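(* Let $p$ be a prime and let $q$ be a power of $p$. Let $\gamma$ be the greatest common divisor of $3$ and $q+1$, and let $$\Gamma:=\{x\in\mathbb F_{q^2}\mid x^{\gamma}=1\},\quad \Psi:=\{x\in\mathbb F_{q^2}\mid x^{q+1}=1\},\quad \mathrm L:=\{a^\gamma\mid a\in\mathbb F_{q^2}^\times\}.$$ Let $\mathfrak U:=\mathbb F_{q^2}^\times/\Gamma$, let $\mathfrak V:=\Psi/\Gamma$ and let $\mathfrak W:=\mathbb F_{q^2}^\times/\mathrm L$. Let $k$ be a field of characteristic $p>0$ and let $N$ be the normaliser of a Sylow $p$-subgroup of $PSU(3,q)$. Then $$Z(kN)\simeq k[T,X_n,Y_m\mid n\in\mathfrak W,\ m\in\mathfrak U]/I,$$ where $I$ is the ideal generated by $$T^2,\quad TX_{n_1},\quad TY_{m_1},\quad X_{n_1}X_{n_2},\quad X_{n_1}Y_{m_1},\quad Y_{m_1}Y_{m_2},$$ $$X_{n_1}Y_{m_2}+\frac1\gamma Y_{m_2}T,\qquad Y_{m_2}Y_{m_3}-(1-\delta_{m_2,m_3^{-1}})\,Y_{m_2m_3}T,$$ where $n_1,n_2\in\mathfrak W$, $m_1\in\mathfrak U-\mathfrak V$, $m_2,m_3\in\mathfrak V$, and $\delta_{a,b}$ is the Kronecker symbol.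
   Context: $PSU(3,q)$ denotes the projective special unitary group of a non-degenerate hermitian form on a $3$-dimensional vector space over the field $\mathbb F_{q^2}$ with $q^2$ elements. $kN$ is the group algebra of $N$ over $k$ and $Z(kN)$ is its centre. $\mathfrak V$ is regarded as a subgroup of $\mathfrak U$, and $\mathfrak U-\mathfrak V$ is the set of elements of $\mathfrak U$ not in $\mathfrak V$.
   Formalization: As printed the quotient is too large (infinite-dimensional if q>2; dimension 7 instead of 5 if q=2). Corrected: the variables Y_m, and the indices m_2, m_3, omit the identity, and Y_{m_1}Y_m=0 is imposed for m_1 in U−V and all m≠1 in U, not only m in V. *)

theory Defs
  imports
    "HOL-Analysis.Determinants"
    "HOL-Library.Poly_Mapping"
    "HOL-Computational_Algebra.Primes"
    "HOL-Algebra.Module"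
    "HOL-Algebra.QuotRing"
    "HOL-Algebra.Group_Action"
begin

section \<open>The projective special unitary group of a hermitian form\<close>

text \<open>Semilinearity in the second argument follows from the hermitian symmetry, since
  \<open>a \<mapsto> a ^ q\<close> is the involutory automorphism of a field with \<open>q\<^sup>2\<close> elements.\<close>

definition nondegenerate_hermitian_form ::
    "nat \<Rightarrow> ('f::field ^ 'n \<Rightarrow> 'f ^ 'n \<Rightarrow> 'f) \<Rightarrow> bool" where
  "nondegenerate_hermitian_form q h \<longleftrightarrow>
     (\<forall>x y z. h (x + y) z = h x z + h y z) \<and>
     (\<forall>a x y. h (a *s x) y = a * h x y) \<and>
     (\<forall>x y. h y x = h x y ^ q) \<and>
     (\<forall>x. (\<forall>y. h x y = 0) \<longrightarrow> x = 0)"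

definition SU :: "('f::field ^ 'n \<Rightarrow> 'f ^ 'n \<Rightarrow> 'f) \<Rightarrow> ('f ^ 'n ^ 'n) monoid" where
  "SU h = \<lparr>carrier = {A. det A = 1 \<and> (\<forall>x y. h (A *v x) (A *v y) = h x y)},
           mult = (**), one = mat 1\<rparr>"

definition PSU :: "('f::field ^ 'n \<Rightarrow> 'f ^ 'n \<Rightarrow> 'f) \<Rightarrow> ('f ^ 'n ^ 'n) set monoid" where
  "PSU h = SU h Mod {A \<in> carrier (SU h). \<exists>c. A = mat c}"

definition sylow_subgroup :: "nat \<Rightarrow> ('g, 'c) monoid_scheme \<Rightarrow> 'g set \<Rightarrow> bool" where
  "sylow_subgroup p G P \<longleftrightarrow> subgroup P G \<and> card P = p ^ multiplicity p (order G)"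

section \<open>Algebras over a field\<close>

text \<open>An algebra over the field \<open>'k\<close> is a \<^typ>\<open>('k, 'a) module\<close> record; every scalar in \<open>'k\<close> acts.\<close>

definition algebra_isomorphic :: "('k, 'a) module \<Rightarrow> ('k, 'b) module \<Rightarrow> bool" where
  "algebra_isomorphic A B \<longleftrightarrow>
     (\<exists>\<phi> \<in> ring_iso A B. \<forall>c. \<forall>x \<in> carrier A. \<phi> (c \<odot>\<^bsub>A\<^esub> x) = c \<odot>\<^bsub>B\<^esub> \<phi> x)"

definition centre_algebra :: "('k, 'a) module \<Rightarrow> ('k, 'a) module" where
  "centre_algebra A =
     A\<lparr>carrier := {z \<in> carrier A. \<forall>x \<in> carrier A. z \<otimes>\<^bsub>A\<^esub> x = x \<otimes>\<^bsub>A\<^esub> z}\<rparr>"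

definition quotient_algebra :: "('k, 'a) module \<Rightarrow> 'a set \<Rightarrow> ('k, 'a set) module" where
  "quotient_algebra A I = ring.extend (A Quot I)
     (module.fields (\<lambda>c S. \<Union>x \<in> S. I +>\<^bsub>A\<^esub> (c \<odot>\<^bsub>A\<^esub> x)))"

text \<open>Elements of the group algebra are finitely supported functions on the group. The product
  is spelled out because the library product of \<^type>\<open>poly_mapping\<close> is convolution with respect
  to a type-class addition on the index type.\<close>

definition group_algebra :: "('g, 'c) monoid_scheme \<Rightarrow> ('k::field, 'g \<Rightarrow>\<^sub>0 'k) module" where
  "group_algebra G =
     \<lparr>carrier = {f. Poly_Mapping.keys f \<subseteq> carrier G},
      mult = (\<lambda>f g. \<Sum>x \<in> Poly_Mapping.keys f. \<Sum>y \<in> Poly_Mapping.keys g.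
                Poly_Mapping.single (x \<otimes>\<^bsub>G\<^esub> y)
                  (Poly_Mapping.lookup f x * Poly_Mapping.lookup g y)),
      one = Poly_Mapping.single \<one>\<^bsub>G\<^esub> 1,
      ring.zero = 0,
      ring.add = (+),
      smult = (\<lambda>c f. Poly_Mapping.map (\<lambda>a. c * a) f)\<rparr>"

text \<open>The polynomial algebra \<open>k[v | v \<in> S]\<close>. A monomial is a finitely supported exponent function
  \<open>'v \<Rightarrow>\<^sub>0 nat\<close>, and the library product on \<open>('v \<Rightarrow>\<^sub>0 nat) \<Rightarrow>\<^sub>0 'k\<close> is the product of polynomials.\<close>

definition polynomial_algebra :: "'v set \<Rightarrow> ('k::field, ('v \<Rightarrow>\<^sub>0 nat) \<Rightarrow>\<^sub>0 'k) module" where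
  "polynomial_algebra S =
     \<lparr>carrier = {f. \<forall>m \<in> Poly_Mapping.keys f. Poly_Mapping.keys m \<subseteq> S},
      mult = (*),
      one = 1,
      ring.zero = 0,
      ring.add = (+),
      smult = (\<lambda>c f. Poly_Mapping.map (\<lambda>a. c * a) f)\<rparr>"

definition Const :: "'k::field \<Rightarrow> ('v \<Rightarrow>\<^sub>0 nat) \<Rightarrow>\<^sub>0 'k" where
  "Const c = Poly_Mapping.single 0 c"

definition Var :: "'v \<Rightarrow> ('v \<Rightarrow>\<^sub>0 nat) \<Rightarrow>\<^sub>0 'k::field" where
  "Var v = Poly_Mapping.single (Poly_Mapping.single v 1) 1"

section \<open>The index groups and the presentation\<close>

definition gam :: "nat \<Rightarrow> nat" where
  "gam q = gcd 3 (q + 1)"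

definition Gam :: "nat \<Rightarrow> 'f::field set" where
  "Gam q = {x. x ^ gam q = 1}"

definition Psi :: "nat \<Rightarrow> 'f::field set" where
  "Psi q = {x. x ^ (q + 1) = 1}"

definition Lset :: "nat \<Rightarrow> 'f::field set" where
  "Lset q = {a ^ gam q | a. a \<noteq> 0}"

definition field_units :: "'f::field monoid" where
  "field_units = \<lparr>carrier = UNIV - {0}, mult = (*), one = 1\<rparr>"

definition Ugrp :: "nat \<Rightarrow> 'f::field set monoid" where
  "Ugrp q = field_units Mod Gam q"

definition Vgrp :: "nat \<Rightarrow> 'f::field set monoid" where
  "Vgrp q = field_units\<lparr>carrier := Psi q\<rparr> Mod Gam q"

definition Wgrp :: "nat \<Rightarrow> 'f::field set monoid" where
  "Wgrp q = field_units Mod Lset q"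

datatype 'i variable = VarT | VarX 'i | VarY 'i

abbreviation pT :: "('i variable \<Rightarrow>\<^sub>0 nat) \<Rightarrow>\<^sub>0 'k::field" where
  "pT \<equiv> Var VarT"

abbreviation pX :: "'i \<Rightarrow> ('i variable \<Rightarrow>\<^sub>0 nat) \<Rightarrow>\<^sub>0 'k::field" where
  "pX n \<equiv> Var (VarX n)"

abbreviation pY :: "'i \<Rightarrow> ('i variable \<Rightarrow>\<^sub>0 nat) \<Rightarrow>\<^sub>0 'k::field" where
  "pY m \<equiv> Var (VarY m)"

abbreviation kronecker :: "'i \<Rightarrow> 'i \<Rightarrow> 'k::field" where
  "kronecker a b \<equiv> (if a = b then 1 else 0)"

text \<open>There is no variable \<open>pY m\<close> for the identity \<open>m\<close> of \<open>Ugrp q\<close>. It would be an additional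
  minimal generator with no counterpart in \<open>Z(kN)\<close>: the conjugacy classes of \<open>N\<close> contained in the
  Sylow subgroup are already accounted for by \<open>1\<close>, \<open>pT\<close> and the \<open>pX n\<close>. Accordingly the Kronecker
  symbol below removes exactly the term in which \<open>pY\<close> would carry the identity as index.\<close>

definition variables :: "nat \<Rightarrow> 'f::field set variable set" where
  "variables q = {VarT} \<union> VarX ` carrier (Wgrp q) \<union> VarY ` (carrier (Ugrp q) - {\<one>\<^bsub>Ugrp q\<^esub>})"

text \<open>The products \<open>pY m1 * pY m\<close> with \<open>m1\<close> outside \<open>Vgrp q\<close> are relations for every \<open>m\<close>, not only for
  \<open>m\<close> in \<open>Vgrp q\<close>; otherwise no power of \<open>pY m1\<close> would lie in the ideal, and the quotient would
  have infinite dimension for \<open>q > 2\<close>.\<close>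

definition relations ::
    "nat \<Rightarrow> (('f::field set variable \<Rightarrow>\<^sub>0 nat) \<Rightarrow>\<^sub>0 'k::field) set" where
  "relations q =
    (let W = carrier (Wgrp q);
         U' = carrier (Ugrp q) - {\<one>\<^bsub>Ugrp q\<^esub>};
         V' = carrier (Vgrp q) - {\<one>\<^bsub>Ugrp q\<^esub>};
         D = carrier (Ugrp q) - carrier (Vgrp q)
     in {pT ^ 2}
      \<union> {pT * pX n1 | n1. n1 \<in> W}
      \<union> {pT * pY m1 | m1. m1 \<in> D}
      \<union> {pX n1 * pX n2 | n1 n2. n1 \<in> W \<and> n2 \<in> W}
      \<union> {pX n1 * pY m1 | n1 m1. n1 \<in> W \<and> m1 \<in> D}
      \<union> {pY m1 * pY m | m1 m. m1 \<in> D \<and> m \<in> U'}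
      \<union> {pX n1 * pY m2 + Const (1 / of_nat (gam q)) * pY m2 * pT | n1 m2. n1 \<in> W \<and> m2 \<in> V'}
      \<union> {pY m2 * pY m3
           - Const (1 - kronecker m2 (inv\<^bsub>Ugrp q\<^esub> m3)) * pY (m2 \<otimes>\<^bsub>Ugrp q\<^esub> m3) * pT
         | m2 m3. m2 \<in> V' \<and> m3 \<in> V'})"

end

theory Submission
  imports Defs "HOL-Computational_Algebra.Polynomial" "HOL-Number_Theory.Residues"
begin

text \<open>The isotropic vectors together with \<open>0\<close> are a multiple of \<open>q\<close> in
  number, so the preimage in \<open>SU\<close> of a Sylow \<open>p\<close>-subgroup \<open>P\<close> has on the nonzero ones an orbit of
  size prime to \<open>p\<close>, hence of size at most \<open>\<gamma>\<close>, and \<open>P\<close> fixes an isotropic line. Comparing orders, \<open>P\<close>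
  is the group of all unipotent elements fixing that line, and its normaliser \<open>N\<close> is the stabiliser
  of the line. The elements of \<open>N\<close> are \<open>E a b t\<close> with \<open>t \<noteq> 0\<close> taken modulo the scalars \<open>\<Gamma>\<close> and
  \<open>b + b\<^sup>q + a\<^sup>q\<^sup>+\<^sup>1 = 0\<close>; the torus element \<open>t\<close> acts on \<open>a\<close> through \<open>\<chi>(t) = t\<^sup>2\<^sup>-\<^sup>q\<close> and on \<open>b\<close> through the norm
  \<open>t\<^sup>q\<^sup>+\<^sup>1\<close>. The kernel of \<open>\<chi>\<close> is \<open>\<Gamma>\<close> and its image is \<open>L\<close>.

  Send \<open>T\<close> to the sum over \<open>Z = {E 0 b 1}\<close>, \<open>X\<^sub>n\<close> to the sum over the class \<open>{E a b 1 | a \<in> n}\<close>, and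
  \<open>Y\<^sub>m\<close> to the sum over the class of \<open>E 0 0 t\<close>, where \<open>t \<in> m\<close>. Unless \<open>m\<close> lies in \<open>V\<close> the class is
  invariant under \<open>Z\<close>, and products of \<open>Z\<close>-invariant sums vanish in characteristic \<open>p\<close>. For \<open>m \<in> V\<close>
  the class meets every coset of \<open>Z\<close> in \<open>P t\<close> exactly once, and the coefficients of \<open>Y\<^sub>m Y\<^sub>m\<^sub>'\<close> count the
  solutions of an equation which becomes, after completing a square, a norm equation with \<open>1\<close> or
  \<open>q + 1\<close> solutions if \<open>m m' \<noteq> 1\<close>, and a trace equation whose number of solutions is divisible by \<open>q\<close>
  if \<open>m m' = 1\<close>. Modulo the relations every polynomial is a combination of \<open>1\<close>, \<open>T\<close>, \<open>X\<^sub>n\<close>, \<open>Y\<^sub>m\<close> and \<open>Y\<^sub>m T\<close>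
  with \<open>m \<in> V\<close> in the last case, and the images of these are a basis of the class functions.\<close>

section \<open>Finite fields with a quadratic Frobenius\<close>

text \<open>The constants in the relations are counts read modulo \<open>p\<close>. The classes
  behind \<open>X_n\<close> have \<open>card (Lset q) = (q ^ 2 - 1) / gam q\<close> values of
  \<open>a\<close>, which is \<open>- 1 / gam q\<close> in \<open>k\<close>. Multiplied by the class
  of a torus element over \<open>V\<close>, each value of \<open>a\<close> yields the whole coset
  exactly once, and the sum over that coset is the image of \<open>Y_m T\<close>. In
  \<open>Y_m Y_m'\<close> the counts \<open>1\<close> and \<open>q + 1\<close> agree in
  \<open>k\<close>, so again a full coset sum appears. All of this uses only the multiplication rule
  and the equality criterion of the symbols \<open>E a b t\<close>. It is therefore carried out in
  an abstract group with such coordinates, and matrices serve only to equip the normaliser with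
  them. The orbit argument takes place in \<open>SU\<close> because \<open>PSU\<close> does not act
  on vectors. The price is a factor \<open>gam q\<close> in the group order, and the scalars pay it
  back: they already give \<open>gam q\<close> points of the small orbit, so that orbit lies on one
  line. The Sylow subgroup is then pinned from both sides: a subgroup of order \<open>q ^ 3\<close>
  bounds its order from below, and the fixed line places it inside such a subgroup.\<close>

text \<open>The double count \<open>card A = (\<Sum>c\<in>B. card (fibre of c))\<close> leaves no room for a fibre with fewer than
  \<open>n\<close> elements. Applied to power, norm and trace maps it gives their exact images and fibres.\<close>

lemma card_fibre_eq:
  fixes f :: "'a \<Rightarrow> 'b"
  assumes fin: "finite A" "finite B" and im: "f ` A \<subseteq> B"
    and card: "card A = m * n" "card B \<le> m"
    and fib: "\<And>b. b \<in> B \<Longrightarrow> card {a \<in> A. f a = b} \<le> n"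
    and "b \<in> B"
  shows "card {a \<in> A. f a = b} = n"
proof (rule ccontr)
  assume "card {a \<in> A. f a = b} \<noteq> n"
  hence lt: "card {a \<in> A. f a = b} < n" using fib[OF \<open>b \<in> B\<close>] by simp
  have "card A = (\<Sum>c\<in>B. card {a \<in> A. f a = c})"
    using sum.group[OF fin im, of "\<lambda>_. 1::nat"] by simp
  also have "\<dots> < (\<Sum>c\<in>B. n)"
    by (rule sum_strict_mono_ex1) (use fin fib lt \<open>b \<in> B\<close> in auto)
  also have "\<dots> \<le> m * n" using card by simp
  finally show False using card by simp
qed

text \<open>Subtracting \<open>P\<close> leaves a monic polynomial of degree \<open>d\<close>. A
  constant \<open>P\<close> bounds the fibres of power maps, a linear one those of
  \<open>x ^ q + s * x\<close>; these are the upper bounds that the double count turns into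
  equalities.\<close>

lemma card_roots_power_eq_poly:
  fixes P :: "'a::{field} poly"
  assumes "Polynomial.degree P < d"
  shows "finite {x. x ^ d = poly P x}" "card {x. x ^ d = poly P x} \<le> d"
proof -
  let ?Q = "Polynomial.monom 1 d - P"
  have c: "Polynomial.coeff ?Q d = 1" using assms by (simp add: Polynomial.coeff_eq_0)
  hence nz: "?Q \<noteq> 0" by (metis Polynomial.coeff_0 zero_neq_one)
  have "Polynomial.degree ?Q \<le> d"
    using assms by (intro Polynomial.degree_diff_le) (auto simp: Polynomial.degree_monom_eq)
  moreover have "{x. x ^ d = poly P x} = {x. poly ?Q x = 0}" by (auto simp: poly_monom)
  ultimately show "finite {x. x ^ d = poly P x}" "card {x. x ^ d = poly P x} \<le> d"
    using card_poly_roots_bound[OF nz] poly_roots_finite[OF nz] by auto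
qed

text \<open>The weight of the diagonal matrix with entries \<open>t\<close>, \<open>t\<^sup>q\<^sup>-\<^sup>1\<close>, \<open>t\<^sup>-\<^sup>q\<close> on the unipotent group modulo its centre.\<close>

definition chi :: "nat \<Rightarrow> 'f::field \<Rightarrow> 'f" where
  "chi q t = t ^ 2 / t ^ q"

locale quadratic_field =
  fixes p r q :: nat and F :: "'f::{field,finite} itself"
  assumes prime_p: "Factorial_Ring.prime p" and r_pos: "0 < r" and q_def: "q = p ^ r"
    and card_F: "CARD('f) = q ^ 2"
begin

lemma q_ge_2: "2 \<le> q"
  using prime_ge_2_nat[OF prime_p] r_pos self_le_power[of p r] by (simp add: q_def)

lemma p_dvd_q: "p dvd q" using r_pos by (simp add: q_def)

lemma char_F: "CHAR('f) = p"
proof -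
  have "CHAR('f) dvd p ^ (r * 2)"
    using CHAR_dvd_CARD[where 'a = 'f] card_F by (simp add: q_def power_mult)
  moreover have "Factorial_Ring.prime CHAR('f)"
    by (simp add: prime_CHAR_semidom finite_imp_CHAR_pos)
  ultimately show ?thesis
    using prime_p by (meson prime_dvd_power primes_dvd_imp_eq)
qed

lemma frob_add: "(x + y :: 'f) ^ q = x ^ q + y ^ q"
  using freshmans_dream'[where 'a = 'f, of "p ^ r" r x y] prime_p char_F by (simp add: q_def)

lemma frob_minus: "(- x :: 'f) ^ q = - (x ^ q)"
proof -
  have "x ^ q + (- x) ^ q = 0"
    using q_ge_2 by (subst frob_add [symmetric]) (simp add: power_0_left)
  thus ?thesis by (simp add: add_eq_0_iff)
qed

lemma frob_diff: "(x - y :: 'f) ^ q = x ^ q - y ^ q"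
  using frob_add[of x "-y"] by (simp add: frob_minus)

lemma frob_zero [simp]: "(0 :: 'f) ^ q = 0"
  using q_ge_2 by (simp add: power_0_left)

lemma zero_frob_iff [simp]: "(x :: 'f) ^ q = 0 \<longleftrightarrow> x = 0"
  using q_ge_2 by simp

lemma card_units: "card (UNIV - {0 :: 'f}) = q ^ 2 - 1"
  using card_F by (simp add: card_Diff_singleton)

text \<open>Multiplication by \<open>x\<close> permutes the nonzero elements and so preserves their
  product.\<close>

lemma pow_card_units: "(x :: 'f) \<noteq> 0 \<Longrightarrow> x ^ (q ^ 2 - 1) = 1"
proof -
  assume x: "x \<noteq> 0"
  let ?P = "\<Prod>y\<in>UNIV - {0 :: 'f}. y"
  have "?P = (\<Prod>y\<in>UNIV - {0}. x * y)"
    by (rule prod.reindex_bij_witness[of _ "\<lambda>y. x * y" "\<lambda>y. y / x"]) (use x in auto)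
  also have "\<dots> = x ^ (q ^ 2 - 1) * ?P"
    by (simp add: prod.distrib card_units)
  finally show ?thesis by simp
qed

lemma pow_card: "(x :: 'f) ^ (q ^ 2) = x"
proof (cases "x = 0")
  case False
  have "x ^ (q ^ 2) = x * x ^ (q ^ 2 - 1)"
    using q_ge_2 by (simp flip: power_Suc)
  thus ?thesis using pow_card_units[OF False] by simp
qed (use q_ge_2 in simp)

lemma frob_frob [simp]: "((x :: 'f) ^ q) ^ q = x"
  using pow_card[of x] by (simp add: power2_eq_square power_mult)

lemmas frob_simps = frob_add frob_diff frob_minus power_mult_distrib power_divide

section \<open>Fibres of power, norm and trace maps\<close>

lemma q_sq: "q ^ 2 - 1 = (q - 1) * (q + 1)"
  by (cases q) (simp_all add: power2_eq_square)

text \<open>The \<open>d * e\<close> units are mapped into the at most \<open>e\<close> roots of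
  \<open>x ^ e = 1\<close> with at most \<open>d\<close> in each fibre, so every one of these bounds
  is attained.\<close>

lemma card_units_fibre:
  assumes de: "d * e = q ^ 2 - 1" and c: "(c :: 'f) ^ e = 1"
  shows "card {x :: 'f. x ^ d = c} = d"
proof -
  have q4: "q ^ 2 \<ge> 4" using power_mono[OF q_ge_2, of 2] by simp
  hence pos: "0 < d" "0 < e" using de by (cases "d = 0"; cases "e = 0"; simp)+
  have c0: "c \<noteq> 0" using c pos by (auto simp: power_0_left)
  have bd: "card {x :: 'f. x ^ k = z} \<le> k" if "0 < k" for k z
    using card_roots_power_eq_poly(2)[of "[:z:]" k] that by simp
  have "card {x \<in> UNIV - {0 :: 'f}. x ^ d = c} = d"
  proof (rule card_fibre_eq[where B = "{x. x ^ e = 1}" and m = e])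
    show "card {a \<in> UNIV - {0 :: 'f}. a ^ d = b} \<le> d" for b
      by (rule order.trans[OF card_mono bd[OF pos(1), of b]]) auto
    show "(\<lambda>x. x ^ d) ` (UNIV - {0}) \<subseteq> {x :: 'f. x ^ e = 1}"
      using pow_card_units by (auto simp: de simp flip: power_mult)
  qed (use pos bd[of e 1] c card_units de in \<open>auto simp: mult.commute\<close>)
  moreover have "{x \<in> UNIV - {0 :: 'f}. x ^ d = c} = {x. x ^ d = c}"
    using pos c0 by (auto simp: power_0_left)
  ultimately show ?thesis by simp
qed

lemma card_norm_fibre:
  assumes "(c :: 'f) ^ q = c"
  shows "card {x :: 'f. x ^ (q + 1) = c} = (if c = 0 then 1 else q + 1)"
proof (cases "c = 0")
  case False
  have "c * c ^ (q - 1) = c ^ q" using q_ge_2 by (simp flip: power_Suc)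
  hence "c ^ (q - 1) = 1" using assms False by simp
  from card_units_fibre[OF _ this, of "q + 1"] False show ?thesis
    unfolding q_sq by (simp only: mult.commute if_False)
qed (use q_ge_2 in simp)

lemma norm_surj: "(c :: 'f) ^ q = c \<Longrightarrow> \<exists>x :: 'f. x ^ (q + 1) = c"
  using card_norm_fibre[of c] by (metis (mono_tags, lifting) Collect_empty_eq card.empty
      add_is_0 zero_neq_one)

text \<open>\<open>s = 1\<close> is the trace, \<open>s = - 1\<close> the map
  \<open>x ^ q - x\<close>. Since \<open>s * s = 1\<close>, the image lies in the set of
  \<open>x\<close> with \<open>x ^ q = s * x\<close>, which has at most \<open>q\<close> elements,
  and so do the fibres; the domain has \<open>q ^ 2\<close>.\<close>

lemma card_additive_fibre:
  assumes s: "s = 1 \<or> s = - 1" and d: "(d :: 'f) ^ q = s * d"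
  shows "card {x :: 'f. x ^ q + s * x = d} = q"
proof -
  have bd: "card {x :: 'f. x ^ q = z + y * x} \<le> q" for y z
    using card_roots_power_eq_poly(2)[of "[:z, y:]" q] q_ge_2 by (auto simp: mult.commute split: if_splits)
  have "card {x \<in> UNIV. x ^ q + s * x = d} = q"
  proof (rule card_fibre_eq[where B = "{x. x ^ q = s * x}" and m = q])
    show "card {a \<in> UNIV. (a :: 'f) ^ q + s * a = b} \<le> q" for b
      using bd[of b "- s"] by (simp add: eq_diff_eq)
    show "(\<lambda>x. x ^ q + s * x) ` UNIV \<subseteq> {x :: 'f. x ^ q = s * x}"
      using s by (auto simp: frob_simps)
  qed (use d bd[of 0 s] q_ge_2 card_F in \<open>auto simp: power2_eq_square\<close>)
  thus ?thesis by simp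
qed

lemma trace_surj: "(d :: 'f) ^ q = d \<Longrightarrow> \<exists>x :: 'f. x + x ^ q = d"
proof -
  assume "d ^ q = d"
  hence "card {x :: 'f. x ^ q + 1 * x = d} = q" by (intro card_additive_fibre) auto
  hence "{x :: 'f. x ^ q + 1 * x = d} \<noteq> {}" using q_ge_2 by (metis card.empty not_numeral_le_zero)
  thus ?thesis by (auto simp: add.commute)
qed

text \<open>Divisibility survives the degenerate cases: for \<open>c = 0\<close> the solutions are
  everything or nothing, and a right-hand side outside the image has no solution. The coefficient
  does vanish in some of the later counts.\<close>

lemma dvd_card_additive_fibre:
  assumes s: "s = 1 \<or> s = - 1"
  shows "q dvd card {x :: 'f. (c * x) ^ q + s * (c * x) = d}"
proof (cases "c = 0")
  case True
  thus ?thesis using card_F by (cases "d = 0") (auto simp: power2_eq_square)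
next
  case False
  have eq: "card {x :: 'f. (c * x) ^ q + s * (c * x) = d} = card {x :: 'f. x ^ q + s * x = d}"
    by (rule bij_betw_same_card[of "\<lambda>x. c * x"], rule bij_betw_byWitness[where f' = "\<lambda>x. x / c"])
       (use False in auto)
  show ?thesis
  proof (cases "d ^ q = s * d")
    case True
    thus ?thesis using card_additive_fibre[OF s True] eq by simp
  next
    case False
    have "{x :: 'f. x ^ q + s * x = d} = {}" using s False by (auto simp: frob_simps)
    thus ?thesis using eq by simp
  qed
qed

section \<open>The torus character \<open>chi\<close>: kernel \<open>Gam q\<close>, image
  \<open>Lset q\<close>\<close>

lemma gam_cases: "gam q = 1 \<or> gam q = 3"
proof -
  have "gam q dvd 3" by (simp add: gam_def)
  moreover have "Factorial_Ring.prime (3 :: nat)" by simp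
  ultimately show ?thesis by (meson prime_nat_iff)
qed

lemma gam_dvd: "gam q dvd q + 1"
  by (simp add: gam_def)

lemma Gam_subset_Psi: "Gam q \<subseteq> (Psi q :: 'f set)"
  using gam_dvd by (auto simp: Gam_def Psi_def elim!: dvdE simp: power_mult simp del: power_Suc)

lemma gam_dvd_card: "gam q dvd q ^ 2 - 1"
  using gam_dvd by (metis dvd_mult q_sq)

lemma card_Gam: "card (Gam q :: 'f set) = gam q"
  using card_units_fibre[of "gam q" "(q ^ 2 - 1) div gam q" 1] gam_dvd_card by (simp add: Gam_def)

lemma Gam_nonzero: "(x :: 'f) \<in> Gam q \<Longrightarrow> x \<noteq> 0"
  using gam_cases by (auto simp: Gam_def)

lemma Psi_nonzero: "(x :: 'f) \<in> Psi q \<Longrightarrow> x \<noteq> 0"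
  by (auto simp: Psi_def)

lemma Lset_nonzero: "(x :: 'f) \<in> Lset q \<Longrightarrow> x \<noteq> 0"
  by (auto simp: Lset_def)

lemma chi_mult: "chi q (s * t :: 'f) = chi q s * chi q t"
  by (simp add: chi_def power_mult_distrib)

lemma chi_one [simp]: "chi q (1 :: 'f) = 1"
  by (simp add: chi_def)

lemma chi_divide: "chi q (s / t :: 'f) = chi q s / chi q t"
  by (simp add: chi_def power_divide)

lemma chi_eq_0_iff [simp]: "chi q (t :: 'f) = 0 \<longleftrightarrow> t = 0"
  by (auto simp: chi_def)

lemma chi_power: "chi q ((t :: 'f) ^ n) = chi q t ^ n"
  by (induction n) (simp_all add: chi_mult)

lemma mem_Psi_iff: "(x :: 'f) \<in> Psi q \<longleftrightarrow> x * x ^ q = 1"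
  by (simp add: Psi_def)

text \<open>The factor by which the torus scales \<open>b\<close> is thus the norm of the factor by
  which it scales \<open>a\<close>, as preservation of \<open>herm\<close> demands.\<close>

lemma chi_norm: "(t :: 'f) \<noteq> 0 \<Longrightarrow> chi q t * chi q t ^ q = t * t ^ q"
  by (simp add: chi_def power_divide power_mult_distrib mult.commute[of 2] power2_eq_square
        field_simps)

text \<open>The exponent is \<open>(2 - q) * (q + 2) = 4 - q ^ 2\<close>, and
  \<open>t ^ (q ^ 2) = t\<close> turns it into \<open>3\<close>.\<close>

lemma chi_power_q_plus_2: "(t :: 'f) \<noteq> 0 \<Longrightarrow> chi q (t ^ (q + 2)) = t ^ 3"
  by (simp add: chi_def power_add power_mult_distrib frob_frob power2_eq_square power3_eq_cube
        field_simps)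

text \<open>If \<open>t ^ q = t ^ 2\<close>, the previous identity gives \<open>t ^ 3 = 1\<close>,
  hence also \<open>t ^ (q + 1) = 1\<close>, and the order of \<open>t\<close> divides the greatest
  common divisor of the two exponents.\<close>

lemma chi_eq_1_iff: "(t :: 'f) \<noteq> 0 \<Longrightarrow> chi q t = 1 \<longleftrightarrow> t \<in> Gam q"
proof
  assume t: "t \<noteq> 0" and "t \<in> Gam q"
  hence "t ^ (q + 1) = 1" "t ^ 3 = 1"
    using Gam_subset_Psi gam_cases by (auto simp: Psi_def Gam_def)
  hence "t ^ 2 * t = t ^ q * t" by (simp add: power2_eq_square power3_eq_cube mult.commute)
  thus "chi q t = 1" using t by (simp add: chi_def)
next
  assume t: "t \<noteq> 0" and c: "chi q t = 1"
  have t3: "t ^ 3 = 1" using chi_power_q_plus_2[OF t] chi_power[of t "q + 2"] c by simp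
  have tq: "t ^ q = t ^ 2" using c t by (simp add: chi_def)
  hence tq1: "t ^ (q + 1) = 1" using t3 by (simp add: power2_eq_square power3_eq_cube mult.assoc)
  show "t \<in> Gam q"
  proof (cases "gam q = 3")
    case True
    thus ?thesis using t3 by (simp add: Gam_def)
  next
    case False
    hence "coprime 3 (q + 1)" using gam_cases unfolding gam_def by (simp add: coprime_iff_gcd_eq_1)
    then obtain x y where xy: "3 * x = (q + 1) * y + 1"
      using coprime_bezout_strong[of 3 "q + 1"] q_ge_2 by auto
    have "(t ^ 3) ^ x = (t ^ (q + 1)) ^ y * t"
      unfolding power_mult[symmetric] xy by (simp only: power_add power_one_right)
    hence "t = 1" using t3 tq1 by simp
    thus ?thesis by (simp add: Gam_def)
  qed
qed

lemma chi_cong: "(s :: 'f) \<noteq> 0 \<Longrightarrow> t \<noteq> 0 \<Longrightarrow> chi q s = chi q t \<longleftrightarrow> s / t \<in> Gam q"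
  using chi_eq_1_iff[of "s / t"] by (simp add: chi_divide field_simps)

text \<open>If \<open>3\<close> divides \<open>q + 1\<close>, then
  \<open>chi q t = t ^ 3 / t ^ (q + 1)\<close> is visibly a cube, and conversely
  \<open>a ^ 3\<close> is the value of \<open>chi\<close> at \<open>a ^ (q + 2)\<close>. Otherwise
  \<open>chi\<close> has trivial kernel and permutes the finite set of units.\<close>

lemma Lset_eq_chi: "Lset q = chi q ` (UNIV - {0 :: 'f})"
proof (cases "gam q = 3")
  case True
  then obtain j where j: "q + 1 = 3 * j" using gam_dvd by auto
  have "chi q t \<in> Lset q" if "t \<noteq> 0" for t :: 'f
  proof -
    have "(t ^ j) ^ 3 = t ^ q * t"
      by (metis j mult.commute power_mult Suc_eq_plus1 power_Suc2)
    hence "chi q t = (t / t ^ j) ^ 3"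
      using that by (simp add: chi_def power_divide power2_eq_square power3_eq_cube)
    thus ?thesis using that True by (auto simp: Lset_def intro!: exI[of _ "t / t ^ j"])
  qed
  moreover have "a ^ 3 \<in> chi q ` (UNIV - {0})" if "a \<noteq> 0" for a :: 'f
    using chi_power_q_plus_2[OF that] that by (intro image_eqI[where x = "a ^ (q + 2)"]) auto
  ultimately show ?thesis using True by (auto simp: Lset_def)
next
  case False
  hence g: "gam q = 1" using gam_cases by simp
  have "inj_on (chi q) (UNIV - {0 :: 'f})"
  proof (rule inj_onI)
    fix s t :: 'f assume st: "s \<in> UNIV - {0}" "t \<in> UNIV - {0}" "chi q s = chi q t"
    hence "s / t \<in> Gam q" using chi_cong by auto
    thus "s = t" using st by (simp add: Gam_def g)
  qed
  moreover have "chi q ` (UNIV - {0 :: 'f}) \<subseteq> UNIV - {0}" by auto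
  ultimately have "chi q ` (UNIV - {0 :: 'f}) = UNIV - {0}"
    by (simp add: card_subset_eq card_image)
  thus ?thesis by (auto simp: Lset_def g)
qed

text \<open>The fibres of \<open>chi\<close> are the cosets of its kernel
  \<open>Gam q\<close>.\<close>

lemma card_Lset: "card (Lset q :: 'f set) * gam q = q ^ 2 - 1"
proof -
  let ?F = "UNIV - {0 :: 'f}"
  have "card ?F = (\<Sum>c\<in>Lset q. card {a \<in> ?F. chi q a = c})"
    using sum.group[of ?F "Lset q" "chi q" "\<lambda>_. 1::nat"] by (simp add: Lset_eq_chi)
  also have "\<dots> = (\<Sum>c\<in>(Lset q :: 'f set). gam q)"
  proof (rule sum.cong)
    fix c :: 'f assume "c \<in> Lset q"
    then obtain t where t: "t \<noteq> 0" "c = chi q t" by (auto simp: Lset_eq_chi)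
    have "card {a \<in> ?F. chi q a = c} = card (Gam q :: 'f set)"
      by (rule bij_betw_same_card[of "\<lambda>x. x / t"], rule bij_betw_byWitness[where f' = "\<lambda>x. x * t"])
         (use t Gam_nonzero in \<open>auto simp: chi_cong\<close>)
    thus "card {a \<in> ?F. chi q a = c} = gam q" by (simp add: card_Gam)
  qed simp
  finally show ?thesis by (simp add: card_units)
qed

end

section \<open>Group algebras of finite groups\<close>

abbreviation lookup :: "('a \<Rightarrow>\<^sub>0 'b::zero) \<Rightarrow> 'a \<Rightarrow> 'b" where
  "lookup \<equiv> Poly_Mapping.lookup"

abbreviation keys :: "('a \<Rightarrow>\<^sub>0 'b::zero) \<Rightarrow> 'a set" where
  "keys \<equiv> Poly_Mapping.keys"

abbreviation single :: "'a \<Rightarrow> 'b \<Rightarrow> 'a \<Rightarrow>\<^sub>0 'b::zero" where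
  "single \<equiv> Poly_Mapping.single"

lemma keys_subset_iff: "keys f \<subseteq> A \<longleftrightarrow> (\<forall>x. x \<notin> A \<longrightarrow> lookup f x = 0)"
  by (auto simp: in_keys_iff)

lemma lookup_smult [simp]:
  "lookup (Poly_Mapping.map (\<lambda>a. c * a) f) x = c * (lookup f x :: 'k::field)"
  by (simp add: map.rep_eq when_def)

lemma poly_mapping_sum_single: "f = (\<Sum>m\<in>keys f. single m (lookup f m))"
  by (rule poly_mapping_eqI) (auto simp: lookup_sum lookup_single when_def in_keys_iff)

lemma poly_mapping_single_induct [consumes 1, case_names zero add]:
  assumes "keys f \<subseteq> K"
    and "P 0"
    and "\<And>m c g. m \<in> K \<Longrightarrow> keys g \<subseteq> K \<Longrightarrow> P g \<Longrightarrow> P (single m c + g)"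
  shows "P (f :: 'a \<Rightarrow>\<^sub>0 'b::comm_monoid_add)"
proof -
  have "P (\<Sum>m\<in>M. single m (h m)) \<and> keys (\<Sum>m\<in>M. single m (h m)) \<subseteq> K"
    if "finite M" "M \<subseteq> K" for M and h :: "'a \<Rightarrow> 'b"
    using that
  proof (induction M)
    case (insert m M)
    thus ?case
      using assms(3)[of m "\<Sum>m\<in>M. single m (h m)" "h m"]
        Poly_Mapping.keys_add[of "single m (h m)" "\<Sum>m\<in>M. single m (h m)"]
      by (auto split: if_splits)
  qed (use assms(2) in auto)
  from this[of "keys f" "lookup f"] show ?thesis
    using assms(1) poly_mapping_sum_single[of f] by simp
qed

lemma sum_mult_delta:
  fixes f :: "'a \<Rightarrow> 'b::semiring_1"
  assumes "finite S"
  shows "(\<Sum>x\<in>S. f x * (if x = a then 1 else 0)) = (if a \<in> S then f a else 0)"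
    and "(\<Sum>x\<in>S. (if x = a then 1 else 0) * f x) = (if a \<in> S then f a else 0)"
    and "(\<Sum>x\<in>S. (if a = x then 1 else 0) * f x) = (if a \<in> S then f a else 0)"
  using assms by (simp_all add: if_distrib[of "\<lambda>u. _ * u"] if_distrib[of "\<lambda>u. u * _"] cong: if_cong)

locale comm_algebra = cring A for A :: "('k::field, 'a) module" (structure) +
  assumes smult_closed: "x \<in> carrier A \<Longrightarrow> c \<odot> x \<in> carrier A"
    and smult_l_distr: "x \<in> carrier A \<Longrightarrow> (c + d) \<odot> x = c \<odot> x \<oplus> d \<odot> x"
    and smult_r_distr: "x \<in> carrier A \<Longrightarrow> y \<in> carrier A \<Longrightarrow> c \<odot> (x \<oplus> y) = c \<odot> x \<oplus> c \<odot> y"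
    and smult_assoc: "x \<in> carrier A \<Longrightarrow> (c * d) \<odot> x = c \<odot> (d \<odot> x)"
    and smult_one: "x \<in> carrier A \<Longrightarrow> 1 \<odot> x = x"
    and smult_mult: "x \<in> carrier A \<Longrightarrow> y \<in> carrier A \<Longrightarrow> (c \<odot> x) \<otimes> y = c \<odot> (x \<otimes> y)"

section \<open>Convolution over a finite group\<close>

context group
begin

abbreviation convolution :: "('a \<Rightarrow>\<^sub>0 'k::field) \<Rightarrow> ('a \<Rightarrow>\<^sub>0 'k) \<Rightarrow> 'a \<Rightarrow>\<^sub>0 'k" (infixl "\<star>" 70) where
  "f \<star> g \<equiv> f \<otimes>\<^bsub>group_algebra G\<^esub> g"

abbreviation scale :: "'k::field \<Rightarrow> ('a \<Rightarrow>\<^sub>0 'k) \<Rightarrow> 'a \<Rightarrow>\<^sub>0 'k" (infixr "\<cdot>" 75) where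
  "c \<cdot> f \<equiv> c \<odot>\<^bsub>group_algebra G\<^esub> f"

lemma inv_cancel_left: "a \<in> carrier G \<Longrightarrow> b \<in> carrier G \<Longrightarrow> a \<otimes> (inv a \<otimes> b) = b"
  "a \<in> carrier G \<Longrightarrow> b \<in> carrier G \<Longrightarrow> inv a \<otimes> (a \<otimes> b) = b"
  by (simp_all flip: m_assoc)

text \<open>Replacing the double sum over supports by one sum over the whole group makes the ring
  laws reindexings of finite sums.\<close>

lemma lookup_group_algebra_mult:
  fixes f g :: "'a \<Rightarrow>\<^sub>0 'k::field"
  assumes fin: "finite (carrier G)"
    and f: "f \<in> carrier (group_algebra G)" and g: "g \<in> carrier (group_algebra G)"
    and z: "z \<in> carrier G"
  shows "lookup (f \<star> g) z =
    (\<Sum>x\<in>carrier G. lookup f x * lookup g (inv x \<otimes> z))"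
proof -
  have keys: "keys f \<subseteq> carrier G" "keys g \<subseteq> carrier G"
    using f g by (auto simp: group_algebra_def)
  have "lookup (f \<star> g) z =
    (\<Sum>x\<in>keys f. \<Sum>y\<in>keys g.
      if x \<otimes> y = z then lookup f x * lookup g y else 0)"
    by (simp add: group_algebra_def lookup_sum lookup_single when_def)
  also have "\<dots> = (\<Sum>x\<in>keys f. lookup f x * lookup g (inv x \<otimes> z))"
  proof (rule sum.cong)
    fix x assume x: "x \<in> keys f"
    have eq: "x \<otimes> y = z \<longleftrightarrow> y = inv x \<otimes> z" if "y \<in> carrier G" for y
      using that x keys z by (auto simp: inv_cancel_left subset_iff)
    have "(\<Sum>y\<in>keys g. if x \<otimes> y = z then lookup f x * lookup g y else 0)
      = (\<Sum>y\<in>keys g. if y = inv x \<otimes> z then lookup f x * lookup g y else 0)"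
      by (intro sum.cong refl if_cong eq) (use keys in auto)
    also have "\<dots> = lookup f x * lookup g (inv x \<otimes> z)"
      by (auto simp: in_keys_iff)
    finally show "(\<Sum>y\<in>keys g. if x \<otimes> y = z then lookup f x * lookup g y else 0)
      = lookup f x * lookup g (inv x \<otimes> z)" .
  qed simp
  also have "\<dots> = (\<Sum>x\<in>carrier G. lookup f x * lookup g (inv x \<otimes> z))"
    by (rule sum.mono_neutral_left) (use keys fin in \<open>auto simp: in_keys_iff\<close>)
  finally show ?thesis .
qed

lemma group_algebra_mult_closed:
  fixes f g :: "'a \<Rightarrow>\<^sub>0 'k::field"
  assumes "f \<in> carrier (group_algebra G)" "g \<in> carrier (group_algebra G)"
  shows "f \<star> g \<in> carrier (group_algebra G)"
proof -
  have "lookup (f \<star> g) z = 0" if z: "z \<notin> carrier G" for z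
    using assms z by (auto simp: group_algebra_def lookup_sum lookup_single when_def subset_iff intro!: sum.neutral)
  thus ?thesis by (subst group_algebra_def) (simp add: keys_subset_iff)
qed

lemma group_algebra_eqI:
  fixes f g :: "'a \<Rightarrow>\<^sub>0 'k::field"
  assumes "f \<in> carrier (group_algebra G)" "g \<in> carrier (group_algebra G)"
    and "\<And>z. z \<in> carrier G \<Longrightarrow> lookup f z = lookup g z"
  shows "f = g"
  using assms by (intro poly_mapping_eqI) (simp add: group_algebra_def keys_subset_iff, metis)

lemma group_algebra_closed_simps [simp]:
  "f \<in> carrier (group_algebra G) \<Longrightarrow> g \<in> carrier (group_algebra G) \<Longrightarrow> f + g \<in> carrier (group_algebra G)"
  "0 \<in> carrier (group_algebra G)"
  "f \<in> carrier (group_algebra G) \<Longrightarrow> - f \<in> carrier (group_algebra G)"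
  "f \<in> carrier (group_algebra G) \<Longrightarrow> c \<cdot> f \<in> carrier (group_algebra G)"
  "x \<in> carrier G \<Longrightarrow> single x c \<in> carrier (group_algebra G)"
  "\<one>\<^bsub>group_algebra G\<^esub> \<in> carrier (group_algebra G)"
  by (auto simp: group_algebra_def keys_subset_iff lookup_add lookup_single when_def)

lemma group_algebra_add [simp]: "f \<oplus>\<^bsub>group_algebra G\<^esub> g = f + g"
  by (simp add: group_algebra_def)

lemma group_algebra_zero [simp]: "\<zero>\<^bsub>group_algebra G\<^esub> = 0"
  by (simp add: group_algebra_def)

lemma lookup_group_algebra_one:
  "lookup \<one>\<^bsub>group_algebra G\<^esub> x = (if x = \<one> then 1 else 0)"
  by (auto simp: group_algebra_def lookup_single when_def)

lemma lookup_group_algebra_smult [simp]: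
  "lookup (c \<cdot> f) x = (c * lookup f x :: 'k::field)"
  by (simp add: group_algebra_def)

lemma group_algebra_assoc:
  fixes f g h :: "'a \<Rightarrow>\<^sub>0 'k::field"
  assumes fin: "finite (carrier G)" and f: "f \<in> carrier (group_algebra G)"
    and g: "g \<in> carrier (group_algebra G)" and h: "h \<in> carrier (group_algebra G)"
  shows "f \<star> g \<star> h = f \<star> (g \<star> h)"
proof (rule group_algebra_eqI)
  fix z assume z: "z \<in> carrier G"
  let ?l = lookup
  have "?l (f \<star> g \<star> h) z
    = (\<Sum>x\<in>carrier G. (\<Sum>w\<in>carrier G. ?l f w * ?l g (inv w \<otimes> x)) * ?l h (inv x \<otimes> z))"
    using fin f g h z by (simp add: lookup_group_algebra_mult group_algebra_mult_closed cong: sum.cong)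
  also have "\<dots> = (\<Sum>w\<in>carrier G. \<Sum>x\<in>carrier G. ?l f w * ?l g (inv w \<otimes> x) * ?l h (inv x \<otimes> z))"
    by (subst sum.swap) (simp add: sum_distrib_right)
  also have "\<dots> = (\<Sum>w\<in>carrier G. \<Sum>v\<in>carrier G. ?l f w * (?l g v * ?l h (inv v \<otimes> (inv w \<otimes> z))))"
  proof (rule sum.cong)
    fix w assume w: "w \<in> carrier G"
    show "(\<Sum>x\<in>carrier G. ?l f w * ?l g (inv w \<otimes> x) * ?l h (inv x \<otimes> z))
      = (\<Sum>v\<in>carrier G. ?l f w * (?l g v * ?l h (inv v \<otimes> (inv w \<otimes> z))))"
      by (rule sum.reindex_bij_witness[of _ "\<lambda>v. w \<otimes> v" "\<lambda>x. inv w \<otimes> x"])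
         (use w z in \<open>auto simp: m_assoc inv_cancel_left inv_mult_group mult.assoc\<close>)
  qed simp
  also have "\<dots> = ?l (f \<star> (g \<star> h)) z"
    using fin f g h z
    by (simp add: lookup_group_algebra_mult group_algebra_mult_closed sum_distrib_left cong: sum.cong)
  finally show "?l (f \<star> g \<star> h) z
    = ?l (f \<star> (g \<star> h)) z" .
qed (use assms in \<open>simp_all add: group_algebra_mult_closed\<close>)

lemma group_algebra_one_mult:
  fixes f :: "'a \<Rightarrow>\<^sub>0 'k::field"
  assumes fin: "finite (carrier G)" and f: "f \<in> carrier (group_algebra G)"
  shows "\<one>\<^bsub>group_algebra G\<^esub> \<star> f = f"
    and "f \<star> \<one>\<^bsub>group_algebra G\<^esub> = f"
proof -
  let ?l = lookup
  show "\<one>\<^bsub>group_algebra G\<^esub> \<star> f = f"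
  proof (rule group_algebra_eqI)
    fix z assume z: "z \<in> carrier G"
    have "?l (\<one>\<^bsub>group_algebra G\<^esub> \<star> f) z = (\<Sum>x\<in>carrier G. if x = \<one> then ?l f z else 0)"
      using fin f z by (subst lookup_group_algebra_mult) (auto simp: lookup_group_algebra_one sum_mult_delta)
    thus "?l (\<one>\<^bsub>group_algebra G\<^esub> \<star> f) z = ?l f z" using fin by simp
  qed (use f in \<open>simp_all add: group_algebra_mult_closed\<close>)
  show "f \<star> \<one>\<^bsub>group_algebra G\<^esub> = f"
  proof (rule group_algebra_eqI)
    fix z assume z: "z \<in> carrier G"
    have "inv x \<otimes> z = \<one> \<longleftrightarrow> x = z" if "x \<in> carrier G" for x
      using that z by (metis inv_closed inv_equality inv_inv l_inv)
    hence "?l (f \<star> \<one>\<^bsub>group_algebra G\<^esub>) z = (\<Sum>x\<in>carrier G. if x = z then ?l f z else 0)"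
      using fin f z by (subst lookup_group_algebra_mult) (auto simp: lookup_group_algebra_one sum_mult_delta)
    thus "?l (f \<star> \<one>\<^bsub>group_algebra G\<^esub>) z = ?l f z"
      using fin z by simp
  qed (use f in \<open>simp_all add: group_algebra_mult_closed\<close>)
qed

lemma group_algebra_distr:
  fixes f g h :: "'a \<Rightarrow>\<^sub>0 'k::field"
  assumes fin: "finite (carrier G)" and f: "f \<in> carrier (group_algebra G)"
    and g: "g \<in> carrier (group_algebra G)" and h: "h \<in> carrier (group_algebra G)"
  shows "(f + g) \<star> h = f \<star> h + g \<star> h"
    and "h \<star> (f + g) = h \<star> f + h \<star> g"
  by (rule group_algebra_eqI;
      use assms in \<open>simp add: group_algebra_mult_closed lookup_group_algebra_mult lookup_add ring_distribs sum.distrib\<close>)+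

lemma group_algebra_smult_mult:
  fixes f g :: "'a \<Rightarrow>\<^sub>0 'k::field"
  assumes fin: "finite (carrier G)" and f: "f \<in> carrier (group_algebra G)"
    and g: "g \<in> carrier (group_algebra G)"
  shows "(c \<cdot> f) \<star> g = c \<cdot> (f \<star> g)"
    and "f \<star> (c \<cdot> g) = c \<cdot> (f \<star> g)"
  by (rule group_algebra_eqI;
      use assms in \<open>simp add: group_algebra_mult_closed lookup_group_algebra_mult sum_distrib_left mult_ac\<close>)+

lemma centre_algebra_simps [simp]:
  "\<one>\<^bsub>centre_algebra A\<^esub> = \<one>\<^bsub>A\<^esub>" "\<zero>\<^bsub>centre_algebra A\<^esub> = \<zero>\<^bsub>A\<^esub>"
  "x \<otimes>\<^bsub>centre_algebra A\<^esub> y = x \<otimes>\<^bsub>A\<^esub> y" "x \<oplus>\<^bsub>centre_algebra A\<^esub> y = x \<oplus>\<^bsub>A\<^esub> y"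
  "c \<odot>\<^bsub>centre_algebra A\<^esub> x = c \<odot>\<^bsub>A\<^esub> x"
  by (simp_all add: centre_algebra_def)

lemma centre_iff:
  "z \<in> carrier (centre_algebra A) \<longleftrightarrow> z \<in> carrier A \<and> (\<forall>x \<in> carrier A. z \<otimes>\<^bsub>A\<^esub> x = x \<otimes>\<^bsub>A\<^esub> z)"
  by (simp add: centre_algebra_def)

lemma centre_group_algebra_comm_algebra:
  assumes fin: "finite (carrier G)"
  shows "comm_algebra (centre_algebra (group_algebra G :: ('k::field, 'a \<Rightarrow>\<^sub>0 'k) module))"
proof -
  let ?A = "group_algebra G :: ('k::field, 'a \<Rightarrow>\<^sub>0 'k) module"
  let ?Z = "centre_algebra ?A"
  note gc = group_algebra_mult_closed
  note ac = group_algebra_assoc[OF fin]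
  have mc: "x \<otimes>\<^bsub>?A\<^esub> y \<in> carrier ?Z" if x: "x \<in> carrier ?Z" and y: "y \<in> carrier ?Z" for x y
  proof -
    have xy: "x \<in> carrier ?A" "y \<in> carrier ?A" using x y by (auto simp: centre_iff)
    have "x \<otimes>\<^bsub>?A\<^esub> y \<otimes>\<^bsub>?A\<^esub> w = w \<otimes>\<^bsub>?A\<^esub> (x \<otimes>\<^bsub>?A\<^esub> y)" if w: "w \<in> carrier ?A" for w
    proof -
      have "x \<otimes>\<^bsub>?A\<^esub> y \<otimes>\<^bsub>?A\<^esub> w = x \<otimes>\<^bsub>?A\<^esub> (w \<otimes>\<^bsub>?A\<^esub> y)"
        using xy y w by (simp add: ac) (simp add: centre_iff)
      also have "\<dots> = (x \<otimes>\<^bsub>?A\<^esub> w) \<otimes>\<^bsub>?A\<^esub> y" using xy w by (simp add: ac)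
      also have "\<dots> = (w \<otimes>\<^bsub>?A\<^esub> x) \<otimes>\<^bsub>?A\<^esub> y" using x w by (simp add: centre_iff)
      finally show ?thesis using xy w by (simp add: ac)
    qed
    thus ?thesis using xy by (auto simp: centre_iff gc)
  qed
  have zero: "0 \<otimes>\<^bsub>?A\<^esub> x = 0" "x \<otimes>\<^bsub>?A\<^esub> 0 = 0" for x by (simp_all add: group_algebra_def)
  have neg: "- x \<in> carrier ?Z" if x: "x \<in> carrier ?Z" for x
  proof -
    \<comment> \<open>Negatives are scalar multiples, so closure of the centre under negation
      follows from bilinearity.\<close>
    have "- x = (- 1) \<odot>\<^bsub>?A\<^esub> x" by (rule poly_mapping_eqI) simp
    thus ?thesis using x by (auto simp: centre_iff group_algebra_smult_mult[OF fin])
  qed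
  have addc: "x + y \<in> carrier ?Z" if "x \<in> carrier ?Z" "y \<in> carrier ?Z" for x y
    using that by (simp add: centre_iff group_algebra_distr[OF fin])
  have smc: "c \<odot>\<^bsub>?A\<^esub> x \<in> carrier ?Z" if "x \<in> carrier ?Z" for c x
    using that by (simp add: centre_iff group_algebra_smult_mult[OF fin])
  have sub: "x \<in> carrier ?A" if "x \<in> carrier ?Z" for x
    using that by (simp add: centre_iff)
  have "abelian_group ?Z"
  proof (rule abelian_groupI)
    fix x assume "x \<in> carrier ?Z"
    thus "\<exists>y\<in>carrier ?Z. y \<oplus>\<^bsub>?Z\<^esub> x = \<zero>\<^bsub>?Z\<^esub>" using neg by (intro bexI[of _ "- x"]) auto
  qed (simp_all add: addc add.assoc add.commute, simp add: centre_iff zero)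
  moreover have "comm_monoid ?Z"
  proof (rule comm_monoidI)
    fix x y assume xy: "x \<in> carrier ?Z" "y \<in> carrier ?Z"
    show "x \<otimes>\<^bsub>?Z\<^esub> y = y \<otimes>\<^bsub>?Z\<^esub> x"
      using xy(1) sub[OF xy(2)] unfolding centre_algebra_simps centre_iff by metis
  qed (simp_all add: mc ac sub group_algebra_one_mult[OF fin],
       simp add: centre_iff group_algebra_one_mult[OF fin])
  ultimately have "cring ?Z"
    by (rule cringI) (simp add: sub group_algebra_distr(1)[OF fin])
  moreover have "comm_algebra_axioms ?Z"
  proof
    fix x y :: "'a \<Rightarrow>\<^sub>0 'k" and c d assume x: "x \<in> carrier ?Z"
    show "c \<odot>\<^bsub>?Z\<^esub> x \<in> carrier ?Z" using smc[OF x] by simp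
    show "(c + d) \<odot>\<^bsub>?Z\<^esub> x = c \<odot>\<^bsub>?Z\<^esub> x \<oplus>\<^bsub>?Z\<^esub> d \<odot>\<^bsub>?Z\<^esub> x"
      by (rule poly_mapping_eqI) (simp add: lookup_add ring_distribs)
    show "c \<odot>\<^bsub>?Z\<^esub> (x \<oplus>\<^bsub>?Z\<^esub> y) = c \<odot>\<^bsub>?Z\<^esub> x \<oplus>\<^bsub>?Z\<^esub> c \<odot>\<^bsub>?Z\<^esub> y"
      by (rule poly_mapping_eqI) (simp add: lookup_add ring_distribs)
    show "(c * d) \<odot>\<^bsub>?Z\<^esub> x = c \<odot>\<^bsub>?Z\<^esub> (d \<odot>\<^bsub>?Z\<^esub> x)"
      by (rule poly_mapping_eqI) (simp add: mult.assoc)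
    show "1 \<odot>\<^bsub>?Z\<^esub> x = x"
      by (rule poly_mapping_eqI) simp
    assume y: "y \<in> carrier ?Z"
    show "c \<odot>\<^bsub>?Z\<^esub> x \<otimes>\<^bsub>?Z\<^esub> y = c \<odot>\<^bsub>?Z\<^esub> (x \<otimes>\<^bsub>?Z\<^esub> y)"
      by (simp add: sub x y group_algebra_smult_mult[OF fin])
  qed
  ultimately show ?thesis by (rule comm_algebra.intro)
qed

section \<open>Class sums and a criterion for centrality\<close>

definition formal_sum :: "'a set \<Rightarrow> 'a \<Rightarrow>\<^sub>0 'k::field" where
  "formal_sum C = (\<Sum>x\<in>C. single x 1)"

lemma lookup_formal_sum: "finite C \<Longrightarrow> lookup (formal_sum C) x = (if x \<in> C then 1 else 0)"
  by (simp add: formal_sum_def lookup_sum lookup_single when_def)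

lemma formal_sum_closed: "finite (carrier G) \<Longrightarrow> C \<subseteq> carrier G \<Longrightarrow> formal_sum C \<in> carrier (group_algebra G)"
  using finite_subset[of C "carrier G"]
  by (auto simp: group_algebra_def keys_subset_iff lookup_formal_sum)

text \<open>Structure constants are numbers of factorisations; every product relation below becomes
  a count modulo \<open>p\<close>.\<close>

lemma lookup_formal_sum_mult:
  assumes fin: "finite (carrier G)" and C: "C \<subseteq> carrier G" and D: "D \<subseteq> carrier G" and z: "z \<in> carrier G"
  shows "lookup (formal_sum C \<star> formal_sum D) z
    = (of_nat (card {(x, y). x \<in> C \<and> y \<in> D \<and> x \<otimes> y = z}) :: 'k::field)"
proof -
  note f = finite_subset[OF C fin] finite_subset[OF D fin]
  have "lookup (formal_sum C \<star> formal_sum D) z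
    = (\<Sum>x\<in>carrier G. if x \<in> C \<and> inv x \<otimes> z \<in> D then 1 else (0 :: 'k))"
    using assms by (subst lookup_group_algebra_mult) (auto simp: formal_sum_closed lookup_formal_sum f intro!: sum.cong)
  also have "\<dots> = of_nat (card {x \<in> carrier G. x \<in> C \<and> inv x \<otimes> z \<in> D})"
    using fin by (simp add: sum.If_cases Int_def)
  also have "card {x \<in> carrier G. x \<in> C \<and> inv x \<otimes> z \<in> D} = card {(x, y). x \<in> C \<and> y \<in> D \<and> x \<otimes> y = z}"
    by (rule bij_betw_same_card[of "\<lambda>x. (x, inv x \<otimes> z)"], rule bij_betw_byWitness[where f' = fst])
       (use C D z in \<open>auto simp: m_assoc[symmetric] inv_solve_left'[symmetric] subset_iff\<close>)
  finally show ?thesis .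
qed

text \<open>Class functions in the form \<open>f (x y) = f (y x)\<close>. This avoids inverses, so
  in coordinates only the two products \<open>x y\<close> and \<open>y x\<close> have to be
  compared. Necessity comes from commuting with single group elements, which act on coefficients by
  translation.\<close>

lemma group_algebra_central_iff:
  fixes f :: "'a \<Rightarrow>\<^sub>0 'k::field"
  assumes fin: "finite (carrier G)" and f: "f \<in> carrier (group_algebra G)"
  shows "f \<in> carrier (centre_algebra (group_algebra G)) \<longleftrightarrow>
    (\<forall>x\<in>carrier G. \<forall>y\<in>carrier G. lookup f (x \<otimes> y) = lookup f (y \<otimes> x))"
proof -
  let ?l = lookup
  have s: "single x 1 \<in> carrier (group_algebra G)" if "x \<in> carrier G" for x
    using that by simp
  have ls: "?l (single x 1 \<star> f) (x \<otimes> y) = ?l f y"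
    if "x \<in> carrier G" "y \<in> carrier G" for x y
  proof -
    have "?l (single x 1 \<star> f) (x \<otimes> y) =
      (\<Sum>w\<in>carrier G. if w = x then ?l f y else 0)"
      using that fin f s
      by (subst lookup_group_algebra_mult)
         (auto simp: lookup_single when_def inv_cancel_left sum_mult_delta)
    thus ?thesis using that fin by simp
  qed
  have rs: "?l (f \<star> single x 1) (y \<otimes> x) = ?l f y"
    if "x \<in> carrier G" "y \<in> carrier G" for x y
  proof -
    have eq: "x = inv w \<otimes> (y \<otimes> x) \<longleftrightarrow> w = y" if "w \<in> carrier G" for w
      using that \<open>x \<in> carrier G\<close> \<open>y \<in> carrier G\<close>
      by (metis inv_solve_left m_closed right_cancel)
    have "?l (f \<star> single x 1) (y \<otimes> x) =
      (\<Sum>w\<in>carrier G. if w = y then ?l f y else 0)"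
      using that fin f s
      by (subst lookup_group_algebra_mult)
         (auto simp: lookup_single when_def eq sum_mult_delta cong: sum.cong)
    thus ?thesis using that fin by simp
  qed
  show ?thesis
  proof safe
    fix x y assume c: "f \<in> carrier (centre_algebra (group_algebra G))" and xy: "x \<in> carrier G" "y \<in> carrier G"
    have eq: "single x 1 \<star> f = f \<star> single x 1"
      using c s[OF xy(1)] unfolding centre_iff by metis
    have conj: "?l f w = ?l f (inv x \<otimes> (w \<otimes> x))" if w: "w \<in> carrier G" for w
    proof -
      have "?l f w = ?l (f \<star> single x 1) (w \<otimes> x)"
        using rs xy w by simp
      also have "w \<otimes> x = x \<otimes> (inv x \<otimes> (w \<otimes> x))" using xy w by (simp add: m_assoc[symmetric])
      also have "?l (f \<star> single x 1) \<dots> = ?l f (inv x \<otimes> (w \<otimes> x))"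
        unfolding eq[symmetric] using ls xy w by simp
      finally show ?thesis .
    qed
    show "?l f (x \<otimes> y) = ?l f (y \<otimes> x)"
      using conj[of "x \<otimes> y"] xy by (simp add: m_assoc[symmetric])
  next
    assume c: "\<forall>x\<in>carrier G. \<forall>y\<in>carrier G. ?l f (x \<otimes> y) = ?l f (y \<otimes> x)"
    have "f \<star> g = g \<star> f" if g: "g \<in> carrier (group_algebra G)" for g
    proof (rule group_algebra_eqI)
      fix z assume z: "z \<in> carrier G"
      have "?l (g \<star> f) z = (\<Sum>x\<in>carrier G. ?l f (inv x \<otimes> z) * ?l g x)"
        using fin f g z by (simp add: lookup_group_algebra_mult mult.commute)
      also have "\<dots> = (\<Sum>x\<in>carrier G. ?l f x * ?l g (inv x \<otimes> z))"
      proof (rule sum.reindex_bij_witness[of _ "\<lambda>y. inv y \<otimes> z" "\<lambda>x. z \<otimes> inv x"])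
        fix x assume x: "x \<in> carrier G"
        show "?l f (z \<otimes> inv x) * ?l g (inv (z \<otimes> inv x) \<otimes> z) = ?l f (inv x \<otimes> z) * ?l g x"
          using c x z by (simp add: inv_mult_group m_assoc)
      qed (use z in \<open>auto simp: inv_mult_group m_assoc inv_cancel_left\<close>)
      also have "\<dots> = ?l (f \<star> g) z"
        using fin f g z by (simp add: lookup_group_algebra_mult)
      finally show "?l (f \<star> g) z = ?l (g \<star> f) z" by simp
    qed (use f g in \<open>simp_all add: group_algebra_mult_closed\<close>)
    thus "f \<in> carrier (centre_algebra (group_algebra G))" using f by (simp add: centre_iff)
  qed
qed

end

section \<open>Evaluation of polynomials\<close>

lemma polynomial_algebra_simps [simp]:
  "f \<oplus>\<^bsub>polynomial_algebra S\<^esub> g = f + g" "f \<otimes>\<^bsub>polynomial_algebra S\<^esub> g = f * g"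
  "\<zero>\<^bsub>polynomial_algebra S\<^esub> = 0" "\<one>\<^bsub>polynomial_algebra S\<^esub> = 1"
  "c \<odot>\<^bsub>polynomial_algebra S\<^esub> f = Const c * f"
  by (simp_all add: polynomial_algebra_def Const_def mult_map_scale_conv_mult)

lemma polynomial_algebra_carrier_iff:
  "f \<in> carrier (polynomial_algebra S) \<longleftrightarrow> (\<forall>m. \<not> keys m \<subseteq> S \<longrightarrow> lookup f m = 0)"
  by (auto simp: polynomial_algebra_def in_keys_iff)

lemma polynomial_algebra_closed [simp]:
  "f \<in> carrier (polynomial_algebra S) \<Longrightarrow> g \<in> carrier (polynomial_algebra S) \<Longrightarrow> f + g \<in> carrier (polynomial_algebra S)"
  "f \<in> carrier (polynomial_algebra S) \<Longrightarrow> g \<in> carrier (polynomial_algebra S) \<Longrightarrow> f - g \<in> carrier (polynomial_algebra S)"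
  "f \<in> carrier (polynomial_algebra S) \<Longrightarrow> - f \<in> carrier (polynomial_algebra S)"
  "f \<in> carrier (polynomial_algebra S) \<Longrightarrow> g \<in> carrier (polynomial_algebra S) \<Longrightarrow> f * g \<in> carrier (polynomial_algebra S)"
  "f \<in> carrier (polynomial_algebra S) \<Longrightarrow> f ^ n \<in> carrier (polynomial_algebra S)"
  "0 \<in> carrier (polynomial_algebra S)" "1 \<in> carrier (polynomial_algebra S)"
  "Const c \<in> carrier (polynomial_algebra S)"
  "v \<in> S \<Longrightarrow> Var v \<in> carrier (polynomial_algebra S)"
proof -
  show mult: "f * g \<in> carrier (polynomial_algebra S)"
    if fg: "f \<in> carrier (polynomial_algebra S)" "g \<in> carrier (polynomial_algebra S)" for f g
  proof -
    have "keys m \<subseteq> S" if m: "m \<in> keys (f * g)" for m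
    proof -
      obtain m1 m2 where *: "m = m1 + m2" "m1 \<in> keys f" "m2 \<in> keys g"
        using m Poly_Mapping.keys_mult[of f g] by auto
      thus ?thesis using fg Poly_Mapping.keys_add[of m1 m2] by (fastforce simp: polynomial_algebra_def)
    qed
    thus ?thesis by (simp add: polynomial_algebra_def)
  qed
  show one: "1 \<in> carrier (polynomial_algebra S)"
    by (auto simp: polynomial_algebra_def)
  show "f ^ n \<in> carrier (polynomial_algebra S)" if "f \<in> carrier (polynomial_algebra S)" for f n
    by (induction n) (use that mult one in auto)
  show "Const c \<in> carrier (polynomial_algebra S)" for c
    by (auto simp: polynomial_algebra_def Const_def)
  show "Var v \<in> carrier (polynomial_algebra S)" if "v \<in> S"
    using that by (auto simp: polynomial_algebra_def Var_def)
qed (auto simp: polynomial_algebra_carrier_iff lookup_add lookup_minus)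

section \<open>Evaluating polynomials in a commutative algebra\<close>

context comm_algebra
begin

lemma zero_smult: "x \<in> carrier A \<Longrightarrow> 0 \<odot> x = \<zero>"
  using smult_l_distr[of x 0 0] smult_closed[of x 0] by (metis add.l_cancel_one add_0)

lemma mult_smult: "x \<in> carrier A \<Longrightarrow> y \<in> carrier A \<Longrightarrow> x \<otimes> (c \<odot> y) = c \<odot> (x \<otimes> y)"
  using smult_mult[of y x c] by (simp add: m_comm smult_closed)

definition monomial_eval :: "('v \<Rightarrow> 'a) \<Rightarrow> ('v \<Rightarrow>\<^sub>0 nat) \<Rightarrow> 'a" where
  "monomial_eval a m = (\<Otimes>v\<in>keys m. a v [^] lookup m v)"

definition poly_eval :: "('v \<Rightarrow> 'a) \<Rightarrow> (('v \<Rightarrow>\<^sub>0 nat) \<Rightarrow>\<^sub>0 'k) \<Rightarrow> 'a" where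
  "poly_eval a f = (\<Oplus>m\<in>keys f. lookup f m \<odot> monomial_eval a m)"

context
  fixes a :: "'v \<Rightarrow> 'a" and S :: "'v set"
  assumes a: "\<And>v. v \<in> S \<Longrightarrow> a v \<in> carrier A"
begin

text \<open>Variables with exponent zero contribute the factor one, so two monomials can be
  evaluated over a common set of variables.\<close>

lemma monomial_eval_superset:
  assumes "finite V" "keys m \<subseteq> V" "V \<subseteq> S"
  shows "monomial_eval a m = (\<Otimes>v\<in>V. a v [^] lookup m v)"
  unfolding monomial_eval_def
  by (rule finprod_mono_neutral_cong_left) (use assms a in \<open>auto simp: in_keys_iff\<close>)

lemma monomial_eval_closed: "keys m \<subseteq> S \<Longrightarrow> monomial_eval a m \<in> carrier A"
  unfolding monomial_eval_def by (rule finprod_closed) (use a in auto)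

lemma monomial_eval_zero [simp]: "monomial_eval a 0 = \<one>"
  by (simp add: monomial_eval_def)

lemma monomial_eval_add:
  assumes "keys m \<subseteq> S" "keys n \<subseteq> S"
  shows "monomial_eval a (m + n) = monomial_eval a m \<otimes> monomial_eval a n"
proof -
  let ?V = "keys m \<union> keys n"
  have V: "finite ?V" "?V \<subseteq> S" using assms by auto
  have "monomial_eval a (m + n) = (\<Otimes>v\<in>?V. a v [^] lookup (m + n) v)"
    by (rule monomial_eval_superset) (use V Poly_Mapping.keys_add[of m n] in auto)
  also have "\<dots> = (\<Otimes>v\<in>?V. a v [^] lookup m v \<otimes> a v [^] lookup n v)"
    by (rule finprod_cong') (use V a in \<open>auto simp: lookup_add nat_pow_mult\<close>)
  also have "\<dots> = (\<Otimes>v\<in>?V. a v [^] lookup m v) \<otimes> (\<Otimes>v\<in>?V. a v [^] lookup n v)"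
    by (rule finprod_multf) (use V a in auto)
  also have "\<dots> = monomial_eval a m \<otimes> monomial_eval a n"
    using monomial_eval_superset[of ?V m] monomial_eval_superset[of ?V n] V by simp
  finally show ?thesis .
qed

lemma monomial_eval_single: "v \<in> S \<Longrightarrow> monomial_eval a (single v 1) = a v"
  using a by (simp add: monomial_eval_def)

lemma poly_eval_superset:
  assumes "finite M" "keys f \<subseteq> M" "M \<subseteq> {m. keys m \<subseteq> S}"
  shows "poly_eval a f = (\<Oplus>m\<in>M. lookup f m \<odot> monomial_eval a m)"
  unfolding poly_eval_def
  by (rule add.finprod_mono_neutral_cong_left)
     (use assms in \<open>auto simp: in_keys_iff zero_smult monomial_eval_closed smult_closed\<close>)

lemma poly_eval_closed: "f \<in> carrier (polynomial_algebra S) \<Longrightarrow> poly_eval a f \<in> carrier A"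
  unfolding poly_eval_def
  by (rule finsum_closed) (auto simp: polynomial_algebra_def monomial_eval_closed smult_closed)

lemma poly_eval_zero [simp]: "poly_eval a 0 = \<zero>"
  by (simp add: poly_eval_def)

lemma poly_eval_single:
  assumes "keys m \<subseteq> S"
  shows "poly_eval a (single m c) = c \<odot> monomial_eval a m"
  using poly_eval_superset[of "{m}" "single m c"] assms
  by (simp add: monomial_eval_closed smult_closed)

lemma poly_eval_add:
  assumes "f \<in> carrier (polynomial_algebra S)" "g \<in> carrier (polynomial_algebra S)"
  shows "poly_eval a (f + g) = poly_eval a f \<oplus> poly_eval a g"
proof -
  let ?M = "keys f \<union> keys g"
  have M: "finite ?M" "?M \<subseteq> {m. keys m \<subseteq> S}"
    using assms by (auto simp: polynomial_algebra_def)
  have c: "lookup h m \<odot> monomial_eval a m \<in> carrier A" if "m \<in> ?M" for m h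
    using that M by (auto intro!: smult_closed monomial_eval_closed)
  have "poly_eval a (f + g) = (\<Oplus>m\<in>?M. lookup (f + g) m \<odot> monomial_eval a m)"
    by (rule poly_eval_superset) (use M Poly_Mapping.keys_add[of f g] in auto)
  also have "\<dots> = (\<Oplus>m\<in>?M. lookup f m \<odot> monomial_eval a m \<oplus> lookup g m \<odot> monomial_eval a m)"
    by (rule add.finprod_cong') (use M c in \<open>auto simp: lookup_add smult_l_distr monomial_eval_closed subset_iff\<close>)
  also have "\<dots> = (\<Oplus>m\<in>?M. lookup f m \<odot> monomial_eval a m) \<oplus> (\<Oplus>m\<in>?M. lookup g m \<odot> monomial_eval a m)"
    by (rule add.finprod_multf) (use M c in auto)
  also have "\<dots> = poly_eval a f \<oplus> poly_eval a g"
    using poly_eval_superset[of ?M f] poly_eval_superset[of ?M g] M by simp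
  finally show ?thesis .
qed

lemma poly_eval_single_mult:
  assumes m: "keys m \<subseteq> S" and g: "g \<in> carrier (polynomial_algebra S)"
  shows "poly_eval a (single m c * g) = c \<odot> monomial_eval a m \<otimes> poly_eval a g"
proof -
  have "keys g \<subseteq> {m. keys m \<subseteq> S}" using g by (auto simp: polynomial_algebra_def)
  thus ?thesis
  proof (induction g rule: poly_mapping_single_induct)
    case zero
    thus ?case using m by (simp add: smult_closed monomial_eval_closed)
  next
    case (add n d g)
    have nk: "keys n \<subseteq> S" "keys (m + n) \<subseteq> S"
      using add m Poly_Mapping.keys_add[of m n] by auto
    have g: "g \<in> carrier (polynomial_algebra S)" and s: "single n d \<in> carrier (polynomial_algebra S)"
      "single (m + n) (c * d) \<in> carrier (polynomial_algebra S)"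
      using add nk by (auto simp: polynomial_algebra_def split: if_splits)
    have mg: "single m c * g \<in> carrier (polynomial_algebra S)"
      by (rule polynomial_algebra_closed) (use add m in \<open>auto simp: polynomial_algebra_def split: if_splits\<close>)
    have "poly_eval a (single m c * (single n d + g))
      = (c * d) \<odot> (monomial_eval a m \<otimes> monomial_eval a n) \<oplus> c \<odot> monomial_eval a m \<otimes> poly_eval a g"
      using add mg s nk m by (simp add: distrib_left mult_single poly_eval_add poly_eval_single monomial_eval_add)
    also have "\<dots> = c \<odot> monomial_eval a m \<otimes> (d \<odot> monomial_eval a n \<oplus> poly_eval a g)"
      using nk m g by (simp add: r_distr smult_closed monomial_eval_closed poly_eval_closed smult_mult mult_smult
          mult.commute[of c] flip: smult_assoc)
    also have "d \<odot> monomial_eval a n \<oplus> poly_eval a g = poly_eval a (single n d + g)"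
      using s g nk by (simp add: poly_eval_add poly_eval_single)
    finally show ?case .
  qed
qed

lemma poly_eval_mult:
  assumes f: "f \<in> carrier (polynomial_algebra S)" and g: "g \<in> carrier (polynomial_algebra S)"
  shows "poly_eval a (f * g) = poly_eval a f \<otimes> poly_eval a g"
proof -
  have "keys f \<subseteq> {m. keys m \<subseteq> S}" using f by (auto simp: polynomial_algebra_def)
  thus ?thesis
  proof (induction f rule: poly_mapping_single_induct)
    case zero
    thus ?case using g by (simp add: poly_eval_closed)
  next
    case (add m c f)
    have mk: "keys m \<subseteq> S" using add by auto
    have f: "f \<in> carrier (polynomial_algebra S)" and s: "single m c \<in> carrier (polynomial_algebra S)"
      using add mk by (auto simp: polynomial_algebra_def split: if_splits)
    show ?case
      using add.IH f s mk g
      by (simp add: distrib_right poly_eval_add poly_eval_single_mult poly_eval_single l_distr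
          smult_closed monomial_eval_closed poly_eval_closed)
  qed
qed

lemma poly_eval_smult:
  assumes f: "f \<in> carrier (polynomial_algebra S)"
  shows "poly_eval a (c \<odot>\<^bsub>polynomial_algebra S\<^esub> f) = c \<odot> poly_eval a f"
proof -
  have "c \<odot>\<^bsub>polynomial_algebra S\<^esub> f = single 0 c * f"
    by (simp add: polynomial_algebra_def mult_map_scale_conv_mult)
  thus ?thesis
    using poly_eval_single_mult[of 0 f c] f
    by (simp add: smult_mult poly_eval_closed)
qed

lemma poly_eval_Var: "v \<in> S \<Longrightarrow> poly_eval a (Var v) = a v"
  by (simp add: Var_def poly_eval_single monomial_eval_single smult_one a del: One_nat_def)

lemma poly_eval_Const: "poly_eval a (Const c) = c \<odot> \<one>"
  unfolding Const_def by (subst poly_eval_single) simp_all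

lemma poly_eval_one: "poly_eval a 1 = \<one>"
  using poly_eval_Const[of 1] by (simp add: Const_def smult_one)

lemma poly_eval_ring_hom: "poly_eval a \<in> ring_hom (polynomial_algebra S) A"
  by (rule ring_hom_memI)
     (simp_all add: poly_eval_closed poly_eval_add poly_eval_mult poly_eval_one polynomial_algebra_def[of S])

end

end

section \<open>Polynomial algebras and their quotients\<close>

lemma polynomial_algebra_cring: "cring (polynomial_algebra S)"
proof (rule cringI)
  show "abelian_group (polynomial_algebra S)"
  proof (rule abelian_groupI)
    fix f assume "f \<in> carrier (polynomial_algebra S)"
    thus "\<exists>g\<in>carrier (polynomial_algebra S). g \<oplus>\<^bsub>polynomial_algebra S\<^esub> f = \<zero>\<^bsub>polynomial_algebra S\<^esub>"
      by (intro bexI[of _ "- f"]) auto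
  qed (auto simp: add_ac)
  show "comm_monoid (polynomial_algebra S)"
    by (rule comm_monoidI) (auto simp: mult_ac)
qed (auto simp: ring_distribs)

lemma polynomial_algebra_minus:
  assumes "g \<in> carrier (polynomial_algebra S)"
  shows "\<ominus>\<^bsub>polynomial_algebra S\<^esub> g = - g"
proof -
  interpret cring "polynomial_algebra S" by (rule polynomial_algebra_cring)
  show ?thesis by (rule sum_zero_eq_neg[symmetric]) (use assms in auto)
qed

text \<open>The isomorphism theorem in the direction from the target to the quotient:
  \<open>z\<close> goes to its whole fibre under \<open>\<psi>\<close>, which is a coset of
  \<open>I\<close>, so no representatives are chosen.\<close>

lemma algebra_isomorphic_quotient:
  fixes R :: "('k::field, 'b) module" and A :: "('k, 'a) module"
  assumes R: "ring R" and I: "ideal I R" and A: "ring A"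
    and smult: "\<And>c x. x \<in> carrier R \<Longrightarrow> c \<odot>\<^bsub>R\<^esub> x \<in> carrier R"
    and hom: "\<psi> \<in> ring_hom R A"
    and lin: "\<And>c x. x \<in> carrier R \<Longrightarrow> \<psi> (c \<odot>\<^bsub>R\<^esub> x) = c \<odot>\<^bsub>A\<^esub> \<psi> x"
    and surj: "carrier A \<subseteq> \<psi> ` carrier R"
    and ker: "\<And>x. x \<in> carrier R \<Longrightarrow> x \<in> I \<longleftrightarrow> \<psi> x = \<zero>\<^bsub>A\<^esub>"
  shows "algebra_isomorphic A (quotient_algebra R I)"
proof -
  interpret R: ring R by fact
  interpret A: ring A by fact
  interpret h: ring_hom_ring R A \<psi> by (rule ring_hom_ringI2[OF R A hom])
  interpret I: ideal I R by fact
  define \<phi> where "\<phi> z = {x \<in> carrier R. \<psi> x = z}" for z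
  have \<phi>: "\<phi> (\<psi> x) = I +>\<^bsub>R\<^esub> x" if x: "x \<in> carrier R" for x
  proof -
    have "y \<in> I +>\<^bsub>R\<^esub> x \<longleftrightarrow> \<psi> y = \<psi> x" if y: "y \<in> carrier R" for y
    proof -
      have "y \<in> I +>\<^bsub>R\<^esub> x \<longleftrightarrow> y \<ominus>\<^bsub>R\<^esub> x \<in> I"
        using x y by (simp add: I.a_rcos_module R.ring_axioms R.minus_eq)
      also have "\<dots> \<longleftrightarrow> \<psi> y \<ominus>\<^bsub>A\<^esub> \<psi> x = \<zero>\<^bsub>A\<^esub>"
        using ker x y by (simp add: R.minus_eq A.minus_eq)
      also have "\<dots> \<longleftrightarrow> \<psi> y = \<psi> x"
        using h.hom_closed[OF x] h.hom_closed[OF y]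
        by (metis A.a_inv_closed A.minus_eq A.minus_equality A.r_neg)
      finally show ?thesis .
    qed
    moreover have "I +>\<^bsub>R\<^esub> x \<subseteq> carrier R" using x by (simp add: R.a_r_coset_subset_G I.a_subset)
    ultimately show ?thesis by (auto simp: \<phi>_def)
  qed
  have pre: "\<exists>x\<in>carrier R. z = \<psi> x" if "z \<in> carrier A" for z using surj that by auto
  have simps: "carrier (quotient_algebra R I) = a_rcosets\<^bsub>R\<^esub> I"
    "X \<oplus>\<^bsub>quotient_algebra R I\<^esub> Y = X <+>\<^bsub>R\<^esub> Y"
    "X \<otimes>\<^bsub>quotient_algebra R I\<^esub> Y = rcoset_mult R I X Y"
    "\<one>\<^bsub>quotient_algebra R I\<^esub> = I +>\<^bsub>R\<^esub> \<one>\<^bsub>R\<^esub>"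
    "c \<odot>\<^bsub>quotient_algebra R I\<^esub> X = (\<Union>x\<in>X. I +>\<^bsub>R\<^esub> (c \<odot>\<^bsub>R\<^esub> x))" for X Y c
    by (simp_all add: quotient_algebra_def ring.extend_def module.fields_def FactRing_def ring.defs module.defs)
  have "\<phi> \<in> ring_hom A (quotient_algebra R I)"
  proof (rule ring_hom_memI)
    fix z assume "z \<in> carrier A"
    then obtain x where x: "x \<in> carrier R" "z = \<psi> x" using pre by blast
    thus "\<phi> z \<in> carrier (quotient_algebra R I)"
      by (auto simp: \<phi> simps A_RCOSETS_def' )
  next
    fix z w assume "z \<in> carrier A" "w \<in> carrier A"
    then obtain x y where xy: "x \<in> carrier R" "z = \<psi> x" "y \<in> carrier R" "w = \<psi> y" using pre by metis
    have "\<phi> (z \<otimes>\<^bsub>A\<^esub> w) = \<phi> (\<psi> (x \<otimes>\<^bsub>R\<^esub> y))" "\<phi> (z \<oplus>\<^bsub>A\<^esub> w) = \<phi> (\<psi> (x \<oplus>\<^bsub>R\<^esub> y))"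
      using xy by simp_all
    thus "\<phi> (z \<otimes>\<^bsub>A\<^esub> w) = \<phi> z \<otimes>\<^bsub>quotient_algebra R I\<^esub> \<phi> w"
      "\<phi> (z \<oplus>\<^bsub>A\<^esub> w) = \<phi> z \<oplus>\<^bsub>quotient_algebra R I\<^esub> \<phi> w"
      using xy by (simp_all only: \<phi> simps R.m_closed R.a_closed I.rcoset_mult_add I.a_rcos_sum)
  next
    show "\<phi> \<one>\<^bsub>A\<^esub> = \<one>\<^bsub>quotient_algebra R I\<^esub>"
      using \<phi>[of "\<one>\<^bsub>R\<^esub>"] by (simp add: simps)
  qed
  moreover have "inj_on \<phi> (carrier A)"
  proof (rule inj_onI)
    fix z w assume "z \<in> carrier A" "w \<in> carrier A" and eq: "\<phi> z = \<phi> w"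
    then obtain x where x: "x \<in> carrier R" "z = \<psi> x" using pre by blast
    hence "x \<in> \<phi> w" using eq by (auto simp: \<phi>_def)
    thus "z = w" using x by (simp add: \<phi>_def)
  qed
  moreover have "\<phi> ` carrier A = carrier (quotient_algebra R I)"
  proof
    show "\<phi> ` carrier A \<subseteq> carrier (quotient_algebra R I)"
    proof safe
      fix z assume "z \<in> carrier A"
      then obtain x where "x \<in> carrier R" "z = \<psi> x" using pre by blast
      thus "\<phi> z \<in> carrier (quotient_algebra R I)" by (auto simp: \<phi> simps A_RCOSETS_def')
    qed
    show "carrier (quotient_algebra R I) \<subseteq> \<phi> ` carrier A"
    proof
      fix X assume "X \<in> carrier (quotient_algebra R I)"
      then obtain x where x: "x \<in> carrier R" "X = I +>\<^bsub>R\<^esub> x" by (auto simp: simps A_RCOSETS_def')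
      thus "X \<in> \<phi> ` carrier A" using \<phi>[OF x(1)] h.hom_closed[OF x(1)] by blast
    qed
  qed
  ultimately have iso: "\<phi> \<in> ring_iso A (quotient_algebra R I)"
    by (simp add: ring_iso_def bij_betw_def)
  have "\<phi> (c \<odot>\<^bsub>A\<^esub> z) = c \<odot>\<^bsub>quotient_algebra R I\<^esub> \<phi> z" if zA: "z \<in> carrier A" for c z
  proof -
    obtain x where x: "x \<in> carrier R" "z = \<psi> x" using pre[OF zA] by blast
    \<comment> \<open>The scalar action on the quotient is a union over all members of a coset;
      linearity of \<open>\<psi>\<close> makes the cosets in this union coincide.\<close>
    have "I +>\<^bsub>R\<^esub> (c \<odot>\<^bsub>R\<^esub> y) = \<phi> (c \<odot>\<^bsub>A\<^esub> z)" if "y \<in> \<phi> z" for y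
    proof -
      have y: "y \<in> carrier R" "z = \<psi> y" using that by (auto simp: \<phi>_def)
      show ?thesis using \<phi>[OF smult[OF y(1)], of c] lin[OF y(1), of c] y(2) by simp
    qed
    moreover have "x \<in> \<phi> z" using x by (simp add: \<phi>_def)
    ultimately have "(\<Union>y\<in>\<phi> z. I +>\<^bsub>R\<^esub> (c \<odot>\<^bsub>R\<^esub> y)) = \<phi> (c \<odot>\<^bsub>A\<^esub> z)"
      by blast
    thus ?thesis by (simp add: simps)
  qed
  thus ?thesis unfolding algebra_isomorphic_def by (intro bexI[OF _ iso]) simp
qed

section \<open>Normal forms modulo the relations\<close>

definition mcoset :: "'f::field set \<Rightarrow> 'f \<Rightarrow> 'f set" where
  "mcoset H t = (\<lambda>h. h * t) ` H"

lemma mem_mcoset_iff: "t \<noteq> 0 \<Longrightarrow> s \<in> mcoset H t \<longleftrightarrow> s / t \<in> H"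
  by (auto simp: mcoset_def intro!: rev_image_eqI[of "s / t"])

lemma card_mcoset: "t \<noteq> 0 \<Longrightarrow> card (mcoset H t) = card H"
  unfolding mcoset_def by (rule card_image) (auto simp: inj_on_def)

text \<open>A right coset does not depend on the carrier of the group record. Hence the elements of
  \<open>Vgrp q\<close> are literally elements of \<open>Ugrp q\<close>, and set differences between
  the two are meaningful.\<close>

lemma r_coset_field_units: "H #>\<^bsub>field_units\<lparr>carrier := C\<rparr>\<^esub> t = mcoset H t"
  "H #>\<^bsub>field_units\<^esub> t = mcoset H t"
  by (auto simp: r_coset_def field_units_def mcoset_def)

lemma carrier_field_units [simp]: "carrier field_units = UNIV - {0}"
  by (simp add: field_units_def)

lemma field_units_comm_group: "comm_group (field_units :: 'f::field monoid)"
proof (rule comm_groupI)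
  fix x :: 'f assume "x \<in> carrier field_units"
  thus "\<exists>y\<in>carrier field_units. y \<otimes>\<^bsub>field_units\<^esub> x = \<one>\<^bsub>field_units\<^esub>"
    by (intro bexI[of _ "inverse x"]) (auto simp: field_units_def)
qed (auto simp: field_units_def)

lemma field_units_inv: "(x :: 'f::field) \<noteq> 0 \<Longrightarrow> inv\<^bsub>field_units\<^esub> x = inverse x"
  by (intro group.inv_equality comm_group.axioms(2) field_units_comm_group)
     (auto simp: field_units_def)

lemma field_units_normal:
  assumes "1 \<in> H" "0 \<notin> H" "\<And>x y. x \<in> H \<Longrightarrow> y \<in> H \<Longrightarrow> x / y \<in> H"
  shows "H \<lhd> (field_units :: 'f::field monoid)"
proof -
  interpret comm_group "field_units :: 'f monoid" by (rule field_units_comm_group)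
  have inv: "inverse y \<in> H" if "y \<in> H" for y using assms(3)[OF assms(1) that] by (simp add: field_simps)
  have "subgroup H field_units"
  proof (rule subgroupI)
    fix x y assume "x \<in> H" "y \<in> H"
    thus "x \<otimes>\<^bsub>field_units\<^esub> y \<in> H"
      using assms(3)[of x "inverse y"] inv by (auto simp: field_units_def divide_inverse)
  next
    fix x assume "x \<in> H"
    moreover have "x \<noteq> 0" using \<open>x \<in> H\<close> assms(2) by auto
    ultimately show "inv\<^bsub>field_units\<^esub> x \<in> H" using inv by (simp add: field_units_inv)
  qed (use assms in \<open>auto simp: field_units_def\<close>)
  thus ?thesis by (rule subgroup_imp_normal)
qed

section \<open>The index groups in terms of cosets, and the normal monomials\<close>

context quadratic_field
begin

abbreviation cl :: "'f \<Rightarrow> 'f set" where "cl t \<equiv> mcoset (Gam q) t"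

abbreviation wl :: "'f \<Rightarrow> 'f set" where "wl t \<equiv> mcoset (Lset q) t"

lemma Gam_normal: "Gam q \<lhd> (field_units :: 'f monoid)"
  using Gam_nonzero by (intro field_units_normal) (auto simp: Gam_def power_divide)

lemma Gam_one: "1 \<in> (Gam q :: 'f set)" by (simp add: Gam_def)

lemma Psi_mult: "(x :: 'f) \<in> Psi q \<Longrightarrow> y \<in> Psi q \<Longrightarrow> x * y \<in> Psi q"
  by (simp add: Psi_def power_mult_distrib del: power_Suc)

lemma Gam_divide: "(x :: 'f) \<in> Gam q \<Longrightarrow> y \<in> Gam q \<Longrightarrow> x / y \<in> Gam q"
  and Gam_mult: "(x :: 'f) \<in> Gam q \<Longrightarrow> y \<in> Gam q \<Longrightarrow> x * y \<in> Gam q"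
  by (simp_all add: Gam_def power_divide power_mult_distrib)

lemma Lset_divide: "(x :: 'f) \<in> Lset q \<Longrightarrow> y \<in> Lset q \<Longrightarrow> x / y \<in> Lset q"
  unfolding Lset_def by clarify (metis divide_eq_0_iff power_divide)

lemma Lset_one: "1 \<in> (Lset q :: 'f set)"
  unfolding Lset_def by (metis (mono_tags, lifting) mem_Collect_eq one_neq_zero power_one)

lemma cl_eq_iff: "s \<noteq> 0 \<Longrightarrow> t \<noteq> 0 \<Longrightarrow> cl s = cl t \<longleftrightarrow> s / t \<in> Gam q"
proof
  assume st: "s \<noteq> 0" "t \<noteq> 0" and "cl s = cl t"
  thus "s / t \<in> Gam q" using Gam_one by (metis divide_self mem_mcoset_iff)
next
  assume st: "s \<noteq> 0" "t \<noteq> 0" and g: "s / t \<in> Gam q"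
  have "x / s \<in> Gam q \<longleftrightarrow> x / t \<in> Gam q" for x
    using Gam_mult[OF _ g, of "x / s"] Gam_divide[OF _ g, of "x / t"] st by auto
  thus "cl s = cl t" using st by (auto simp: mem_mcoset_iff)
qed

lemma wl_eq_iff: "s \<noteq> 0 \<Longrightarrow> t \<noteq> 0 \<Longrightarrow> wl s = wl t \<longleftrightarrow> s / t \<in> Lset q"
proof
  assume st: "s \<noteq> 0" "t \<noteq> 0" and "wl s = wl t"
  thus "s / t \<in> Lset q" using Lset_one by (metis divide_self mem_mcoset_iff)
next
  assume st: "s \<noteq> 0" "t \<noteq> 0" and g: "s / t \<in> Lset q"
  have g': "t / s \<in> Lset q" using Lset_divide[OF Lset_one g] by simp
  have "x / s \<in> Lset q \<longleftrightarrow> x / t \<in> Lset q" for x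
    using Lset_divide[OF _ g', of "x / s"] Lset_divide[OF _ g, of "x / t"] st by auto
  thus "wl s = wl t" using st by (auto simp: mem_mcoset_iff)
qed

lemma carrier_Ugrp: "carrier (Ugrp q :: 'f set monoid) = cl ` (UNIV - {0})"
  by (simp add: Ugrp_def FactGroup_def RCOSETS_def r_coset_field_units UNION_singleton_eq_range)

lemma carrier_Vgrp: "carrier (Vgrp q :: 'f set monoid) = cl ` Psi q"
  by (simp add: Vgrp_def FactGroup_def RCOSETS_def r_coset_field_units UNION_singleton_eq_range)

lemma carrier_Wgrp: "carrier (Wgrp q :: 'f set monoid) = wl ` (UNIV - {0})"
  by (simp add: Wgrp_def FactGroup_def RCOSETS_def r_coset_field_units UNION_singleton_eq_range)

lemma Ugrp_one: "\<one>\<^bsub>Ugrp q\<^esub> = cl 1"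
  by (simp add: Ugrp_def mcoset_def)

lemma Ugrp_mult: "s \<noteq> 0 \<Longrightarrow> t \<noteq> 0 \<Longrightarrow> cl s \<otimes>\<^bsub>Ugrp q\<^esub> cl t = cl (s * t)"
  using normal.rcos_sum[OF Gam_normal, of s t]
  by (simp add: Ugrp_def r_coset_field_units) (simp add: field_units_def)

lemma Ugrp_inv: "t \<noteq> 0 \<Longrightarrow> inv\<^bsub>Ugrp q\<^esub> (cl t) = cl (inverse t)"
proof (rule group.inv_equality)
  show "group (Ugrp q :: 'f set monoid)"
    unfolding Ugrp_def by (rule normal.factorgroup_is_group[OF Gam_normal])
qed (auto simp: carrier_Ugrp Ugrp_mult Ugrp_one)

lemma Vgrp_subset_Ugrp: "carrier (Vgrp q :: 'f set monoid) \<subseteq> carrier (Ugrp q)"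
  using Psi_nonzero by (auto simp: carrier_Ugrp carrier_Vgrp)

lemma cl_in_Vgrp: "t \<noteq> 0 \<Longrightarrow> cl t \<in> carrier (Vgrp q) \<longleftrightarrow> t \<in> Psi q"
proof
  assume t: "t \<noteq> 0" and "cl t \<in> carrier (Vgrp q)"
  then obtain s where s: "s \<in> Psi q" "cl t = cl s" by (auto simp: carrier_Vgrp)
  hence "t / s \<in> Psi q" using t Psi_nonzero cl_eq_iff Gam_subset_Psi by blast
  from Psi_mult[OF this s(1)] show "t \<in> Psi q" using Psi_nonzero[OF s(1)] by simp
qed (auto simp: carrier_Vgrp)

lemma Vgrp_mult_closed:
  "m \<in> carrier (Vgrp q) \<Longrightarrow> n \<in> carrier (Vgrp q) \<Longrightarrow> m \<otimes>\<^bsub>Ugrp q\<^esub> n \<in> carrier (Vgrp q :: 'f set monoid)"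
  using Psi_nonzero Psi_mult by (auto simp: carrier_Vgrp Ugrp_mult)

lemma Ugrp_mult_eq_one:
  "m \<in> carrier (Ugrp q :: 'f set monoid) \<Longrightarrow> n \<in> carrier (Ugrp q) \<Longrightarrow>
    m \<otimes>\<^bsub>Ugrp q\<^esub> n = \<one>\<^bsub>Ugrp q\<^esub> \<longleftrightarrow> m = inv\<^bsub>Ugrp q\<^esub> n"
proof -
  assume "m \<in> carrier (Ugrp q)" "n \<in> carrier (Ugrp q)"
  then obtain s t where st: "s \<noteq> 0" "t \<noteq> 0" "m = cl s" "n = cl t" by (auto simp: carrier_Ugrp)
  thus ?thesis by (simp add: Ugrp_mult Ugrp_one Ugrp_inv) (simp add: cl_eq_iff divide_inverse)
qed

definition WW :: "'f set set" where "WW = carrier (Wgrp q)"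
definition UU :: "'f set set" where "UU = carrier (Ugrp q) - {\<one>\<^bsub>Ugrp q\<^esub>}"
definition VV :: "'f set set" where "VV = carrier (Vgrp q) - {\<one>\<^bsub>Ugrp q\<^esub>}"
definition DD :: "'f set set" where "DD = carrier (Ugrp q) - carrier (Vgrp q)"

lemma UU_cases: "UU = DD \<union> VV"
proof -
  have "\<one>\<^bsub>Ugrp q\<^esub> \<in> carrier (Vgrp q :: 'f set monoid)" by (simp add: Ugrp_one cl_in_Vgrp Psi_def)
  thus ?thesis using Vgrp_subset_Ugrp by (auto simp: UU_def DD_def VV_def)
qed

lemma variables_eq: "variables q = {VarT} \<union> VarX ` WW \<union> VarY ` UU"
  by (simp add: variables_def WW_def UU_def)

lemma relations_eq:
  "relations q = {pT ^ 2}
      \<union> {pT * pX n1 | n1. n1 \<in> WW}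
      \<union> {pT * pY m1 | m1. m1 \<in> DD}
      \<union> {pX n1 * pX n2 | n1 n2. n1 \<in> WW \<and> n2 \<in> WW}
      \<union> {pX n1 * pY m1 | n1 m1. n1 \<in> WW \<and> m1 \<in> DD}
      \<union> {pY m1 * pY m | m1 m. m1 \<in> DD \<and> m \<in> UU}
      \<union> {pX n1 * pY m2 + Const (1 / of_nat (gam q)) * pY m2 * pT | n1 m2. n1 \<in> WW \<and> m2 \<in> VV}
      \<union> {pY m2 * pY m3
           - Const (1 - kronecker m2 (inv\<^bsub>Ugrp q\<^esub> m3)) * pY (m2 \<otimes>\<^bsub>Ugrp q\<^esub> m3) * pT
         | m2 m3. m2 \<in> VV \<and> m3 \<in> VV}"
  unfolding relations_def Let_def WW_def UU_def VV_def DD_def ..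

lemma finite_index [simp]: "finite WW" "finite UU" "finite VV" "finite DD"
  by simp_all

definition var_monomial :: "'v \<Rightarrow> 'v \<Rightarrow>\<^sub>0 nat" where
  "var_monomial v = single v 1"

lemma var_monomial_simps [simp]:
  "var_monomial v \<noteq> 0" "0 \<noteq> var_monomial v" "var_monomial v = var_monomial w \<longleftrightarrow> v = w"
  by (auto simp: var_monomial_def poly_mapping_eq_iff fun_eq_iff lookup_single when_def)

lemma var_monomial_Y_T [simp]:
  "var_monomial (VarY m) + var_monomial VarT \<noteq> 0" "0 \<noteq> var_monomial (VarY m) + var_monomial VarT"
  "var_monomial (VarY m) + var_monomial VarT \<noteq> var_monomial v"
  "var_monomial v \<noteq> var_monomial (VarY m) + var_monomial VarT"
proof -
  have eq: "lookup (var_monomial (VarY m) + var_monomial VarT) (VarY m) = 1"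
    "lookup (var_monomial (VarY m) + var_monomial VarT) VarT = 1"
    by (simp_all add: lookup_add lookup_single when_def var_monomial_def)
  show *: "var_monomial (VarY m) + var_monomial VarT \<noteq> 0" using eq by (metis lookup_zero zero_neq_one)
  show **: "var_monomial (VarY m) + var_monomial VarT \<noteq> var_monomial v"
    using eq unfolding var_monomial_def
    by (metis lookup_single_not_eq variable.distinct(3) zero_neq_one)
  show "0 \<noteq> var_monomial (VarY m) + var_monomial VarT"
    "var_monomial v \<noteq> var_monomial (VarY m) + var_monomial VarT" using * ** by metis+
qed

lemma Var_eq_single: "Var v = single (var_monomial v) 1"
  by (simp add: Var_def var_monomial_def)

definition normal_monomials :: "('f set variable \<Rightarrow>\<^sub>0 nat) set" where
  "normal_monomials = {0, var_monomial VarT}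
    \<union> (\<lambda>n. var_monomial (VarX n)) ` WW
    \<union> (\<lambda>m. var_monomial (VarY m)) ` UU
    \<union> (\<lambda>m. var_monomial (VarY m) + var_monomial VarT) ` VV"

lemma finite_normal_monomials: "finite normal_monomials"
  by (simp add: normal_monomials_def)

lemma sum_normal_monomials:
  fixes g :: "('f set variable \<Rightarrow>\<^sub>0 nat) \<Rightarrow> 'a::comm_monoid_add"
  shows "sum g normal_monomials = g 0 + (g (var_monomial VarT)
    + ((\<Sum>n\<in>WW. g (var_monomial (VarX n)))
    + ((\<Sum>m\<in>UU. g (var_monomial (VarY m)))
    + (\<Sum>m\<in>VV. g (var_monomial (VarY m) + var_monomial VarT)))))"
proof -
  let ?d = "var_monomial :: 'f set variable \<Rightarrow> _"
  have "sum g normal_monomials = sum g ({0} \<union> ({?d VarT} \<union> ((\<lambda>n. ?d (VarX n)) ` WW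
      \<union> ((\<lambda>m. ?d (VarY m)) ` UU \<union> (\<lambda>m. ?d (VarY m) + ?d VarT) ` VV))))"
    by (rule arg_cong[of _ _ "sum g"]) (auto simp: normal_monomials_def)
  also have "\<dots> = sum g {0} + (sum g {?d VarT} + (sum g ((\<lambda>n. ?d (VarX n)) ` WW)
      + (sum g ((\<lambda>m. ?d (VarY m)) ` UU) + sum g ((\<lambda>m. ?d (VarY m) + ?d VarT) ` VV))))"
    by (subst sum.union_disjoint, simp, simp, (auto; fail))+ simp
  finally show ?thesis
    by (simp add: sum.reindex inj_on_def)
qed

lemma normal_monomial_closed: "m \<in> normal_monomials \<Longrightarrow> keys m \<subseteq> variables q"
proof -
  have "keys (var_monomial (VarY n) + var_monomial VarT) \<subseteq> {VarY n, VarT}" for n :: "'f set"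
    using Poly_Mapping.keys_add[of "var_monomial (VarY n)" "var_monomial VarT"] by (auto simp: var_monomial_def)
  moreover have "VV \<subseteq> UU" using UU_cases by blast
  ultimately show "m \<in> normal_monomials \<Longrightarrow> keys m \<subseteq> variables q"
    by (fastforce simp: normal_monomials_def variables_eq var_monomial_def)
qed

section \<open>Reduction to normal monomials\<close>

context
  fixes R :: "('k::field, ('f set variable \<Rightarrow>\<^sub>0 nat) \<Rightarrow>\<^sub>0 'k) module" and I
  assumes R: "R = polynomial_algebra (variables q)"
    and I: "ideal I R" and rel: "relations q \<subseteq> I"
begin

lemma ideal_closed:
  "f \<in> I \<Longrightarrow> f \<in> carrier R" "f \<in> I \<Longrightarrow> g \<in> I \<Longrightarrow> f + g \<in> I" "f \<in> I \<Longrightarrow> - f \<in> I"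
  "f \<in> I \<Longrightarrow> g \<in> carrier R \<Longrightarrow> f * g \<in> I" "f \<in> I \<Longrightarrow> g \<in> carrier R \<Longrightarrow> g * f \<in> I" "0 \<in> I"
proof -
  interpret ideal I R by (rule I)
  show c: "f \<in> carrier R" if "f \<in> I" for f using that a_subset by auto
  show "f + g \<in> I" if "f \<in> I" "g \<in> I" for f g
    using additive_subgroup.a_closed[OF additive_subgroup_axioms that] by (simp add: R)
  show "- f \<in> I" if "f \<in> I"
    using additive_subgroup.a_inv_closed[OF additive_subgroup_axioms that] c[OF that] polynomial_algebra_minus[of f] by (simp add: R)
  show "f * g \<in> I" if "f \<in> I" "g \<in> carrier R" using I_r_closed[OF that] by (simp add: R)
  show "g * f \<in> I" if "f \<in> I" "g \<in> carrier R" using I_l_closed[OF that] by (simp add: R)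
  show "0 \<in> I" using additive_subgroup.zero_closed[OF additive_subgroup_axioms] by (simp add: R)
qed

definition reducible where
  "reducible f \<longleftrightarrow> f \<in> carrier R \<and> (\<exists>g. keys g \<subseteq> normal_monomials \<and> f - g \<in> I)"

lemma reducible_add: "reducible f \<Longrightarrow> reducible g \<Longrightarrow> reducible (f + g)"
proof -
  assume "reducible f" "reducible g"
  then obtain f' g' where *: "f \<in> carrier R" "g \<in> carrier R" "f - f' \<in> I" "g - g' \<in> I"
    "keys f' \<subseteq> normal_monomials" "keys g' \<subseteq> normal_monomials"
    by (auto simp: reducible_def)
  have "(f + g) - (f' + g') = (f - f') + (g - g')" by simp
  hence "(f + g) - (f' + g') \<in> I" using * ideal_closed(2) by metis
  moreover have "keys (f' + g') \<subseteq> normal_monomials" using * Poly_Mapping.keys_add[of f' g'] by blast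
  moreover have "f + g \<in> carrier R" using * by (simp add: R)
  ultimately show ?thesis unfolding reducible_def by blast
qed

lemma reducible_ideal: "f \<in> I \<Longrightarrow> reducible f"
  unfolding reducible_def by (auto simp: ideal_closed intro!: exI[of _ 0])

lemma reducible_Const: "reducible f \<Longrightarrow> reducible (Const c * f)"
proof -
  assume "reducible f"
  then obtain g where *: "f \<in> carrier R" "f - g \<in> I" "keys g \<subseteq> normal_monomials"
    by (auto simp: reducible_def)
  have "Const c * (f - g) \<in> I" using * ideal_closed(5)[OF *(2), of "Const c"] by (simp add: R)
  hence "Const c * f - Const c * g \<in> I" by (simp add: right_diff_distrib)
  moreover have "keys (Const c * g) \<subseteq> normal_monomials"
    using * by (auto simp: Const_def in_keys_iff mult_map_scale_conv_mult[symmetric])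
  moreover have "Const c * f \<in> carrier R" using * by (simp add: R)
  ultimately show ?thesis unfolding reducible_def by blast
qed

lemma reducible_normal: "m \<in> normal_monomials \<Longrightarrow> reducible (single m c)"
proof -
  assume m: "m \<in> normal_monomials"
  have "single m c \<in> carrier R"
    using normal_monomial_closed[OF m] by (auto simp: R polynomial_algebra_def)
  moreover have "single m c - single m c \<in> I" by (simp add: ideal_closed)
  moreover have "keys (single m c) \<subseteq> normal_monomials" using m by auto
  ultimately show ?thesis unfolding reducible_def by blast
qed

lemma reducible_basis:
  "reducible 1" "reducible pT" "n \<in> WW \<Longrightarrow> reducible (pX n)" "m \<in> UU \<Longrightarrow> reducible (pY m)"
  "m \<in> VV \<Longrightarrow> reducible (pY m * pT)" "m \<in> VV \<Longrightarrow> reducible (pT * pY m)"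
proof -
  show "reducible 1" using reducible_normal[of 0 1] by (simp add: normal_monomials_def)
  show "reducible pT" unfolding Var_eq_single by (rule reducible_normal) (simp add: normal_monomials_def)
  show "n \<in> WW \<Longrightarrow> reducible (pX n)"
    unfolding Var_eq_single by (rule reducible_normal) (simp add: normal_monomials_def)
  show "m \<in> UU \<Longrightarrow> reducible (pY m)"
    unfolding Var_eq_single by (rule reducible_normal) (simp add: normal_monomials_def)
  show "m \<in> VV \<Longrightarrow> reducible (pY m * pT)"
    unfolding Var_eq_single mult_single by (rule reducible_normal) (simp add: normal_monomials_def)
  thus "m \<in> VV \<Longrightarrow> reducible (pT * pY m)" by (simp add: mult.commute)
qed

lemma vars_closed [simp]: "pT \<in> carrier R" "n \<in> WW \<Longrightarrow> pX n \<in> carrier R" "m \<in> UU \<Longrightarrow> pY m \<in> carrier R"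
  "m \<in> VV \<Longrightarrow> pY m \<in> carrier R" "m \<in> DD \<Longrightarrow> pY m \<in> carrier R"
  using UU_cases by (auto simp: R variables_eq intro!: polynomial_algebra_closed)

lemma relations_in_ideal:
  "pT * pT \<in> I" "n \<in> WW \<Longrightarrow> pT * pX n \<in> I" "m \<in> DD \<Longrightarrow> pT * pY m \<in> I"
  "n \<in> WW \<Longrightarrow> n' \<in> WW \<Longrightarrow> pX n * pX n' \<in> I" "n \<in> WW \<Longrightarrow> m \<in> DD \<Longrightarrow> pX n * pY m \<in> I"
  "m \<in> DD \<Longrightarrow> m' \<in> UU \<Longrightarrow> pY m * pY m' \<in> I"
  "n \<in> WW \<Longrightarrow> m' \<in> VV \<Longrightarrow> pX n * pY m' + Const (1 / of_nat (gam q)) * pY m' * pT \<in> I"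
  "m1 \<in> VV \<Longrightarrow> m2 \<in> VV \<Longrightarrow> pY m1 * pY m2
     - Const (1 - kronecker m1 (inv\<^bsub>Ugrp q\<^esub> m2)) * pY (m1 \<otimes>\<^bsub>Ugrp q\<^esub> m2) * pT \<in> I"
proof -
  note relI = subsetD[OF rel[unfolded relations_eq]]
  have "pT ^ 2 \<in> I"
    by (rule relI, (rule UnI1)+, rule singletonI)
  thus "pT * pT \<in> I" by (simp add: power2_eq_square)
  show "n \<in> WW \<Longrightarrow> pT * pX n \<in> I"
    by (rule relI, rule UnI1, rule UnI1, rule UnI1, rule UnI1, rule UnI1, rule UnI1, rule UnI2, rule CollectI, blast)
  show "m \<in> DD \<Longrightarrow> pT * pY m \<in> I"
    by (rule relI, rule UnI1, rule UnI1, rule UnI1, rule UnI1, rule UnI1, rule UnI2, rule CollectI, blast)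
  show "n \<in> WW \<Longrightarrow> n' \<in> WW \<Longrightarrow> pX n * pX n' \<in> I"
    by (rule relI, rule UnI1, rule UnI1, rule UnI1, rule UnI1, rule UnI2, rule CollectI, blast)
  show "n \<in> WW \<Longrightarrow> m \<in> DD \<Longrightarrow> pX n * pY m \<in> I"
    by (rule relI, rule UnI1, rule UnI1, rule UnI1, rule UnI2, rule CollectI, blast)
  show "m \<in> DD \<Longrightarrow> m' \<in> UU \<Longrightarrow> pY m * pY m' \<in> I"
    by (rule relI, rule UnI1, rule UnI1, rule UnI2, rule CollectI, blast)
  show "n \<in> WW \<Longrightarrow> m' \<in> VV \<Longrightarrow> pX n * pY m' + Const (1 / of_nat (gam q)) * pY m' * pT \<in> I"
    by (rule relI, rule UnI1, rule UnI2, rule CollectI, blast)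
  show "m1 \<in> VV \<Longrightarrow> m2 \<in> VV \<Longrightarrow> pY m1 * pY m2
     - Const (1 - kronecker m1 (inv\<^bsub>Ugrp q\<^esub> m2)) * pY (m1 \<otimes>\<^bsub>Ugrp q\<^esub> m2) * pT \<in> I"
    by (rule relI, rule UnI2, rule CollectI, blast)
qed

lemma X_mult_Y:
  assumes "n \<in> WW" "m \<in> UU" shows "reducible (pX n * pY m)"
proof (cases "m \<in> DD")
  case True
  thus ?thesis using assms relations_in_ideal(5) reducible_ideal by blast
next
  case False
  hence m: "m \<in> VV" using assms UU_cases by blast
  let ?c = "1 / of_nat (gam q)"
  have "pX n * pY m = (pX n * pY m + Const ?c * pY m * pT) + Const (- ?c) * (pY m * pT)"
    by (simp add: Const_def single_uminus mult.assoc)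
  moreover have "reducible \<dots>"
    by (intro reducible_add reducible_Const reducible_basis reducible_ideal relations_in_ideal assms m)
  ultimately show ?thesis by metis
qed

text \<open>The Kronecker factor vanishes exactly when the product of the indices is the identity,
  for which there is no variable; in all other cases the product index stays in
  \<open>VV\<close>.\<close>

lemma Y_mult_Y:
  assumes "m \<in> VV" "m' \<in> VV"
  shows "pY m * pY m' \<in> I \<or> (\<exists>l\<in>VV. pY m * pY m' - pY l * pT \<in> I)"
proof (cases "m = inv\<^bsub>Ugrp q\<^esub> m'")
  case True
  thus ?thesis using relations_in_ideal(8)[OF assms] by (simp add: Const_def)
next
  case False
  hence "m \<otimes>\<^bsub>Ugrp q\<^esub> m' \<in> VV"
    using assms Vgrp_mult_closed Vgrp_subset_Ugrp Ugrp_mult_eq_one[of m m'] by (auto simp: VV_def)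
  thus ?thesis using relations_in_ideal(8)[OF assms] False by (auto simp: Const_def)
qed

text \<open>One multiplication table suffices: a variable times a normal monomial either is directly
  covered by a relation or contains a factor that \<open>T\<close> annihilates. Products of two
  \<open>Y\<close> with indices in \<open>VV\<close> pass to \<open>pY l * pT\<close>, and another
  factor \<open>pT\<close> then kills them through \<open>pT * pT\<close>.\<close>

lemma reducible_Var_normal:
  assumes v: "v \<in> variables q" and m: "m \<in> normal_monomials"
  shows "reducible (Var v * single m 1)"
proof -
  define b :: "('f set variable \<Rightarrow>\<^sub>0 nat) \<Rightarrow>\<^sub>0 'k" where "b = single m 1"
  have b: "b = 1 \<or> b = pT \<or> (\<exists>n\<in>WW. b = pX n) \<or> (\<exists>m\<in>UU. b = pY m) \<or> (\<exists>m\<in>VV. b = pY m * pT)"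
    using m by (auto simp: b_def normal_monomials_def Var_eq_single mult_single)
  have TX: "reducible (pT * pX n)"
    if "n \<in> WW" for n using that by (intro reducible_ideal relations_in_ideal)
  have TY: "reducible (pT * pY m)" if "m \<in> UU" for m
    using that UU_cases reducible_ideal relations_in_ideal(3) reducible_basis(6) by blast
  \<comment> \<open>Whatever \<open>T\<close> annihilates modulo the ideal also annihilates
    \<open>pY m * pT\<close>; this serves \<open>T\<close> itself, every \<open>X\<close> and the
    \<open>Y\<close> with index in \<open>DD\<close>.\<close>
  have TTY: "x * (pY m * pT) \<in> I" if "pT * x \<in> I" "m \<in> VV" for x m
  proof -
    have "(pT * x) * pY m \<in> I" by (rule ideal_closed(4)[OF that(1) vars_closed(4)[OF that(2)]])
    thus ?thesis by (simp add: mult_ac)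
  qed
  consider (T) "v = VarT" | (X) n where "n \<in> WW" "v = VarX n" | (Y) m where "m \<in> UU" "v = VarY m"
    using v by (auto simp: variables_eq)
  hence "reducible (Var v * b)"
  proof cases
    case T
    have "reducible (pT * pT)" by (intro reducible_ideal relations_in_ideal)
    moreover have "reducible (pT * (pY m * pT))" if "m \<in> VV" for m
      using TTY[OF relations_in_ideal(1) that] by (rule reducible_ideal)
    ultimately show ?thesis using b T TX TY reducible_basis by auto
  next
    case X
    have "reducible (pX n * pX n')" if "n' \<in> WW" for n'
      using that X by (intro reducible_ideal relations_in_ideal)
    moreover have "reducible (pX n * (pY m * pT))" if "m \<in> VV" for m
      using TTY[OF relations_in_ideal(2) that] X by (intro reducible_ideal)
    moreover have "reducible (pX n * pT)" using TX[OF X(1)] by (simp add: mult.commute)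
    ultimately show ?thesis using b X X_mult_Y reducible_basis by auto
  next
    case Y
    have "reducible (pY m * pT)" using TY[OF Y(1)] by (simp add: mult.commute)
    moreover have "reducible (pY m * pX n)" if "n \<in> WW" for n
      using X_mult_Y[OF that Y(1)] by (simp add: mult.commute)
    moreover have "reducible (pY m * pY m')" if m': "m' \<in> UU" for m'
    proof -
      consider "m \<in> DD" | "m' \<in> DD" | "m \<in> VV" "m' \<in> VV" using Y m' UU_cases by blast
      thus ?thesis
      proof cases
        case 2
        have "pY m' * pY m \<in> I" using 2 Y by (intro relations_in_ideal)
        thus ?thesis by (intro reducible_ideal) (simp add: mult.commute)
      next
        case 3
        from Y_mult_Y[OF this] show ?thesis
        proof
          assume "\<exists>l\<in>VV. pY m * pY m' - pY l * pT \<in> I"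
          then obtain l where l: "l \<in> VV" "pY m * pY m' - pY l * pT \<in> I" by blast
          have "reducible ((pY m * pY m' - pY l * pT) + pY l * pT)"
            using l by (intro reducible_add reducible_ideal reducible_basis)
          thus ?thesis by simp
        qed (rule reducible_ideal)
      qed (use m' in \<open>intro reducible_ideal relations_in_ideal\<close>)
    qed
    moreover have "reducible (pY m * (pY m' * pT))" if m': "m' \<in> VV" for m'
    proof (cases "m \<in> DD")
      case True
      show ?thesis using TTY[OF relations_in_ideal(3) m'] True by (intro reducible_ideal)
    next
      case False
      hence m: "m \<in> VV" using Y UU_cases by blast
      from Y_mult_Y[OF m m'] have "pY m * pY m' * pT \<in> I"
      proof
        assume "\<exists>l\<in>VV. pY m * pY m' - pY l * pT \<in> I"
        then obtain l where l: "l \<in> VV" "pY m * pY m' - pY l * pT \<in> I" by blast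
        \<comment> \<open>The added term lies in the ideal because of \<open>pT * pT\<close>, and it
          cancels what the multiplied relation leaves over.\<close>
        have "(pY m * pY m' - pY l * pT) * pT + pT * (pY l * pT) \<in> I"
          using l by (intro ideal_closed(2) ideal_closed(4) TTY relations_in_ideal) auto
        thus ?thesis by (simp add: algebra_simps)
      qed (auto intro: ideal_closed(4))
      thus ?thesis by (intro reducible_ideal) (simp add: mult.assoc)
    qed
    ultimately show ?thesis using b Y reducible_basis by auto
  qed
  thus ?thesis by (simp add: b_def)
qed

text \<open>Replacing \<open>f\<close> by a normal form changes the product only by an element of
  the ideal, so by linearity the table for normal monomials applies.\<close>

lemma reducible_Var_mult:
  assumes v: "v \<in> variables q" and f: "reducible f"
  shows "reducible (Var v * f)"
proof -
  obtain g where g: "keys g \<subseteq> normal_monomials" "f - g \<in> I"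
    using f by (auto simp: reducible_def)
  have "reducible (Var v * g)"
    using g(1)
  proof (induction g rule: poly_mapping_single_induct)
    case zero
    show ?case using reducible_ideal[OF ideal_closed(6)] by simp
  next
    case (add m c g)
    have "Var v * (single m c + g) = Const c * (Var v * single m 1) + Var v * g"
      by (simp add: Const_def Var_def mult_single distrib_left add.commute)
    thus ?case using add reducible_Var_normal[OF v] by (simp add: reducible_add reducible_Const)
  qed
  moreover have "reducible (Var v * (f - g))"
    using v g by (intro reducible_ideal ideal_closed(5)) (auto simp: R)
  ultimately have "reducible (Var v * (f - g) + Var v * g)" using reducible_add by blast
  thus ?thesis by (simp add: algebra_simps)
qed

text \<open>A monomial is built from \<open>1\<close> by multiplying with one variable at a time,
  hence the inner induction on the exponent.\<close>

lemma reducible_monomial: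
  assumes "keys m \<subseteq> variables q"
  shows "reducible (single m 1)"
  using assms
proof (induction m rule: poly_mapping_single_induct)
  case zero
  show ?case using reducible_basis(1) by simp
next
  case (add v n m)
  have "reducible (single (single v n + m) 1)"
  proof (induction n)
    case 0
    thus ?case using add.IH by simp
  next
    case (Suc n)
    have "single (single v (Suc n) + m) 1
      = Var v * single (single v n + m) (1 :: 'k)"
      by (simp add: Var_def mult_single add.assoc[symmetric] single_add[symmetric])
    thus ?case using reducible_Var_mult[OF add.hyps(1) Suc.IH] by simp
  qed
  thus ?case .
qed

lemma exists_normal_form:
  assumes "f \<in> carrier R"
  shows "\<exists>g. keys g \<subseteq> normal_monomials \<and> f - g \<in> I"
proof -
  have "keys f \<subseteq> {m. keys m \<subseteq> variables q}"
    using assms by (auto simp: R polynomial_algebra_def)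
  hence "reducible f"
  proof (induction f rule: poly_mapping_single_induct)
    case zero
    show ?case by (rule reducible_ideal[OF ideal_closed(6)])
  next
    case (add m c g)
    have "single m c = Const c * single m 1"
      by (simp add: Const_def mult_single)
    thus ?case using add reducible_monomial by (simp add: reducible_add reducible_Const)
  qed
  thus ?thesis by (simp add: reducible_def)
qed

end

end

section \<open>Class sums of the Borel subgroup\<close>

text \<open>\<open>X\<close> is a union of left cosets of \<open>H\<close>; the induction removes
  one coset at a time.\<close>

lemma (in group) dvd_card_right_invariant:
  assumes H: "subgroup H G" and X: "finite X" "X \<subseteq> carrier G"
    and inv: "\<And>x h. x \<in> X \<Longrightarrow> h \<in> H \<Longrightarrow> x \<otimes> h \<in> X"
  shows "card H dvd card X"
  using X inv
proof (induction X rule: finite_psubset_induct)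
  case (psubset X)
  interpret H: subgroup H G by fact
  show ?case
  proof (cases "X = {}")
    case False
    then obtain x where x: "x \<in> X" by blast
    let ?xH = "(\<lambda>h. x \<otimes> h) ` H"
    have xG: "x \<in> carrier G" and sub: "?xH \<subseteq> X" using x psubset by auto
    have xin: "x \<in> ?xH" using xG by (intro image_eqI[of _ _ \<one>]) auto
    have "card H dvd card (X - ?xH)"
    proof (rule psubset.IH)
      show "X - ?xH \<subset> X" using x xin by blast
      show "X - ?xH \<subseteq> carrier G" using psubset.prems(1) by blast
      fix y h assume y: "y \<in> X - ?xH" and h: "h \<in> H"
      have yG: "y \<in> carrier G" using y psubset.prems by auto
      have "y \<otimes> h \<notin> ?xH"
      proof
        assume "y \<otimes> h \<in> ?xH"
        then obtain h' where h': "h' \<in> H" "y \<otimes> h = x \<otimes> h'" by auto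
        have "y = x \<otimes> (h' \<otimes> inv h)"
        proof -
          have hG: "h \<in> carrier G" "h' \<in> carrier G" using h h' by auto
          have "(y \<otimes> h) \<otimes> inv h = y" using hG yG by (simp add: m_assoc)
          thus ?thesis unfolding h'(2) using hG xG by (simp add: m_assoc)
        qed
        thus False using y h h' by auto
      qed
      thus "y \<otimes> h \<in> X - ?xH" using y h psubset.prems by auto
    qed
    moreover have "card ?xH = card H"
      by (rule card_image) (auto simp: inj_on_def xG)
    moreover have "card X = card (X - ?xH) + card ?xH"
    proof -
      have "X = (X - ?xH) \<union> ?xH" using sub by blast
      moreover have "finite (X - ?xH)" "finite ?xH" "(X - ?xH) \<inter> ?xH = {}"
        using psubset(1) finite_subset[OF sub] by auto
      ultimately show ?thesis using card_Un_disjoint by metis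
    qed
    ultimately show ?thesis by simp
  qed simp
qed

text \<open>\<open>H\<close> acts freely on factorisations by moving \<open>h\<close> across:
  \<open>(x, y)\<close> becomes \<open>(x h, h\<inverse> y)\<close>. This explains why right
  invariance is asked of \<open>C\<close> and left invariance of \<open>D\<close>.\<close>

lemma (in group) dvd_card_products:
  assumes H: "subgroup H G" and fin: "finite (carrier G)" and C: "C \<subseteq> carrier G" and D: "D \<subseteq> carrier G"
    and z: "z \<in> carrier G"
    and Cinv: "\<And>x h. x \<in> C \<Longrightarrow> h \<in> H \<Longrightarrow> x \<otimes> h \<in> C"
    and Dinv: "\<And>x h. x \<in> D \<Longrightarrow> h \<in> H \<Longrightarrow> h \<otimes> x \<in> D"
  shows "card H dvd card {(x, y). x \<in> C \<and> y \<in> D \<and> x \<otimes> y = z}"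
proof -
  interpret H: subgroup H G by fact
  have "card {(x, y). x \<in> C \<and> y \<in> D \<and> x \<otimes> y = z} = card {x \<in> C. inv x \<otimes> z \<in> D}"
    by (rule bij_betw_same_card[of fst], rule bij_betw_byWitness[where f' = "\<lambda>x. (x, inv x \<otimes> z)"])
       (use C D z in \<open>auto simp: inv_cancel_left subset_iff\<close>)
  also have "card H dvd \<dots>"
  proof (rule dvd_card_right_invariant[OF H])
    fix x h assume x: "x \<in> {x \<in> C. inv x \<otimes> z \<in> D}" and h: "h \<in> H"
    have "inv h \<otimes> (inv x \<otimes> z) \<in> D" using x h Dinv H.m_inv_closed by auto
    also have "inv h \<otimes> (inv x \<otimes> z) = inv (x \<otimes> h) \<otimes> z"
      using x h C z by (auto simp: inv_mult_group m_assoc)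
    finally show "x \<otimes> h \<in> {x \<in> C. inv x \<otimes> z \<in> D}" using x h Cinv by auto
  next
    show "finite {x \<in> C. inv x \<otimes> z \<in> D}" using finite_subset[OF C fin] by simp
  qed (use C in auto)
  finally show ?thesis .
qed

section \<open>The equation that counts products of two torus classes\<close>

context quadratic_field
begin

text \<open>The condition under which the unitriangular matrix with first row
  \<open>(1, a, b)\<close> preserves the hermitian form \<open>std_form\<close>.\<close>

definition herm :: "'f \<Rightarrow> 'f \<Rightarrow> bool" where
  "herm a b \<longleftrightarrow> b + b ^ q + a * a ^ q = 0"

text \<open>The conjugates of \<open>E 0 0 t\<close> in the coset of \<open>t\<close>, for \<open>t\<close> of norm one, are the
  \<open>E a (kap t * a\<^sup>q\<^sup>+\<^sup>1) t\<close>.\<close>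

definition kap :: "'f \<Rightarrow> 'f" where
  "kap t = 1 / (chi q t - 1)"

lemma herm_conj: "herm a b \<Longrightarrow> b ^ q = - b - a * a ^ q"
  by (simp add: herm_def eq_neg_iff_add_eq_0 algebra_simps)

lemma exists_herm: "\<exists>b. herm a b"
proof -
  have "(- (a * a ^ q)) ^ q = - (a * a ^ q)" by (simp add: frob_simps mult.commute)
  from trace_surj[OF this] show ?thesis by (metis add.left_inverse herm_def)
qed

lemma exists_trace_zero: "\<exists>b \<noteq> 0. herm 0 b"
proof -
  have "card {x :: 'f. x ^ q + 1 * x = 0} = q" by (rule card_additive_fibre) auto
  hence "card {x :: 'f. x ^ q + 1 * x = 0} \<noteq> card {0 :: 'f}" using q_ge_2 by simp
  hence "{x :: 'f. x ^ q + 1 * x = 0} \<noteq> {0}" by metis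
  moreover have "(0 :: 'f) \<in> {x :: 'f. x ^ q + 1 * x = 0}" by simp
  ultimately obtain x :: 'f where "x ^ q + 1 * x = 0" "x \<noteq> 0" by blast
  thus ?thesis by (auto simp: herm_def add.commute)
qed

text \<open>For \<open>w\<close> of norm one, \<open>w ^ q\<close> is the inverse of
  \<open>w\<close>, and the rest is arithmetic with \<open>1 / (w - 1)\<close>. The second identity
  says that \<open>c\<close> has trace \<open>- 1\<close>, which is why
  \<open>c * (a * a ^ q)\<close> is an admissible \<open>b\<close> for \<open>a\<close>.\<close>

lemma norm_one_facts:
  assumes w: "w \<noteq> 1" "w * w ^ q = (1 :: 'f)"
  defines "c \<equiv> 1 / (w - 1)"
  shows "w * c = 1 + c" "c ^ q = - (1 + c)" "w ^ q * (1 + c) = c"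
proof -
  have w0: "w \<noteq> 0" using w by auto
  have wq: "w ^ q = 1 / w" using w w0 by (simp add: field_simps)
  show 1: "w * c = 1 + c" using w by (simp add: c_def field_simps)
  show "c ^ q = - (1 + c)"
  proof -
    have "c ^ q = 1 / (1 / w - 1)" by (simp add: c_def frob_simps wq)
    also have "\<dots> = - (w * c)" using w w0 by (simp add: c_def field_simps)
    finally show ?thesis using 1 by simp
  qed
  show "w ^ q * (1 + c) = c" using 1 w w0 by (simp flip: 1 add: wq)
qed

text \<open>Here \<open>w\<close> and \<open>u\<close> are the \<open>chi\<close> values of two
  torus elements of norm one. Writing \<open>E X Y\<close> as a product of members of their classes,
  \<open>b\<close> is the first coordinate of the second factor and \<open>X - w * b\<close> that of
  the first; comparing second coordinates gives the equation in \<open>S\<close>.\<close>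

lemma card_kap_fibre:
  fixes X Y w u :: 'f
  assumes w: "w \<noteq> 1" "w * w ^ q = 1" and u: "u \<noteq> 1" "u * u ^ q = 1" and XY: "herm X Y"
  defines "c \<equiv> 1 / (w - 1)" and "d \<equiv> 1 / (u - 1)"
  defines "S \<equiv> {b. c * ((X - w * b) * (X - w * b) ^ q) + d * (b * b ^ q) - (X - w * b) * (w * b) ^ q = Y}"
  shows "if w * u = 1 then q dvd card S else card S = 1 \<or> card S = q + 1"
proof -
  note c = norm_one_facts[OF w, folded c_def]
  note d = norm_one_facts[OF u, folded d_def]
  \<comment> \<open>\<open>k\<close> is the coefficient of the norm of \<open>b\<close> after
    expansion; up to the nonzero factor \<open>(w - 1) * (u - 1)\<close> it equals
    \<open>w * u - 1\<close>, so it decides between the trace and the norm equation.\<close>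
  define k where "k = c + d + 1"
  define v where "v = (1 + c) * X ^ q"
  have vq: "v ^ q = - c * X" by (simp add: v_def frob_simps c)
  have kq: "k ^ q = - k" by (simp add: k_def frob_simps c d)
  have k: "(w - 1) * (u - 1) * k = w * u - 1"
  proof -
    have cd: "(w - 1) * c = 1" "(u - 1) * d = 1" using w u by (simp_all add: c_def d_def)
    have "(w - 1) * (u - 1) * k = (u - 1) * ((w - 1) * c) + (w - 1) * ((u - 1) * d) + (w - 1) * (u - 1)"
      by (simp add: k_def algebra_simps)
    thus ?thesis unfolding cd by (simp add: algebra_simps)
  qed
  have eq: "c * ((X - w * b) * (X - w * b) ^ q) + d * (b * b ^ q) - (X - w * b) * (w * b) ^ q
    = c * X * X ^ q + k * (b * b ^ q) + v ^ q * b ^ q - v * b" for b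
  proof -
    have "c * ((X - w * b) * (X - w * b) ^ q) + d * (b * b ^ q) - (X - w * b) * (w * b) ^ q
      = c * X * X ^ q - w ^ q * (1 + c) * (X * b ^ q) - w * c * (X ^ q * b)
        + (w * w ^ q * (1 + c) + d) * (b * b ^ q)"
      by (simp add: frob_simps algebra_simps)
    thus ?thesis unfolding c w(2) vq by (simp add: k_def v_def algebra_simps)
  qed
  let ?Y = "Y - c * X * X ^ q"
  have Yq: "?Y ^ q = - ?Y"
  proof -
    show ?thesis by (simp add: frob_simps c herm_conj[OF XY] algebra_simps)
  qed
  show ?thesis
  proof (cases "w * u = 1")
    case True
    hence "k = 0" using k w u by simp
    hence "S = {b. (v * b) ^ q + - 1 * (v * b) = ?Y}"
      unfolding S_def eq by (auto simp: frob_simps algebra_simps)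
    thus ?thesis using True dvd_card_additive_fibre[of "- 1" v ?Y] by simp
  next
    case False
    hence k0: "k \<noteq> 0" using k by auto
    \<comment> \<open>The shift that completes the square: as \<open>k ^ q = - k\<close>, one value
      of \<open>s\<close> absorbs both linear terms \<open>v ^ q * b ^ q\<close> and
      \<open>- v * b\<close>.\<close>
    define s where "s = v ^ q / k"
    have sq: "s ^ q = - v / k" by (simp add: s_def frob_simps kq)
    define e where "e = ?Y / k + s * s ^ q"
    have "(?Y / k) ^ q = ?Y / k" by (simp only: power_divide Yq kq minus_divide_divide)
    moreover have "(s * s ^ q) ^ q = s * s ^ q" by (simp add: power_mult_distrib mult.commute)
    ultimately have "e ^ q = e" by (simp only: e_def frob_add)
    note card_e = card_norm_fibre[OF this]
    have "S = {b. (b + s) ^ (q + 1) = e}"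
    proof -
      have "k * ((b + s) ^ (q + 1)) = k * (b * b ^ q) + v ^ q * b ^ q - v * b + k * (s * s ^ q)" for b
      proof -
        have "k * ((b + s) ^ (q + 1)) = k * (b * b ^ q) + (k * s) * b ^ q + (k * s ^ q) * b + k * (s * s ^ q)"
          by (simp add: frob_simps algebra_simps)
        also have "k * s = v ^ q" using k0 by (simp add: s_def)
        also have "k * s ^ q = - v" using k0 by (simp add: sq)
        finally show ?thesis by simp
      qed
      moreover have "k * e = ?Y + k * (s * s ^ q)" using k0 by (simp add: e_def field_simps)
      ultimately have "(b + s) ^ (q + 1) = e \<longleftrightarrow>
        k * (b * b ^ q) + v ^ q * b ^ q - v * b + k * (s * s ^ q) = ?Y + k * (s * s ^ q)" for b
        using k0 by (metis mult_cancel_left)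
      thus ?thesis unfolding S_def eq by (auto simp: algebra_simps)
    qed
    moreover have "card {b. (b + s) ^ (q + 1) = e} = card {x. x ^ (q + 1) = e}"
      by (rule bij_betw_same_card[of "\<lambda>b. b + s"], rule bij_betw_byWitness[where f' = "\<lambda>x. x - s"]) auto
    ultimately show ?thesis using False card_e by (auto split: if_splits)
  qed
qed

end

text \<open>\<open>E a b t\<close> is the class modulo scalars of the product of the unitriangular matrix with rows
  \<open>(1, a, b)\<close>, \<open>(0, 1, - a\<^sup>q)\<close>, \<open>(0, 0, 1)\<close> and the diagonal matrix with entries \<open>t\<close>, \<open>t\<^sup>q\<^sup>-\<^sup>1\<close>, \<open>t\<^sup>-\<^sup>q\<close>. It is
  constrained only for \<open>herm a b\<close> and \<open>t \<noteq> 0\<close>.\<close>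

locale borel = quadratic_field p r q F + group G
  for p r q and F :: "'f::{field,finite} itself" and G :: "('g, 'c) monoid_scheme" (structure) +
  fixes E :: "'f \<Rightarrow> 'f \<Rightarrow> 'f \<Rightarrow> 'g"
  assumes E_closed: "herm a b \<Longrightarrow> t \<noteq> 0 \<Longrightarrow> E a b t \<in> carrier G"
    and E_surj: "x \<in> carrier G \<Longrightarrow> \<exists>a b t. herm a b \<and> t \<noteq> 0 \<and> x = E a b t"
    and E_mult: "herm a b \<Longrightarrow> t \<noteq> 0 \<Longrightarrow> herm a' b' \<Longrightarrow> t' \<noteq> 0 \<Longrightarrow> E a b t \<otimes> E a' b' t' =
      E (a + chi q t * a') (b + t * t ^ q * b' - a * (chi q t * a') ^ q) (t * t')"
    and E_eq_iff: "herm a b \<Longrightarrow> t \<noteq> 0 \<Longrightarrow> herm a' b' \<Longrightarrow> t' \<noteq> 0 \<Longrightarrow>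
      E a b t = E a' b' t' \<longleftrightarrow> a = a' \<and> b = b' \<and> t / t' \<in> Gam q"
begin

lemma finite_G: "finite (carrier G)"
proof (rule finite_subset)
  show "carrier G \<subseteq> (\<lambda>(a, b, t). E a b t) ` UNIV" using E_surj by (auto simp: image_iff) blast
qed simp

lemma herm_zero [simp]: "herm 0 0" by (simp add: herm_def)

lemma E_one: "E 0 0 1 = \<one>"
proof -
  have "E 0 0 1 \<otimes> E 0 0 1 = E 0 0 1" by (simp add: E_mult)
  thus ?thesis using E_closed[of 0 0 1] by (metis herm_zero l_cancel_one one_neq_zero)
qed

lemma herm_mult:
  assumes "herm a b" "herm a' b'" "t \<noteq> 0"
  shows "herm (a + chi q t * a') (b + t * t ^ q * b' - a * (chi q t * a') ^ q)"
proof -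
  have n: "t * t ^ q = chi q t * chi q t ^ q" using chi_norm assms(3) by simp
  show ?thesis
    unfolding herm_def n by (simp add: frob_simps herm_conj[OF assms(1)] herm_conj[OF assms(2)] algebra_simps)
qed

text \<open>Conjugacy classes: \<open>PP {0}\<close> is the centre of the unipotent group, \<open>PP n\<close> for \<open>n\<close> in \<open>WW\<close> a class of
  non-central unipotent elements; \<open>SS m\<close> is the coset over \<open>m\<close>, a single class for \<open>m\<close> in \<open>DD\<close>, and \<open>KK m\<close>
  is the class of the torus element over \<open>m\<close> in \<open>VV\<close>.\<close>

definition PP :: "'f set \<Rightarrow> 'g set" where "PP A = {E a b 1 | a b. a \<in> A \<and> herm a b}"
definition SS :: "'f set \<Rightarrow> 'g set" where "SS m = {E a b t | a b t. t \<in> m \<and> herm a b}"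
definition KK :: "'f set \<Rightarrow> 'g set" where "KK m = {E a (kap t * (a * a ^ q)) t | a t. t \<in> m}"

lemma mem_PP_iff: "herm a b \<Longrightarrow> t \<noteq> 0 \<Longrightarrow> E a b t \<in> PP A \<longleftrightarrow> a \<in> A \<and> t \<in> Gam q"
  by (force simp: PP_def E_eq_iff)

lemma cl_cong_Gam: "t \<noteq> 0 \<Longrightarrow> s \<in> cl t \<Longrightarrow> s \<noteq> 0 \<and> s / t \<in> Gam q"
  using Gam_nonzero[of "s / t"] by (auto simp: mem_mcoset_iff)

lemma mem_SS_iff: "herm a b \<Longrightarrow> t \<noteq> 0 \<Longrightarrow> s \<noteq> 0 \<Longrightarrow> E a b t \<in> SS (cl s) \<longleftrightarrow> t / s \<in> Gam q"
proof
  assume *: "herm a b" "t \<noteq> 0" "s \<noteq> 0" "t / s \<in> Gam q"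
  thus "E a b t \<in> SS (cl s)" by (auto simp: SS_def mem_mcoset_iff)
next
  assume *: "herm a b" "t \<noteq> 0" "s \<noteq> 0" "E a b t \<in> SS (cl s)"
  then obtain a' b' t' where **: "E a b t = E a' b' t'" "t' \<in> cl s" "herm a' b'" by (auto simp: SS_def)
  hence "t' \<noteq> 0 \<and> t' / s \<in> Gam q" using cl_cong_Gam * by blast
  moreover have "t / t' \<in> Gam q" using E_eq_iff * ** calculation by blast
  ultimately show "t / s \<in> Gam q" using Gam_mult[of "t / t'" "t' / s"] by simp
qed

lemma Gam_imp_chi_eq: "(s :: 'f) \<noteq> 0 \<Longrightarrow> t \<noteq> 0 \<Longrightarrow> s / t \<in> Gam q \<Longrightarrow> chi q s = chi q t"
  using chi_cong by blast

lemma chi_Psi: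
  assumes "(t :: 'f) \<in> Psi q" "t \<notin> Gam q"
  shows "chi q t \<noteq> 1" "chi q t * chi q t ^ q = 1" "t * t ^ q = 1"
  using assms Psi_nonzero[OF assms(1)] chi_eq_1_iff[of t] chi_norm[of t] by (auto simp: mem_Psi_iff)

lemma herm_kap:
  assumes "t \<in> Psi q" "t \<notin> Gam q"
  shows "herm a (kap t * (a * a ^ q))"
proof -
  have "kap t ^ q = - (1 + kap t)"
    using norm_one_facts(2)[OF chi_Psi(1,2)[OF assms]] by (simp only: kap_def)
  moreover have "(kap t * (a * a ^ q)) ^ q = kap t ^ q * (a * a ^ q)"
    by (simp add: power_mult_distrib mult.commute)
  ultimately show ?thesis by (simp only: herm_def) (simp add: algebra_simps)
qed

text \<open>\<open>kap\<close> depends on \<open>t\<close> only through \<open>chi\<close>, hence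
  only on the class of \<open>t\<close> modulo \<open>Gam q\<close>, so any representative of the
  class describes the same set.\<close>

lemma mem_KK_iff:
  assumes ab: "herm a b" and t: "t \<noteq> 0" and s: "s \<in> Psi q" "s \<notin> Gam q"
  shows "E a b t \<in> KK (cl s) \<longleftrightarrow> t / s \<in> Gam q \<and> b = kap s * (a * a ^ q)"
proof -
  have s0: "s \<noteq> 0" using Psi_nonzero s by auto
  have *: "kap t' = kap s" "t' \<in> Psi q" "t' \<notin> Gam q" "t' \<noteq> 0" if "t' \<noteq> 0" "t' / s \<in> Gam q" for t'
  proof -
    show "kap t' = kap s" using Gam_imp_chi_eq that s0 by (simp add: kap_def)
    show "t' \<in> Psi q" using Psi_mult[of "t' / s" s] that s s0 Gam_subset_Psi by auto
    show "t' \<notin> Gam q" using chi_eq_1_iff that s0 s Gam_imp_chi_eq by metis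
  qed fact
  show ?thesis
  proof
    assume "E a b t \<in> KK (cl s)"
    then obtain a' t' where **: "E a b t = E a' (kap t' * (a' * a' ^ q)) t'" "t' \<in> cl s"
      by (auto simp: KK_def)
    have t': "t' \<noteq> 0" "t' / s \<in> Gam q" using cl_cong_Gam[OF s0] ** by auto
    note *** = *[OF t']
    have "a = a' \<and> b = kap t' * (a' * a' ^ q) \<and> t / t' \<in> Gam q"
      using E_eq_iff[OF ab t herm_kap[OF ***(2,3)] t'(1)] **(1) by blast
    thus "t / s \<in> Gam q \<and> b = kap s * (a * a ^ q)"
      using Gam_mult[of "t / t'" "t' / s"] t' *** by auto
  next
    assume "t / s \<in> Gam q \<and> b = kap s * (a * a ^ q)"
    hence "t \<in> cl s \<and> E a b t = E a (kap t * (a * a ^ q)) t"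
      using *[OF t] s0 by (simp add: mem_mcoset_iff)
    thus "E a b t \<in> KK (cl s)" unfolding KK_def by blast
  qed
qed

lemma PP_closed: "PP A \<subseteq> carrier G"
  using E_closed by (auto simp: PP_def)

lemma SS_closed: "m \<in> UU \<Longrightarrow> SS m \<subseteq> carrier G"
  using E_closed cl_cong_Gam unfolding SS_def UU_def carrier_Ugrp by fast

lemma cl_in_index: "t \<noteq> 0 \<Longrightarrow> cl t \<in> UU \<longleftrightarrow> t \<notin> Gam q"
  "t \<noteq> 0 \<Longrightarrow> cl t \<in> VV \<longleftrightarrow> t \<in> Psi q \<and> t \<notin> Gam q"
  "t \<noteq> 0 \<Longrightarrow> cl t \<in> DD \<longleftrightarrow> t \<notin> Psi q"
  by (auto simp: UU_def VV_def DD_def carrier_Ugrp cl_in_Vgrp Ugrp_one cl_eq_iff)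

lemma UU_E:
  assumes "m \<in> UU"
  obtains t where "t \<noteq> 0" "t \<notin> Gam q" "m = cl t"
proof -
  obtain t where "t \<noteq> 0" "m = cl t" using assms by (auto simp: UU_def carrier_Ugrp)
  thus ?thesis using assms that by (simp add: cl_in_index)
qed

lemma VV_E:
  assumes "m \<in> VV"
  obtains t where "t \<in> Psi q" "t \<notin> Gam q" "t \<noteq> 0" "m = cl t"
proof -
  obtain t where t: "t \<noteq> 0" "m = cl t" using assms Psi_nonzero by (auto simp: VV_def carrier_Vgrp)
  hence "t \<in> Psi q \<and> t \<notin> Gam q" using assms by (simp add: cl_in_index)
  thus ?thesis using that t by blast
qed

lemma KK_subset_SS: "m \<in> VV \<Longrightarrow> KK m \<subseteq> SS m"
proof -
  assume "m \<in> VV"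
  then obtain s where s: "s \<in> Psi q" "s \<notin> Gam q" "s \<noteq> 0" "m = cl s" by (rule VV_E)
  have "herm a (kap t * (a * a ^ q))" if "t \<in> cl s" for a t
  proof (rule herm_kap)
    have t: "t \<noteq> 0" "t / s \<in> Gam q" using cl_cong_Gam s that by auto
    show "t \<in> Psi q" using Psi_mult[of "t / s" s] t s Gam_subset_Psi by auto
    show "t \<notin> Gam q" using chi_eq_1_iff t s Gam_imp_chi_eq by metis
  qed
  thus ?thesis using s by (fastforce simp: KK_def SS_def)
qed

text \<open>The conjugacy class whose sum is the image of \<open>Y_m\<close>: the coset over
  \<open>m\<close> is a single class outside \<open>VV\<close>, but splits for \<open>m\<close> in
  \<open>VV\<close>.\<close>

definition YS :: "'f set \<Rightarrow> 'g set" where "YS m = (if m \<in> VV then KK m else SS m)"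

lemma YS_closed: "m \<in> UU \<Longrightarrow> YS m \<subseteq> carrier G"
  using SS_closed KK_subset_SS by (auto simp: YS_def)

abbreviation A :: "('k::field, 'g \<Rightarrow>\<^sub>0 'k) module" where "A \<equiv> centre_algebra (group_algebra G)"

lemma central_sumI:
  assumes C: "C \<subseteq> carrier G" and comm: "\<And>x y. x \<in> carrier G \<Longrightarrow> y \<in> carrier G \<Longrightarrow> x \<otimes> y \<in> C \<Longrightarrow> y \<otimes> x \<in> C"
  shows "formal_sum C \<in> carrier A"
proof -
  have "finite C" using C finite_G finite_subset by blast
  thus ?thesis
    using comm by (subst group_algebra_central_iff)
      (auto simp: finite_G formal_sum_closed C lookup_formal_sum)
qed

lemma product_cases:
  assumes "x \<in> carrier G" "y \<in> carrier G"
  obtains a b t a' b' t' where "herm a b" "t \<noteq> 0" "x = E a b t" "herm a' b'" "t' \<noteq> 0" "y = E a' b' t'"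
    "x \<otimes> y = E (a + chi q t * a') (b + t * t ^ q * b' - a * (chi q t * a') ^ q) (t * t')"
    "y \<otimes> x = E (a' + chi q t' * a) (b' + t' * t' ^ q * b - a' * (chi q t' * a) ^ q) (t * t')"
    "herm (a + chi q t * a') (b + t * t ^ q * b' - a * (chi q t * a') ^ q)"
    "herm (a' + chi q t' * a) (b' + t' * t' ^ q * b - a' * (chi q t' * a) ^ q)"
proof -
  obtain a b t a' b' t' where *: "herm a b" "t \<noteq> 0" "x = E a b t" "herm a' b'" "t' \<noteq> 0" "y = E a' b' t'"
    using E_surj[OF assms(1)] E_surj[OF assms(2)] by auto
  show ?thesis
  proof (rule that[OF *])
    show "y \<otimes> x = E (a' + chi q t' * a) (b' + t' * t' ^ q * b - a' * (chi q t' * a) ^ q) (t * t')"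
      using E_mult[OF *(4,5,1,2)] * by (simp add: mult.commute[of t' t])
  qed (use * E_mult herm_mult in auto)
qed

text \<open>\<open>x y\<close> and \<open>y x\<close> have the same torus part
  \<open>t * t'\<close>, which lies in \<open>Gam q\<close>, so
  \<open>chi q t * chi q t' = 1\<close>; multiplication by \<open>chi q t'\<close> then carries the
  first coordinate of \<open>x y\<close> to that of \<open>y x\<close>. The sets \<open>{0}\<close>
  and the cosets of \<open>Lset q\<close> are both stable under this.\<close>

lemma central_PP:
  assumes B: "\<And>a c. a \<in> B \<Longrightarrow> c \<in> Lset q \<Longrightarrow> a * c \<in> B"
  shows "formal_sum (PP B) \<in> carrier A"
proof (rule central_sumI[OF PP_closed])
  fix x y assume xG: "x \<in> carrier G" and yG: "y \<in> carrier G" and xy: "x \<otimes> y \<in> PP B"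
  obtain a b t a' b' t' where *: "t \<noteq> 0" "t' \<noteq> 0"
    "x \<otimes> y = E (a + chi q t * a') (b + t * t ^ q * b' - a * (chi q t * a') ^ q) (t * t')"
    "y \<otimes> x = E (a' + chi q t' * a) (b' + t' * t' ^ q * b - a' * (chi q t' * a) ^ q) (t * t')"
    "herm (a + chi q t * a') (b + t * t ^ q * b' - a * (chi q t * a') ^ q)"
    "herm (a' + chi q t' * a) (b' + t' * t' ^ q * b - a' * (chi q t' * a) ^ q)"
    by (rule product_cases[OF xG yG], rule that)
  have "a + chi q t * a' \<in> B" and tt: "t * t' \<in> Gam q"
    using xy mem_PP_iff[OF *(5)] * by auto
  hence "(a + chi q t * a') * chi q t' \<in> B" using B * by (simp add: Lset_eq_chi)
  moreover have "chi q t * chi q t' = 1" using tt * chi_eq_1_iff[of "t * t'"] by (simp add: chi_mult)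
  hence "(a + chi q t * a') * chi q t' = a' + chi q t' * a"
  proof -
    assume "chi q t * chi q t' = 1"
    moreover have "(a + chi q t * a') * chi q t' = chi q t' * a + (chi q t * chi q t') * a'"
      by (simp add: algebra_simps)
    ultimately show ?thesis by simp
  qed
  ultimately show "y \<otimes> x \<in> PP B"
    using mem_PP_iff[OF *(6)] tt * by auto
qed

lemma central_SS:
  assumes "m \<in> UU"
  shows "formal_sum (SS m) \<in> carrier A"
proof (rule central_sumI[OF SS_closed[OF assms]])
  fix x y assume xG: "x \<in> carrier G" and yG: "y \<in> carrier G" and xy: "x \<otimes> y \<in> SS m"
  obtain a b t a' b' t' where *: "t \<noteq> 0" "t' \<noteq> 0"
    "x \<otimes> y = E (a + chi q t * a') (b + t * t ^ q * b' - a * (chi q t * a') ^ q) (t * t')"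
    "y \<otimes> x = E (a' + chi q t' * a) (b' + t' * t' ^ q * b - a' * (chi q t' * a) ^ q) (t * t')"
    "herm (a + chi q t * a') (b + t * t ^ q * b' - a * (chi q t * a') ^ q)"
    "herm (a' + chi q t' * a) (b' + t' * t' ^ q * b - a' * (chi q t' * a) ^ q)"
    by (rule product_cases[OF xG yG], rule that)
  obtain s where s: "s \<noteq> 0" "m = cl s" using assms by (rule UU_E)
  show "y \<otimes> x \<in> SS m"
    using xy mem_SS_iff[OF *(5) _ s(1), of "t * t'"] mem_SS_iff[OF *(6) _ s(1), of "t * t'"] * s by simp
qed

text \<open>Membership means that the defect \<open>b - kap s * (a * a ^ q)\<close> vanishes.
  Multiplying the defect of \<open>x y\<close> by the norm of \<open>chi q t'\<close> gives the
  defect of \<open>y x\<close>, because the product of the two torus parts has norm one.\<close>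

lemma central_KK:
  assumes "m \<in> VV"
  shows "formal_sum (KK m) \<in> carrier A"
proof (rule central_sumI)
  have "m \<in> UU" using assms UU_cases by blast
  thus "KK m \<subseteq> carrier G" using KK_subset_SS[OF assms] SS_closed by blast
next
  fix x y assume xG: "x \<in> carrier G" and yG: "y \<in> carrier G" and xy: "x \<otimes> y \<in> KK m"
  obtain a b t a' b' t' where *: "t \<noteq> 0" "t' \<noteq> 0"
    "x \<otimes> y = E (a + chi q t * a') (b + t * t ^ q * b' - a * (chi q t * a') ^ q) (t * t')"
    "y \<otimes> x = E (a' + chi q t' * a) (b' + t' * t' ^ q * b - a' * (chi q t' * a) ^ q) (t * t')"
    "herm (a + chi q t * a') (b + t * t ^ q * b' - a * (chi q t * a') ^ q)"
    "herm (a' + chi q t' * a) (b' + t' * t' ^ q * b - a' * (chi q t' * a) ^ q)"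
    by (rule product_cases[OF xG yG], rule that)
  obtain s where s: "s \<in> Psi q" "s \<notin> Gam q" "s \<noteq> 0" "m = cl s" using assms by (rule VV_E)
  let ?A = "a + chi q t * a'" and ?B = "b + t * t ^ q * b' - a * (chi q t * a') ^ q"
  let ?A' = "a' + chi q t' * a" and ?B' = "b' + t' * t' ^ q * b - a' * (chi q t' * a) ^ q"
  have tt: "t * t' / s \<in> Gam q" and B: "?B = kap s * (?A * ?A ^ q)"
    using xy mem_KK_iff[OF *(5) _ s(1,2), of "t * t'"] * s by auto
  define w w' c where "w = chi q t" and "w' = chi q t'" and "c = kap s"
  have n: "t * t ^ q = w * w ^ q" "t' * t' ^ q = w' * w' ^ q"
    using chi_norm * by (simp_all add: w_def w'_def)
  have cs: "chi q s = w * w'" using Gam_imp_chi_eq[of "t * t'" s] tt * s by (simp add: chi_mult w_def w'_def)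
  have ww: "w * w' \<noteq> 1" "(w * w') * (w * w') ^ q = 1"
    using chi_Psi(1,2)[OF s(1,2)] by (simp_all add: cs)
  have c: "c = 1 / (w * w' - 1)" by (simp add: c_def kap_def cs)
  have nn: "w' * w' ^ q * (w * w ^ q) = 1" using ww by (simp add: frob_simps mult_ac)
  have e1: "c * (w' * w' ^ q * w) = (1 + c) * w' ^ q"
    using norm_one_facts(1)[OF ww, folded c] by (metis mult.commute mult.left_commute)
  have e2: "(1 + c) * (w' * w' ^ q * w ^ q) = c * w'"
  proof -
    have "(1 + c) * (w' * w' ^ q * w ^ q) = w' * ((w * w') ^ q * (1 + c))"
      by (simp add: frob_simps algebra_simps)
    thus ?thesis unfolding norm_one_facts(3)[OF ww, folded c] by (simp add: mult.commute)
  qed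
  have "w' * w' ^ q * (?B - kap s * (?A * ?A ^ q)) = w' * w' ^ q * b + (w' * w' ^ q * (w * w ^ q)) * b'
     - ((1 + c) * (w' * w' ^ q * w ^ q)) * (a * a' ^ q) - c * (w' * w' ^ q) * (a * a ^ q)
     - (c * (w' * w' ^ q * w)) * (a' * a ^ q) - c * (w' * w' ^ q * (w * w ^ q)) * (a' * a' ^ q)"
    unfolding n c_def[symmetric] w_def[symmetric] w'_def[symmetric]
    by (simp add: frob_simps algebra_simps)
  also have "\<dots> = ?B' - kap s * (?A' * ?A' ^ q)"
    unfolding e1 e2 nn
    unfolding n c_def[symmetric] w_def[symmetric] w'_def[symmetric]
    by (simp add: frob_simps algebra_simps)
  finally have "?B' = kap s * (?A' * ?A' ^ q)" using B by simp
  thus "y \<otimes> x \<in> KK m"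
    using mem_KK_iff[OF *(6) _ s(1,2), of "t * t'"] tt * s by auto
qed

end

section \<open>Counting factorisations into classes\<close>

context borel
begin

lemma PP_E:
  assumes "x \<in> PP B"
  obtains a b where "a \<in> B" "herm a b" "x = E a b 1"
  using assms by (auto simp: PP_def)

lemma SS_E:
  assumes "x \<in> SS (cl s)" "s \<noteq> 0"
  obtains a b where "herm a b" "x = E a b s"
proof -
  obtain a b t where *: "t \<in> cl s" "herm a b" "x = E a b t" using assms by (auto simp: SS_def)
  hence "t \<noteq> 0 \<and> t / s \<in> Gam q" using cl_cong_Gam assms by blast
  hence "x = E a b s" using * assms by (simp add: E_eq_iff)
  thus ?thesis using that * by blast
qed

lemma KK_E:
  assumes "x \<in> KK (cl s)" "s \<in> Psi q" "s \<notin> Gam q"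
  obtains a where "x = E a (kap s * (a * a ^ q)) s"
proof -
  have s: "s \<noteq> 0" "cl s \<in> VV" using assms Psi_nonzero[OF assms(2)] by (auto simp: cl_in_index)
  then obtain a b where *: "herm a b" "x = E a b s" using SS_E KK_subset_SS assms by blast
  hence "b = kap s * (a * a ^ q)" using mem_KK_iff[of a b s s] assms s by simp
  thus ?thesis using that * by blast
qed

lemma PP_zero_subgroup: "subgroup (PP {0}) G"
proof (rule subgroupI)
  show "PP {0} \<noteq> {}" using exists_trace_zero by (auto simp: PP_def)
  fix x assume "x \<in> PP {0}"
  then obtain b where b: "herm 0 b" "x = E 0 b 1" by (elim PP_E) auto
  have "b + b ^ q = 0" using b by (simp add: herm_def)
  moreover have "- b + (- b) ^ q = - (b + b ^ q)" by (simp add: frob_minus)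
  ultimately have "- b + (- b) ^ q = 0" by simp
  hence b': "herm 0 (- b)" by (simp add: herm_def)
  have "E 0 (- b) 1 \<otimes> x = \<one>" using b b' by (simp add: E_mult E_one[symmetric])
  hence "inv x = E 0 (- b) 1" using b b' E_closed by (intro inv_equality) auto
  thus "inv x \<in> PP {0}" using b' by (auto simp: PP_def)
  fix y assume "y \<in> PP {0}"
  then obtain c where c: "herm 0 c" "y = E 0 c 1" by (elim PP_E) auto
  thus "x \<otimes> y \<in> PP {0}" using b herm_mult[of 0 b 0 c 1] by (auto simp: PP_def E_mult)
qed (use PP_closed in auto)

lemma card_PP_zero: "card (PP {0}) = q"
proof -
  have "PP {0} = (\<lambda>b. E 0 b 1) ` {b. b ^ q + 1 * b = 0}"
    by (auto simp: PP_def herm_def add.commute)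
  moreover have "inj_on (\<lambda>b. E 0 b 1) {b. b ^ q + 1 * b = 0}"
    by (rule inj_onI) (auto simp: E_eq_iff herm_def add.commute)
  ultimately show ?thesis using card_additive_fibre[of 1 0] by (simp add: card_image)
qed

lemma PP_PP_zero: "x \<in> PP B \<Longrightarrow> h \<in> PP {0} \<Longrightarrow> x \<otimes> h \<in> PP B" "x \<in> PP B \<Longrightarrow> h \<in> PP {0} \<Longrightarrow> h \<otimes> x \<in> PP B"
proof -
  assume "x \<in> PP B" "h \<in> PP {0}"
  then obtain a b c where *: "herm a b" "x = E a b 1" "a \<in> B" "herm 0 c" "h = E 0 c 1"
    by (auto simp: PP_def)
  show "x \<otimes> h \<in> PP B" "h \<otimes> x \<in> PP B"
    using * herm_mult[of a b 0 c 1] herm_mult[of 0 c a b 1] by (auto simp: PP_def E_mult)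
qed

lemma SS_PP_zero:
  assumes "x \<in> SS m" "h \<in> PP {0}" "m \<in> UU"
  shows "x \<otimes> h \<in> SS m" "h \<otimes> x \<in> SS m"
proof -
  obtain a b t where x: "t \<in> m" "herm a b" "x = E a b t" using assms by (auto simp: SS_def)
  obtain c where c: "herm 0 c" "h = E 0 c 1" using assms by (auto simp: PP_def)
  have t: "t \<noteq> 0" using assms x cl_cong_Gam by (auto simp: UU_def carrier_Ugrp)
  show "x \<otimes> h \<in> SS m" "h \<otimes> x \<in> SS m"
    using x c t herm_mult[of a b 0 c t] herm_mult[of 0 c a b 1] by (auto simp: SS_def E_mult)
qed

text \<open>For given \<open>z\<close> in the coset, choosing \<open>a\<close> in \<open>B\<close>
  determines everything: the second factor has first coordinate \<open>X - a\<close> and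
  \<open>KK\<close> has one member for each first coordinate.\<close>

lemma card_products_PP_KK:
  assumes s: "s \<in> Psi q" "s \<notin> Gam q" and z: "z \<in> carrier G"
  shows "card {(x, y). x \<in> PP B \<and> y \<in> KK (cl s) \<and> x \<otimes> y = z} = (if z \<in> SS (cl s) then card B else 0)"
proof -
  have s0: "s \<noteq> 0" using Psi_nonzero s by blast
  note hk = herm_kap[OF s]
  show ?thesis
  proof (cases "z \<in> SS (cl s)")
    case False
    have "x \<otimes> y \<in> SS (cl s)" if xy: "x \<in> PP B" "y \<in> KK (cl s)" for x y
    proof -
      obtain a b where x: "a \<in> B" "herm a b" "x = E a b 1" using xy(1) by (rule PP_E)
      obtain c where y: "y = E c (kap s * (c * c ^ q)) s" by (rule KK_E[OF xy(2) s])
      show ?thesis using x y hk[of c] s0 herm_mult[OF x(2) hk[of c], of 1]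
        by (simp add: E_mult mem_SS_iff Gam_one)
    qed
    hence "{(x, y). x \<in> PP B \<and> y \<in> KK (cl s) \<and> x \<otimes> y = z} = {}" using False by auto
    hence "card {(x, y). x \<in> PP B \<and> y \<in> KK (cl s) \<and> x \<otimes> y = z} = 0" by (metis card.empty)
    thus ?thesis using False by simp
  next
    case True
    then obtain X Y where XY: "herm X Y" "z = E X Y s" using SS_E s0 by blast
    \<comment> \<open>Obtained by solving the second coordinate of the product for \<open>b\<close>;
      \<open>herm a (f a)\<close> is then automatic.\<close>
    define f where "f a = Y - kap s * ((X - a) * (X - a) ^ q) + a * (X - a) ^ q" for a
    define g where "g a = (E a (f a) 1, E (X - a) (kap s * ((X - a) * (X - a) ^ q)) s)" for a
    have hf: "herm a (f a)" for a
    proof -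
      have kq: "kap s ^ q = - (1 + kap s)"
        using norm_one_facts(2)[OF chi_Psi(1,2)[OF s]] by (simp only: kap_def)
      show ?thesis by (simp add: herm_def f_def frob_simps kq herm_conj[OF XY(1)] algebra_simps)
    qed
    have "{(x, y). x \<in> PP B \<and> y \<in> KK (cl s) \<and> x \<otimes> y = z} = g ` B"
    proof safe
      fix x y assume "x \<in> PP B" "y \<in> KK (cl s)" and eq: "z = x \<otimes> y"
      obtain a b where x: "a \<in> B" "herm a b" "x = E a b 1" using \<open>x \<in> PP B\<close> by (rule PP_E)
      obtain c where y: "y = E c (kap s * (c * c ^ q)) s" by (rule KK_E[OF \<open>y \<in> KK (cl s)\<close> s])
      have "E X Y s = E (a + c) (b + kap s * (c * c ^ q) - a * c ^ q) s"
        using eq XY x y hk[of c] s0 by (simp add: E_mult)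
      hence "X = a + c" "Y = b + kap s * (c * c ^ q) - a * c ^ q"
        using XY(1) s0 herm_mult[OF x(2) hk[of c], of 1] by (simp_all add: E_eq_iff)
      hence "c = X - a" "b = f a" by (simp_all add: f_def)
      thus "(x, y) \<in> g ` B" using x y by (auto simp: g_def)
    next
      fix x y a assume a: "a \<in> B" "(x, y) = g a"
      show "x \<in> PP B" using a hf by (auto simp: g_def PP_def)
      show "y \<in> KK (cl s)" using a hk s s0 by (auto simp: g_def mem_KK_iff Gam_one)
      show "x \<otimes> y = z" using a hf[of a] hk[of "X - a"] s0 XY by (simp add: g_def E_mult f_def)
    qed
    moreover have "inj_on g B"
      by (rule inj_onI) (auto simp: g_def E_eq_iff hf)
    ultimately show ?thesis using True by (simp add: card_image)
  qed
qed

text \<open>A factorisation is determined by the first coordinate \<open>b\<close> of its second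
  factor, and the admissible \<open>b\<close> form the set \<open>S\<close> counted in
  \<open>card_kap_fibre\<close>.\<close>

lemma card_products_KK_KK:
  assumes t: "t \<in> Psi q" "t \<notin> Gam q" and s: "s \<in> Psi q" "s \<notin> Gam q" and z: "z \<in> carrier G"
  defines "n \<equiv> card {(x, y). x \<in> KK (cl t) \<and> y \<in> KK (cl s) \<and> x \<otimes> y = z}"
  shows "if t * s \<in> Gam q then q dvd n else if z \<in> SS (cl (t * s)) then n = 1 \<or> n = q + 1 else n = 0"
proof -
  have t0: "t \<noteq> 0" and s0: "s \<noteq> 0" using Psi_nonzero s t by blast+
  note hs = herm_kap[OF s] and ht = herm_kap[OF t] and ct = chi_Psi[OF t]  and cs = chi_Psi[OF s]
  have prod: "E a (kap t * (a * a ^ q)) t \<otimes> E b (kap s * (b * b ^ q)) s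
    = E (a + chi q t * b) (kap t * (a * a ^ q) + kap s * (b * b ^ q) - a * (chi q t * b) ^ q) (t * s)"
    and herm: "herm (a + chi q t * b) (kap t * (a * a ^ q) + kap s * (b * b ^ q) - a * (chi q t * b) ^ q)" for a b
    using E_mult[OF ht t0 hs s0, of a b] herm_mult[OF ht hs t0, of a b] ct by simp_all
  show ?thesis
  proof (cases "z \<in> SS (cl (t * s))")
    case False
    have "x \<otimes> y \<in> SS (cl (t * s))" if xy: "x \<in> KK (cl t)" "y \<in> KK (cl s)" for x y
    proof -
      obtain a where x: "x = E a (kap t * (a * a ^ q)) t" by (rule KK_E[OF xy(1) t])
      obtain b where y: "y = E b (kap s * (b * b ^ q)) s" by (rule KK_E[OF xy(2) s])
      show ?thesis using x y prod herm s0 t0 by (simp add: mem_SS_iff Gam_one)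
    qed
    hence "{(x, y). x \<in> KK (cl t) \<and> y \<in> KK (cl s) \<and> x \<otimes> y = z} = {}" using False by auto
    hence "n = 0" unfolding n_def by (metis card.empty)
    thus ?thesis using False by simp
  next
    case True
    then obtain X Y where XY: "herm X Y" "z = E X Y (t * s)"
      by (rule SS_E) (use s0 t0 in auto)
    let ?w = "chi q t"
    define S where "S = {b. kap t * ((X - ?w * b) * (X - ?w * b) ^ q) + kap s * (b * b ^ q) - (X - ?w * b) * (?w * b) ^ q = Y}"
    define g where "g b = (E (X - ?w * b) (kap t * ((X - ?w * b) * (X - ?w * b) ^ q)) t, E b (kap s * (b * b ^ q)) s)" for b
    have "{(x, y). x \<in> KK (cl t) \<and> y \<in> KK (cl s) \<and> x \<otimes> y = z} = g ` S"
    proof safe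
      fix x y assume "x \<in> KK (cl t)" "y \<in> KK (cl s)" and eq: "z = x \<otimes> y"
      obtain a where x: "x = E a (kap t * (a * a ^ q)) t" by (rule KK_E[OF \<open>x \<in> KK (cl t)\<close> t])
      obtain b where y: "y = E b (kap s * (b * b ^ q)) s" by (rule KK_E[OF \<open>y \<in> KK (cl s)\<close> s])
      have "X = a + ?w * b" "Y = kap t * (a * a ^ q) + kap s * (b * b ^ q) - a * (?w * b) ^ q"
        using eq XY x y prod[of a b] herm[of a b] s0 t0 by (simp_all add: E_eq_iff)
      hence "a = X - ?w * b" "b \<in> S" by (simp_all add: S_def)
      thus "(x, y) \<in> g ` S" using x y by (auto simp: g_def)
    next
      fix x y b assume b: "b \<in> S" "(x, y) = g b"
      show "x \<in> KK (cl t)" using b ht t0 t by (auto simp: g_def mem_KK_iff Gam_one)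
      show "y \<in> KK (cl s)" using b hs s s0 by (auto simp: g_def mem_KK_iff Gam_one)
      show "x \<otimes> y = z" using b prod[of "X - ?w * b" b] XY by (simp add: g_def S_def)
    qed
    moreover have "inj_on g S"
      by (rule inj_onI) (use s0 hs in \<open>auto simp: g_def E_eq_iff\<close>)
    ultimately have n: "n = card S" unfolding n_def by (simp add: card_image)
    have "?w * chi q s = 1 \<longleftrightarrow> t * s \<in> Gam q"
      using chi_eq_1_iff[of "t * s"] s0 t0 by (simp add: chi_mult)
    moreover have "if ?w * chi q s = 1 then q dvd card S else card S = 1 \<or> card S = q + 1"
      using card_kap_fibre[OF ct(1,2) cs(1,2) XY(1)] unfolding S_def kap_def .
    ultimately show ?thesis using True n by (auto split: if_splits)
  qed
qed

lemma card_KK: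
  assumes s: "s \<in> Psi q" "s \<notin> Gam q"
  shows "card (KK (cl s)) = q ^ 2"
proof -
  have s0: "s \<noteq> 0" using Psi_nonzero s by blast
  note hk = herm_kap[OF s]
  have "KK (cl s) = (\<lambda>a. E a (kap s * (a * a ^ q)) s) ` UNIV"
  proof
    show "KK (cl s) \<subseteq> (\<lambda>a. E a (kap s * (a * a ^ q)) s) ` UNIV"
    proof
      fix x assume "x \<in> KK (cl s)"
      then obtain a where "x = E a (kap s * (a * a ^ q)) s" by (rule KK_E[OF _ s])
      thus "x \<in> (\<lambda>a. E a (kap s * (a * a ^ q)) s) ` UNIV" by blast
    qed
    show "(\<lambda>a. E a (kap s * (a * a ^ q)) s) ` UNIV \<subseteq> KK (cl s)"
      using mem_KK_iff[OF hk s0 s] s0 Gam_one by auto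
  qed
  moreover have "inj (\<lambda>a. E a (kap s * (a * a ^ q)) s)"
    by (rule injI) (use s0 hk in \<open>auto simp: E_eq_iff\<close>)
  ultimately show ?thesis using card_F by (simp add: card_image)
qed

text \<open>The class \<open>KK (cl s)\<close> is not invariant under the centre of the unipotent
  group, so a different count is needed: since \<open>SS (cl t)\<close> is a full coset, either no
  \<open>y\<close> works or every one of the \<open>q ^ 2\<close> members of the class does, with
  \<open>x = z y\<inverse>\<close>.\<close>

lemma dvd_card_products_SS_KK:
  assumes t: "t \<noteq> 0" and s: "s \<in> Psi q" "s \<notin> Gam q" and z: "z \<in> carrier G"
  shows "q dvd card {(x, y). x \<in> SS (cl t) \<and> y \<in> KK (cl s) \<and> x \<otimes> y = z}"
proof -
  let ?Sol = "{(x, y). x \<in> SS (cl t) \<and> y \<in> KK (cl s) \<and> x \<otimes> y = z}"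
  have s0: "s \<noteq> 0" using Psi_nonzero s by blast
  note hk = herm_kap[OF s]
  have clo: "KK (cl s) \<subseteq> carrier G"
    using KK_subset_SS SS_closed UU_cases cl_in_index(2)[OF s0] s by (metis UnI2 order.trans)
  have "SS (cl t) \<subseteq> carrier G"
  proof
    fix x assume "x \<in> SS (cl t)"
    then obtain a b where "herm a b" "x = E a b t" using t by (rule SS_E)
    thus "x \<in> carrier G" using t E_closed by simp
  qed
  hence eqz: "x = z \<otimes> inv y" if "(x, y) \<in> ?Sol" for x y
    using that clo z by (auto simp: m_assoc subset_iff)
  show ?thesis
  proof (cases "?Sol = {}")
    case False
    then obtain x0 y0 where *: "x0 \<in> SS (cl t)" "y0 \<in> KK (cl s)" "x0 \<otimes> y0 = z" by auto
    obtain a0 b0 where x0: "herm a0 b0" "x0 = E a0 b0 t" using *(1) t by (rule SS_E)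
    obtain c0 where y0: "y0 = E c0 (kap s * (c0 * c0 ^ q)) s" by (rule KK_E[OF *(2) s])
    obtain X Y where XY: "herm X Y" "z = E X Y (t * s)"
      using E_mult[OF x0(1) t hk s0] herm_mult[OF x0(1) hk t] x0 y0 * by metis
    have "?Sol = (\<lambda>y. (z \<otimes> inv y, y)) ` KK (cl s)"
    proof
      show "?Sol \<subseteq> (\<lambda>y. (z \<otimes> inv y, y)) ` KK (cl s)" using eqz by auto
      show "(\<lambda>y. (z \<otimes> inv y, y)) ` KK (cl s) \<subseteq> ?Sol"
      proof safe
        fix y assume y: "y \<in> KK (cl s)"
        hence yG: "y \<in> carrier G" using clo by blast
        thus eq: "z \<otimes> inv y \<otimes> y = z" using z by (simp add: m_assoc)
        obtain a b u where x: "herm a b" "u \<noteq> 0" "z \<otimes> inv y = E a b u"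
          using E_surj z yG by (metis inv_closed m_closed)
        obtain c where c: "y = E c (kap s * (c * c ^ q)) s" by (rule KK_E[OF y s])
        have "E X Y (t * s) = E (a + chi q u * c) (b + u * u ^ q * (kap s * (c * c ^ q)) - a * (chi q u * c) ^ q) (u * s)"
          using eq x c XY E_mult[OF x(1,2) hk s0, of c] by simp
        hence "t * s / (u * s) \<in> Gam q"
          using E_eq_iff[OF XY(1) _ herm_mult[OF x(1) hk x(2)], of "t * s" "u * s"] t s0 x(2) by simp
        hence "t / u \<in> Gam q" using s0 by simp
        hence "u / t \<in> Gam q" using Gam_divide[OF Gam_one, of "t / u"] by simp
        thus "z \<otimes> inv y \<in> SS (cl t)" using x t by (simp add: mem_SS_iff)
      qed
    qed
    hence "card ?Sol = q ^ 2"
      using card_KK[OF s] by (simp add: card_image inj_on_def)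
    thus ?thesis by simp
  qed (metis card.empty dvd_0_right)
qed

lemma VV_UU: "m \<in> VV \<Longrightarrow> m \<in> UU" and DD_UU: "m \<in> DD \<Longrightarrow> m \<in> UU"
  using UU_cases by blast+

lemma KK_closed: "m \<in> VV \<Longrightarrow> KK m \<subseteq> carrier G"
  using KK_subset_SS SS_closed VV_UU by blast

lemma finite_sets: "finite (PP B)" "m \<in> UU \<Longrightarrow> finite (SS m)" "m \<in> VV \<Longrightarrow> finite (KK m)"
  using PP_closed SS_closed KK_closed finite_G finite_subset by metis+

end

section \<open>Products of class sums in characteristic \<open>p\<close>\<close>

locale borel_algebra = borel p r q F G E
  for p r q and F :: "'f::{field,finite} itself" and G :: "('g, 'c) monoid_scheme" (structure)
    and E :: "'f \<Rightarrow> 'f \<Rightarrow> 'f \<Rightarrow> 'g" +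
  fixes K :: "'k::field itself"
  assumes char_k: "CHAR('k) = p"
begin

lemma of_nat_dvd: "q dvd n \<Longrightarrow> of_nat n = (0 :: 'k)"
  using p_dvd_q char_k of_nat_eq_0_iff_char_dvd[where 'a = 'k] dvd_trans by metis

lemma formal_sum_product_eqI:
  fixes f :: "'g \<Rightarrow>\<^sub>0 'k"
  assumes "C \<subseteq> carrier G" "D \<subseteq> carrier G" "f \<in> carrier (group_algebra G)"
    and "\<And>z. z \<in> carrier G \<Longrightarrow> of_nat (card {(x, y). x \<in> C \<and> y \<in> D \<and> x \<otimes> y = z}) = lookup f z"
  shows "formal_sum C \<star> formal_sum D = f"
proof (rule group_algebra_eqI)
  show "formal_sum C \<star> formal_sum D \<in> carrier (group_algebra G :: ('k, _) module)"
    using assms by (intro group_algebra_mult_closed formal_sum_closed finite_G)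
qed (use assms in \<open>simp_all add: lookup_formal_sum_mult finite_G\<close>)

lemma product_zero:
  assumes C: "C \<subseteq> carrier G" and D: "D \<subseteq> carrier G"
    and "\<And>x h. x \<in> C \<Longrightarrow> h \<in> PP {0} \<Longrightarrow> x \<otimes> h \<in> C"
    and "\<And>x h. x \<in> D \<Longrightarrow> h \<in> PP {0} \<Longrightarrow> h \<otimes> x \<in> D"
  shows "formal_sum C \<star> formal_sum D = (0 :: 'g \<Rightarrow>\<^sub>0 'k)"
proof (rule formal_sum_product_eqI[OF C D])
  fix z assume z: "z \<in> carrier G"
  have "q dvd card {(x, y). x \<in> C \<and> y \<in> D \<and> x \<otimes> y = z}"
    using dvd_card_products[OF PP_zero_subgroup finite_G C D z] assms card_PP_zero by simp
  thus "of_nat (card {(x, y). x \<in> C \<and> y \<in> D \<and> x \<otimes> y = z}) = lookup (0 :: 'g \<Rightarrow>\<^sub>0 'k) z"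
    by (simp add: of_nat_dvd)
qed simp

lemma product_PP_PP: "formal_sum (PP B) \<star> formal_sum (PP C) = (0 :: 'g \<Rightarrow>\<^sub>0 'k)"
  by (intro product_zero PP_closed PP_PP_zero)

lemma product_PP_SS: "m \<in> UU \<Longrightarrow> formal_sum (PP B) \<star> formal_sum (SS m) = (0 :: 'g \<Rightarrow>\<^sub>0 'k)"
  by (intro product_zero PP_closed SS_closed PP_PP_zero SS_PP_zero)

lemma product_SS_SS:
  "m \<in> UU \<Longrightarrow> m' \<in> UU \<Longrightarrow> formal_sum (SS m) \<star> formal_sum (SS m') = (0 :: 'g \<Rightarrow>\<^sub>0 'k)"
  by (intro product_zero SS_closed SS_PP_zero)

lemma product_SS_KK:
  assumes "m \<in> UU" "m' \<in> VV"
  shows "formal_sum (SS m) \<star> formal_sum (KK m') = (0 :: 'g \<Rightarrow>\<^sub>0 'k)"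
proof (rule formal_sum_product_eqI)
  fix z assume z: "z \<in> carrier G"
  obtain t where t: "t \<noteq> 0" "m = cl t" using assms(1) by (rule UU_E)
  obtain s where s: "s \<in> Psi q" "s \<notin> Gam q" "m' = cl s" using assms(2) by (rule VV_E)
  show "of_nat (card {(x, y). x \<in> SS m \<and> y \<in> KK m' \<and> x \<otimes> y = z}) = lookup (0 :: 'g \<Rightarrow>\<^sub>0 'k) z"
    using dvd_card_products_SS_KK[OF t(1) s(1,2) z] by (simp add: of_nat_dvd t s)
qed (use assms SS_closed KK_closed in auto)

lemma product_PP_KK:
  assumes "m \<in> VV"
  shows "formal_sum (PP B) \<star> formal_sum (KK m)
    = of_nat (card B) \<cdot> (formal_sum (SS m) :: 'g \<Rightarrow>\<^sub>0 'k)"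
proof (rule formal_sum_product_eqI)
  fix z assume z: "z \<in> carrier G"
  obtain s where s: "s \<in> Psi q" "s \<notin> Gam q" "m = cl s" using assms by (rule VV_E)
  show "of_nat (card {(x, y). x \<in> PP B \<and> y \<in> KK m \<and> x \<otimes> y = z})
    = lookup (of_nat (card B) \<cdot> (formal_sum (SS m) :: 'g \<Rightarrow>\<^sub>0 'k)) z"
    using card_products_PP_KK[OF s(1,2) z] finite_sets(2)[OF VV_UU[OF assms]]
    by (simp add: s(3) lookup_formal_sum)
next
  show "of_nat (card B) \<cdot> (formal_sum (SS m) :: 'g \<Rightarrow>\<^sub>0 'k) \<in> carrier (group_algebra G)"
    by (intro group_algebra_closed_simps formal_sum_closed finite_G SS_closed VV_UU assms)
qed (use assms PP_closed KK_closed in auto)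

text \<open>The solution numbers \<open>1\<close> and \<open>q + 1\<close> both become
  \<open>1\<close> in \<open>'k\<close>, so the product is constant on the coset over
  \<open>m m'\<close>; for \<open>m m' = 1\<close> every number of solutions is divisible by
  \<open>q\<close>.\<close>

lemma product_KK_KK:
  assumes "m \<in> VV" "m' \<in> VV"
  shows "formal_sum (KK m) \<star> formal_sum (KK m')
    = (if m = inv\<^bsub>Ugrp q\<^esub> m' then 0 else (formal_sum (SS (m \<otimes>\<^bsub>Ugrp q\<^esub> m')) :: 'g \<Rightarrow>\<^sub>0 'k))"
proof -
  obtain t where t: "t \<in> Psi q" "t \<notin> Gam q" "t \<noteq> 0" "m = cl t" using assms(1) by (rule VV_E)
  obtain s where s: "s \<in> Psi q" "s \<notin> Gam q" "s \<noteq> 0" "m' = cl s" using assms(2) by (rule VV_E)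
  have mm: "m \<otimes>\<^bsub>Ugrp q\<^esub> m' = cl (t * s)" using t s by (simp add: Ugrp_mult)
  have inv: "m = inv\<^bsub>Ugrp q\<^esub> m' \<longleftrightarrow> t * s \<in> Gam q"
    using t s by (simp add: Ugrp_inv cl_eq_iff divide_inverse)
  have SS: "SS (cl (t * s)) \<subseteq> carrier G" if "t * s \<notin> Gam q"
    using that t s by (intro SS_closed) (simp add: cl_in_index)
  show ?thesis
  proof (rule formal_sum_product_eqI)
    fix z assume z: "z \<in> carrier G"
    show "of_nat (card {(x, y). x \<in> KK m \<and> y \<in> KK m' \<and> x \<otimes> y = z}) = lookup
      (if m = inv\<^bsub>Ugrp q\<^esub> m' then 0 else (formal_sum (SS (m \<otimes>\<^bsub>Ugrp q\<^esub> m')) :: 'g \<Rightarrow>\<^sub>0 'k)) z"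
      using card_products_KK_KK[OF t(1,2) s(1,2) z] of_nat_dvd[of q] finite_subset[OF SS finite_G]
      unfolding inv mm unfolding t(4) s(4)
      by (auto simp: of_nat_dvd lookup_formal_sum split: if_splits)
  next
    show "(if m = inv\<^bsub>Ugrp q\<^esub> m' then 0 else (formal_sum (SS (m \<otimes>\<^bsub>Ugrp q\<^esub> m')) :: 'g \<Rightarrow>\<^sub>0 'k)) \<in> carrier (group_algebra G)"
      unfolding inv mm using SS by (auto intro: formal_sum_closed finite_G)
  qed (use assms KK_closed in auto)
qed

fun generator :: "'f set variable \<Rightarrow> 'g \<Rightarrow>\<^sub>0 'k" where
  "generator VarT = formal_sum (PP {0})"
| "generator (VarX n) = formal_sum (PP n)"
| "generator (VarY m) = formal_sum (YS m)"

lemma generator_closed: "v \<in> variables q \<Longrightarrow> generator v \<in> carrier A"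
proof (cases v)
  case VarT
  thus ?thesis using central_PP[of "{0}"] by simp
next
  case (VarX n)
  assume "v \<in> variables q"
  then obtain s where s: "s \<noteq> 0" "n = wl s" using VarX by (auto simp: variables_eq WW_def carrier_Wgrp)
  have "a * c \<in> n" if "a \<in> n" "c \<in> Lset q" for a c
    using that s Lset_divide[of "a / s" "1 / c"] Lset_divide[OF Lset_one that(2)] by (simp add: mem_mcoset_iff)
  thus ?thesis unfolding VarX generator.simps by (rule central_PP)
next
  case (VarY m)
  assume "v \<in> variables q"
  thus ?thesis using VarY central_SS central_KK by (auto simp: variables_eq YS_def)
qed

end

section \<open>The centre of the group algebra\<close>

lemma (in comm_algebra) kernel_ideal:
  assumes a: "\<And>v. v \<in> S \<Longrightarrow> a v \<in> carrier A"
  shows "ideal {f \<in> carrier (polynomial_algebra S). poly_eval a f = \<zero>} (polynomial_algebra S)"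
proof -
  interpret R: cring "polynomial_algebra S :: ('k, _) module" by (rule polynomial_algebra_cring)
  interpret ring_hom_ring "polynomial_algebra S" A "poly_eval a"
    by (rule ring_hom_ringI2[OF R.ring_axioms ring_axioms poly_eval_ring_hom[OF a]])
  show ?thesis using kernel_is_ideal unfolding a_kernel_def' .
qed

section \<open>Central elements are constant on the classes\<close>

context borel
begin

lemma central_conj:
  assumes z: "z \<in> carrier (A :: ('k::field, _) module)"
    and x: "x \<in> carrier G" and y: "y \<in> carrier G" and y': "y' \<in> carrier G" and eq: "x \<otimes> y = y' \<otimes> x"
  shows "lookup z y = lookup z y'"
proof -
  have c: "lookup z (u \<otimes> v) = lookup z (v \<otimes> u)"
    if "u \<in> carrier G" "v \<in> carrier G" for u v
    using group_algebra_central_iff[OF finite_G] z that unfolding centre_iff by blast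
  have "y' = x \<otimes> (y \<otimes> inv x)" using x y y' eq by (metis inv_solve_right m_assoc m_closed inv_closed)
  moreover have "y = (y \<otimes> inv x) \<otimes> x" using x y by (simp add: m_assoc)
  ultimately show ?thesis using c[of x "y \<otimes> inv x"] x y by simp
qed

context
  fixes z :: "'g \<Rightarrow>\<^sub>0 'k::field"
  assumes z: "z \<in> carrier A"
begin

lemma central_E:
  assumes "herm c d" "s \<noteq> 0" "herm a b" "herm a' b'" "t \<noteq> 0" "t' \<noteq> 0"
    and "E c d s \<otimes> E a b t = E a' b' t' \<otimes> E c d s"
  shows "lookup z (E a b t) = lookup z (E a' b' t')"
  using assms by (intro central_conj[OF z, of "E c d s"] E_closed)

lemma central_torus:
  assumes "herm a b" "t \<noteq> 0" "s \<noteq> 0"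
  shows "lookup z (E a b t) = lookup z (E (chi q s * a) (s * s ^ q * b) t)"
proof (rule central_E[of 0 0 s])
  show *: "herm (chi q s * a) (s * s ^ q * b)" using herm_mult[of 0 0 a b s] assms by simp
  show "E 0 0 s \<otimes> E a b t = E (chi q s * a) (s * s ^ q * b) t \<otimes> E 0 0 s"
    using assms * by (simp add: E_mult mult.commute)
qed (use assms in auto)

text \<open>Both entries are skew under the Frobenius map, so their quotient is fixed by it and
  hence is a norm; conjugation by a torus element of that norm carries one to the other.\<close>

lemma central_scale_zero:
  assumes "herm 0 b" "herm 0 b'" "b \<noteq> 0" "b' \<noteq> 0" "t \<noteq> 0"
  shows "lookup z (E 0 b t) = lookup z (E 0 b' t)"
proof -
  have "b ^ q = - b" "b' ^ q = - b'"
    using assms by (simp_all add: herm_def eq_neg_iff_add_eq_0 add.commute)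
  hence "(b' / b) ^ q = b' / b" by (simp add: power_divide)
  from norm_surj[OF this] obtain s where s: "s * s ^ q = b' / b" by auto
  hence "s \<noteq> 0" using assms by auto
  from central_torus[OF assms(1,5) this] show ?thesis using s assms by simp
qed

text \<open>A torus element first adjusts the first coordinate within its coset of
  \<open>Lset q\<close>; a unipotent element then adjusts the second coordinate by an arbitrary skew
  amount.\<close>

lemma central_PP_const:
  assumes "herm a b" "herm a' b'" "a \<noteq> 0" "a' / a \<in> Lset q"
  shows "lookup z (E a b 1) = lookup z (E a' b' 1)"
proof -
  obtain s where s: "s \<noteq> 0" "a' / a = chi q s" using assms by (auto simp: Lset_eq_chi)
  hence a': "a' = chi q s * a" "a' \<noteq> 0" using assms by (auto simp: field_simps)
  define c where "c = s * s ^ q * b"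
  have c: "herm a' c" using herm_mult[of 0 0 a b s] assms s a' by (simp add: c_def)
  define d where "d = b' - c"
  have d: "d ^ q = - d" by (simp add: d_def frob_diff herm_conj[OF c] herm_conj[OF assms(2)])
  obtain th :: 'f where th: "th + th ^ q = 1" using trace_surj[of 1] by auto
  \<comment> \<open>Conjugation by \<open>E e f 1\<close> shifts the second coordinate by
    \<open>a' * e ^ q - e * a' ^ q\<close>. Splitting \<open>d\<close> with an element
    \<open>th\<close> of trace one solves for this shift to be \<open>d\<close>.\<close>
  define e where "e = - (d * th) / a' ^ q"
  have e: "a' * e ^ q - e * a' ^ q = d"
  proof -
    have "e ^ q = d * th ^ q / a'" using a' by (simp add: e_def frob_simps d)
    hence "a' * e ^ q - e * a' ^ q = d * (th + th ^ q)" using a' by (simp add: e_def algebra_simps)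
    thus ?thesis using th by simp
  qed
  obtain f where f: "herm e f" using exists_herm by blast
  have "lookup z (E a b 1) = lookup z (E a' c 1)"
    using central_torus[OF assms(1) _ s(1), of 1] by (simp add: a' c_def)
  also have "\<dots> = lookup z (E a' b' 1)"
  proof (rule central_E[OF f _ c assms(2)])
    have eq: "f + c - e * a' ^ q = b' + f - a' * e ^ q" using e by (simp add: d_def algebra_simps)
    have l: "E e f 1 \<otimes> E a' c 1 = E (a' + e) (f + c - e * a' ^ q) 1"
      using E_mult[OF f _ c, of 1 1] by (simp add: add.commute[of e])
    have r: "E a' b' 1 \<otimes> E e f 1 = E (a' + e) (b' + f - a' * e ^ q) 1"
      using E_mult[OF assms(2) _ f, of 1 1] by simp
    show "E e f 1 \<otimes> E a' c 1 = E a' b' 1 \<otimes> E e f 1" unfolding l r eq ..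
  qed auto
  finally show ?thesis .
qed

text \<open>Solves for a unipotent \<open>E c d 1\<close> conjugating \<open>E 0 0 t\<close> into
  \<open>E a b t\<close>. The two coordinates can be divided by \<open>1 - w\<close> and by
  \<open>1 - w * w ^ q\<close>, the latter because \<open>t\<close> does not have norm one.\<close>

lemma central_DD:
  assumes ab: "herm a b" and t: "t \<noteq> 0" "t \<notin> Psi q"
  shows "lookup z (E a b t) = lookup z (E 0 0 t)"
proof -
  define w where "w = chi q t"
  have w: "w * w ^ q = t * t ^ q" using chi_norm t by (simp add: w_def)
  have w1: "w \<noteq> 1" using chi_eq_1_iff t Gam_subset_Psi by (auto simp: w_def)
  have n1: "w * w ^ q \<noteq> 1" using t w by (simp add: mem_Psi_iff)
  define c where "c = a / (1 - w)"
  have a: "a = (1 - w) * c" using w1 by (simp add: c_def)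
  define d where "d = (b - a * (w * c) ^ q) / (1 - w * w ^ q)"
  have b: "b = (1 - w * w ^ q) * d + a * (w * c) ^ q" using n1 by (simp add: d_def)
  have "(1 - w * w ^ q) * (d + d ^ q + c * c ^ q) = b + b ^ q + a * a ^ q"
    unfolding b unfolding a by (simp add: frob_simps algebra_simps)
  hence cd: "herm c d" using ab n1 by (simp add: herm_def)
  have "lookup z (E 0 0 t) = lookup z (E a b t)"
  proof (rule central_E[OF cd])
    have "a + w * c = c" by (simp add: a algebra_simps)
    moreover have "b + w * w ^ q * d - a * (w * c) ^ q = d" by (simp add: b algebra_simps)
    ultimately show "E c d 1 \<otimes> E 0 0 t = E a b t \<otimes> E c d 1"
      using cd ab t by (simp add: E_mult flip: w w_def)
  qed (use ab t in auto)
  thus ?thesis by simp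
qed

text \<open>For norm one the second of these divisions breaks down: unipotent conjugation still
  removes the first coordinate, but leaves the defect \<open>b - kap t * (a * a ^ q)\<close> behind.
  Whether it is zero separates the class \<open>KK\<close> from the rest of the coset.\<close>

lemma central_VV:
  assumes ab: "herm a b" and t: "t \<in> Psi q" "t \<notin> Gam q"
  shows "lookup z (E a b t) = lookup z (E 0 (b - kap t * (a * a ^ q)) t)"
    and "herm 0 (b - kap t * (a * a ^ q))"
proof -
  have t0: "t \<noteq> 0" using Psi_nonzero t by blast
  define w where "w = chi q t"
  note w = chi_Psi[OF t, folded w_def]
  have w0: "w \<noteq> 0" using w by auto
  define c where "c = a / (1 - w)"
  obtain d where cd: "herm c d" using exists_herm by blast
  define e where "e = b - kap t * (a * a ^ q)"
  have "a * (w * c) ^ q = kap t * (a * a ^ q)"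
  proof -
    have wq: "w ^ q = 1 / w" using w w0 by (simp add: field_simps)
    have "(w * c) ^ q = a ^ q * (1 / w / (1 - 1 / w))" by (simp add: c_def frob_simps wq)
    also have "1 / w / (1 - 1 / w) = kap t" using w w0 by (simp add: kap_def field_simps flip: w_def)
    finally have "(w * c) ^ q = kap t * a ^ q" by (simp add: mult.commute)
    thus ?thesis by (simp add: mult_ac)
  qed
  hence e: "e = b - a * (w * c) ^ q" by (simp only: e_def)
  show he: "herm 0 (b - kap t * (a * a ^ q))"
    by (simp add: herm_def frob_diff herm_conj[OF ab] herm_conj[OF herm_kap[OF t, of a]])
  have "lookup z (E 0 e t) = lookup z (E a b t)"
  proof (rule central_E[OF cd])
    show he': "herm 0 e" using he by (simp add: e_def)
    have 1: "a + w * c = c" using w by (simp add: c_def field_simps)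
    have 2: "d + e = b + d - a * (w * c) ^ q" by (simp add: e)
    have l: "E c d 1 \<otimes> E 0 e t = E c (d + e) t" using cd he' t0 by (simp add: E_mult)
    have r: "E a b t \<otimes> E c d 1 = E (a + w * c) (b + d - a * (w * c) ^ q) t"
      using E_mult[OF ab t0 cd, of 1] by (simp add: w(3) flip: w_def)
    show "E c d 1 \<otimes> E 0 e t = E a b t \<otimes> E c d 1" unfolding l r 1 2 ..
  qed (use ab t0 in auto)
  thus "lookup z (E a b t) = lookup z (E 0 (b - kap t * (a * a ^ q)) t)"
    by (simp add: e_def)
qed

end

end

section \<open>The evaluation homomorphism onto the centre\<close>

context borel_algebra
begin

abbreviation psi :: "(('f set variable \<Rightarrow>\<^sub>0 nat) \<Rightarrow>\<^sub>0 'k) \<Rightarrow> ('g \<Rightarrow>\<^sub>0 'k)" where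
  "psi \<equiv> comm_algebra.poly_eval A generator"

abbreviation RR :: "('k, ('f set variable \<Rightarrow>\<^sub>0 nat) \<Rightarrow>\<^sub>0 'k) module" where
  "RR \<equiv> polynomial_algebra (variables q)"

interpretation A: comm_algebra "A :: ('k, 'g \<Rightarrow>\<^sub>0 'k) module"
  by (rule centre_group_algebra_comm_algebra[OF finite_G])

lemma gen_closed: "v \<in> variables q \<Longrightarrow> generator v \<in> carrier (A :: ('k, 'g \<Rightarrow>\<^sub>0 'k) module)"
  by (rule generator_closed)

lemma psi_hom: "psi \<in> ring_hom RR A"
  by (rule A.poly_eval_ring_hom[OF gen_closed])

lemma psi_simps:
  "f \<in> carrier RR \<Longrightarrow> g \<in> carrier RR \<Longrightarrow> psi (f * g) = psi f \<star> psi g"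
  "f \<in> carrier RR \<Longrightarrow> g \<in> carrier RR \<Longrightarrow> psi (f + g) = psi f + psi g"
  "psi (Const c) = c \<cdot> \<one>\<^bsub>group_algebra G\<^esub>"
  "psi pT = formal_sum (PP {0})"
  "n \<in> WW \<Longrightarrow> psi (pX n) = formal_sum (PP n)"
  "m \<in> UU \<Longrightarrow> psi (pY m) = formal_sum (YS m)"
  using A.poly_eval_mult[where a = generator and S = "variables q", OF gen_closed]
    A.poly_eval_add[where a = generator and S = "variables q", OF gen_closed]
    A.poly_eval_Const[where a = generator and S = "variables q", OF gen_closed]
    A.poly_eval_Var[where a = generator and S = "variables q", OF gen_closed]
  by (simp_all add: variables_eq)

lemma psi_smult: "f \<in> carrier RR \<Longrightarrow> psi (Const c * f) = c \<cdot> psi f"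
  using A.poly_eval_smult[where a = generator and S = "variables q", OF gen_closed, of f c] by simp

lemma psi_minus:
  assumes "f \<in> carrier RR" "g \<in> carrier RR"
  shows "psi (f - g) = psi f - psi g"
  using psi_simps(2)[of "f - g" g] assms by simp

lemma vars_in_RR: "pT \<in> carrier RR" "n \<in> WW \<Longrightarrow> pX n \<in> carrier RR" "m \<in> UU \<Longrightarrow> pY m \<in> carrier RR"
  by (auto simp: variables_eq intro!: polynomial_algebra_closed)

text \<open>The class over \<open>m\<close> meets each coset of the centre of the unipotent group
  once, so multiplying its sum by the sum over that centre fills the whole coset over
  \<open>m\<close>.\<close>

lemma psi_Y_T: "m \<in> VV \<Longrightarrow> psi (pY m * pT) = formal_sum (SS m)"
proof -
  assume m: "m \<in> VV"
  note mU = VV_UU[OF m]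
  have "psi (pT * pY m) = formal_sum (PP {0}) \<star> formal_sum (KK m)"
    using m mU by (simp add: psi_simps vars_in_RR YS_def)
  also have "\<dots> = formal_sum (SS m)"
    unfolding product_PP_KK[OF m] by (rule poly_mapping_eqI) simp
  finally show ?thesis by (simp add: mult.commute)
qed

text \<open>The source of \<open>1 / \<gamma>\<close> in the relations:
  \<open>card n * gam q = q ^ 2 - 1\<close>, which is \<open>- 1\<close> in characteristic
  \<open>p\<close>. The same equation shows that \<open>gam q\<close> is invertible in
  \<open>'k\<close>.\<close>

lemma card_wl: "n \<in> WW \<Longrightarrow> of_nat (card n) = (- (1 / of_nat (gam q)) :: 'k)"
proof -
  assume "n \<in> WW"
  then obtain s where "s \<noteq> 0" "n = wl s" by (auto simp: WW_def carrier_Wgrp)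
  hence "card n * gam q + 1 = q ^ 2"
    using card_Lset card_mcoset[of s "Lset q"] q_ge_2 by (simp add: le_add_diff_inverse2)
  hence "of_nat (card n) * of_nat (gam q) + 1 = (of_nat (q ^ 2) :: 'k)"
    by (metis of_nat_1 of_nat_add of_nat_mult)
  also have "\<dots> = 0" by (rule of_nat_dvd) simp
  finally have *: "of_nat (card n) * of_nat (gam q) = (- 1 :: 'k)" by (simp add: eq_neg_iff_add_eq_0)
  hence "of_nat (gam q) \<noteq> (0 :: 'k)" by auto
  hence "of_nat (card n) = (- 1 :: 'k) / of_nat (gam q)" using * nonzero_eq_divide_eq by blast
  thus ?thesis by simp
qed

lemma psi_relations:
  assumes "f \<in> relations q"
  shows "f \<in> carrier RR \<and> psi f = 0"
proof -
  note vr = vars_in_RR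
  consider "f = pT ^ 2"
    | n where "n \<in> WW" "f = pT * pX n"
    | m where "m \<in> DD" "f = pT * pY m"
    | n n' where "n \<in> WW" "n' \<in> WW" "f = pX n * pX n'"
    | n m where "n \<in> WW" "m \<in> DD" "f = pX n * pY m"
    | m m' where "m \<in> DD" "m' \<in> UU" "f = pY m * pY m'"
    | (XY) n m where "n \<in> WW" "m \<in> VV" "f = pX n * pY m + Const (1 / of_nat (gam q)) * pY m * pT"
    | (YY) m m' where "m \<in> VV" "m' \<in> VV" "f = pY m * pY m'
        - Const (1 - kronecker m (inv\<^bsub>Ugrp q\<^esub> m')) * pY (m \<otimes>\<^bsub>Ugrp q\<^esub> m') * pT"
    using assms unfolding relations_eq by blast
  thus ?thesis
  proof cases
    case XY
    note mU = VV_UU[OF XY(2)]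
    let ?c = "1 / of_nat (gam q)"
    have c: "pX n * pY m \<in> carrier RR" "pY m * pT \<in> carrier RR" using vr mU XY by simp_all
    have f: "f = pX n * pY m + Const ?c * (pY m * pT)" using XY by (simp add: mult.assoc)
    have "psi f = psi (pX n * pY m) + psi (Const ?c * (pY m * pT))"
      unfolding f by (rule psi_simps(2)) (use c in auto)
    also have "psi (pX n * pY m) = of_nat (card n) \<cdot> formal_sum (SS m)"
      using XY mU vr product_PP_KK[OF XY(2), of n] by (simp add: psi_simps YS_def)
    also have "psi (Const ?c * (pY m * pT)) = ?c \<cdot> formal_sum (SS m)"
      by (simp only: psi_smult[OF c(2)] psi_Y_T[OF XY(2)])
    also have "of_nat (card n) \<cdot> formal_sum (SS m) + ?c \<cdot> formal_sum (SS m) = (0 :: 'g \<Rightarrow>\<^sub>0 'k)"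
      by (rule poly_mapping_eqI) (simp add: lookup_add card_wl[OF XY(1)])
    finally show ?thesis using XY mU vr by auto
  next
    case YY
    note mU = VV_UU[OF YY(1)] VV_UU[OF YY(2)]
    have pc: "pY m * pY m' \<in> carrier RR" using vr mU by simp
    have pp: "psi (pY m * pY m') = (if m = inv\<^bsub>Ugrp q\<^esub> m' then 0 else formal_sum (SS (m \<otimes>\<^bsub>Ugrp q\<^esub> m')))"
      using YY mU vr product_KK_KK[OF YY(1,2)] by (simp add: psi_simps YS_def)
    show ?thesis
    proof (cases "m = inv\<^bsub>Ugrp q\<^esub> m'")
      case True
      thus ?thesis using YY pc pp by (simp add: Const_def)
    next
      case False
      have mm: "m \<otimes>\<^bsub>Ugrp q\<^esub> m' \<in> VV"
        using YY Vgrp_mult_closed Vgrp_subset_Ugrp Ugrp_mult_eq_one[of m m'] False by (auto simp: VV_def)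
      have f: "f = pY m * pY m' - pY (m \<otimes>\<^bsub>Ugrp q\<^esub> m') * pT"
        using YY False by (simp add: Const_def)
      have "pY (m \<otimes>\<^bsub>Ugrp q\<^esub> m') * pT \<in> carrier RR" using vr VV_UU[OF mm] by simp
      thus ?thesis unfolding f using pc pp False psi_Y_T[OF mm] by (simp add: psi_minus)
    qed
  qed (use vr DD_UU in \<open>auto simp: psi_simps power2_eq_square product_PP_PP product_PP_SS
        product_SS_SS product_SS_KK YS_def DD_def VV_def UU_def\<close>)
qed

lemma lookup_finsum:
  assumes "finite M" "\<And>m. m \<in> M \<Longrightarrow> f m \<in> carrier (A :: ('k, _) module)"
  shows "lookup (finsum A f M) x = (\<Sum>m\<in>M. lookup (f m) x)"
  using assms
proof (induction M)
  case (insert m M)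
  thus ?case by (subst A.finsum_insert) (auto simp: lookup_add)
qed simp

lemma monomial_eval_normal:
  "A.monomial_eval generator 0 = \<one>\<^bsub>group_algebra G\<^esub>"
  "A.monomial_eval generator (var_monomial VarT) = formal_sum (PP {0})"
  "n \<in> WW \<Longrightarrow> A.monomial_eval generator (var_monomial (VarX n)) = formal_sum (PP n)"
  "m \<in> UU \<Longrightarrow> A.monomial_eval generator (var_monomial (VarY m)) = formal_sum (YS m)"
  "m \<in> VV \<Longrightarrow> A.monomial_eval generator (var_monomial (VarY m) + var_monomial VarT) = formal_sum (SS m)"
proof -
  have 1: "A.monomial_eval generator (var_monomial v) = generator v" if "v \<in> variables q" for v
    unfolding var_monomial_def by (rule A.monomial_eval_single[OF gen_closed that])
  show "A.monomial_eval generator 0 = \<one>\<^bsub>group_algebra G\<^esub>"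
    using A.monomial_eval_zero[of "variables q" generator, OF gen_closed] by simp
  show "A.monomial_eval generator (var_monomial VarT) = formal_sum (PP {0})"
    "n \<in> WW \<Longrightarrow> A.monomial_eval generator (var_monomial (VarX n)) = formal_sum (PP n)"
    "m \<in> UU \<Longrightarrow> A.monomial_eval generator (var_monomial (VarY m)) = formal_sum (YS m)"
    using 1 by (simp_all add: variables_eq)
  assume m: "m \<in> VV"
  let ?e = "var_monomial (VarY m) + var_monomial VarT"
  have "?e \<in> normal_monomials" using m by (simp add: normal_monomials_def)
  hence "psi (single ?e 1) = 1 \<odot>\<^bsub>A\<^esub> A.monomial_eval generator ?e"
    by (intro A.poly_eval_single[where S = "variables q", OF gen_closed] normal_monomial_closed)
  also have "single ?e 1 = pY m * (pT :: _ \<Rightarrow>\<^sub>0 'k)" by (simp add: Var_eq_single mult_single)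
  finally show "A.monomial_eval generator ?e = formal_sum (SS m)"
    using psi_Y_T[OF m] by (metis (no_types, lifting) poly_mapping_eqI centre_algebra_simps(5) lookup_group_algebra_smult mult_1)
qed

text \<open>The matrix of the evaluation map between normal monomials and classes. It is triangular:
  only \<open>T\<close> overlaps with \<open>1\<close>, and only \<open>Y_m T\<close> with
  \<open>Y_m\<close>. Injectivity and surjectivity are both read off from it.\<close>

lemma lookup_psi_normal:
  assumes g: "keys g \<subseteq> normal_monomials" and ab: "herm a b" and t: "t \<noteq> 0"
  shows "lookup (psi g) (E a b t) =
    (if t \<in> Gam q then
       (if a = 0 then lookup g (var_monomial VarT) + (if b = 0 then lookup g 0 else 0)
        else lookup g (var_monomial (VarX (wl a))))
     else if t \<in> Psi q then
       lookup g (var_monomial (VarY (cl t)) + var_monomial VarT)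
       + (if b = kap t * (a * a ^ q) then lookup g (var_monomial (VarY (cl t))) else 0)
     else lookup g (var_monomial (VarY (cl t))))"
proof -
  let ?l = lookup
  let ?x = "E a b t"
  have "psi g = (\<Oplus>\<^bsub>A\<^esub>m\<in>normal_monomials. ?l g m \<odot>\<^bsub>A\<^esub> A.monomial_eval generator m)"
    by (rule A.poly_eval_superset[where S = "variables q", OF gen_closed])
       (use g finite_normal_monomials normal_monomial_closed in auto)
  hence "?l (psi g) ?x = (\<Sum>m\<in>normal_monomials. ?l (?l g m \<odot>\<^bsub>A\<^esub> A.monomial_eval generator m) ?x)"
    by (simp only:, intro lookup_finsum finite_normal_monomials A.smult_closed
        A.monomial_eval_closed[where S = "variables q", OF gen_closed] normal_monomial_closed)
  also have "\<dots> = ?l g 0 * ?l \<one>\<^bsub>group_algebra G\<^esub> ?x + (?l g (var_monomial VarT) * ?l (formal_sum (PP {0})) ?x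
    + ((\<Sum>n\<in>WW. ?l g (var_monomial (VarX n)) * ?l (formal_sum (PP n)) ?x)
    + ((\<Sum>m\<in>UU. ?l g (var_monomial (VarY m)) * ?l (formal_sum (YS m)) ?x)
    + (\<Sum>m\<in>VV. ?l g (var_monomial (VarY m) + var_monomial VarT) * ?l (formal_sum (SS m)) ?x))))"
    by (subst sum_normal_monomials) (simp add: monomial_eval_normal cong: sum.cong)
  also have "?l \<one>\<^bsub>group_algebra G\<^esub> ?x = (if t \<in> Gam q \<and> a = 0 \<and> b = 0 then 1 else (0 :: 'k))"
    using ab t by (simp add: lookup_group_algebra_one E_one[symmetric] E_eq_iff)
  also have "?l (formal_sum (PP {0})) ?x = (if t \<in> Gam q \<and> a = 0 then 1 else (0 :: 'k))"
    using ab t by (simp add: lookup_formal_sum finite_sets mem_PP_iff)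
  also have "(\<Sum>n\<in>WW. ?l g (var_monomial (VarX n)) * ?l (formal_sum (PP n)) ?x)
    = (\<Sum>n\<in>WW. if n = wl a \<and> t \<in> Gam q \<and> a \<noteq> 0 then ?l g (var_monomial (VarX n)) else 0)"
  proof (rule sum.cong)
    fix n assume "n \<in> WW"
    then obtain s where s: "s \<noteq> 0" "n = wl s" by (auto simp: WW_def carrier_Wgrp)
    have "a \<in> n \<longleftrightarrow> n = wl a \<and> a \<noteq> 0"
      using s Lset_nonzero[of "a / s"] wl_eq_iff[of a s] by (auto simp: mem_mcoset_iff)
    thus "?l g (var_monomial (VarX n)) * ?l (formal_sum (PP n)) ?x =
      (if n = wl a \<and> t \<in> Gam q \<and> a \<noteq> 0 then ?l g (var_monomial (VarX n)) else 0)"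
      using ab t by (auto simp: lookup_formal_sum finite_sets mem_PP_iff)
  qed simp
  also have "\<dots> = (if t \<in> Gam q \<and> a \<noteq> 0 then ?l g (var_monomial (VarX (wl a))) else 0)"
  proof (cases "t \<in> Gam q \<and> a \<noteq> 0")
    case True
    hence "wl a \<in> WW" by (simp add: WW_def carrier_Wgrp)
    thus ?thesis using True by simp
  next
    case False
    thus ?thesis by (intro trans[OF sum.neutral]) auto
  qed
  also have "(\<Sum>m\<in>UU. ?l g (var_monomial (VarY m)) * ?l (formal_sum (YS m)) ?x)
    = (\<Sum>m\<in>UU. if m = cl t \<and> (t \<in> Psi q \<longrightarrow> b = kap t * (a * a ^ q)) then ?l g (var_monomial (VarY m)) else 0)"
  proof (rule sum.cong)
    fix m assume m: "m \<in> UU"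
    obtain s where s: "s \<noteq> 0" "s \<notin> Gam q" "m = cl s" using m by (rule UU_E)
    have fin: "finite (YS m)" using YS_closed[OF m] finite_G finite_subset by blast
    have eq: "m = cl t \<longleftrightarrow> t / s \<in> Gam q" using s t cl_eq_iff[of t s] by auto
    have "?x \<in> YS m \<longleftrightarrow> m = cl t \<and> (t \<in> Psi q \<longrightarrow> b = kap t * (a * a ^ q))"
    proof (cases "m = cl t")
      case True
      hence "kap t = kap s" using eq Gam_imp_chi_eq s t by (simp add: kap_def)
      moreover have "m \<in> VV \<longleftrightarrow> t \<in> Psi q" "m \<in> VV \<longleftrightarrow> s \<in> Psi q"
        using cl_in_index[OF t] cl_in_index[OF s(1)] True m s by auto
      ultimately show ?thesis
        using True eq s ab t mem_KK_iff[OF ab t, of s] by (auto simp: YS_def mem_SS_iff Gam_one)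
    next
      case False
      moreover have "?x \<notin> SS m" using False eq s ab t by (simp add: mem_SS_iff)
      ultimately show ?thesis using KK_subset_SS[of m] by (auto simp: YS_def)
    qed
    thus "?l g (var_monomial (VarY m)) * ?l (formal_sum (YS m)) ?x =
      (if m = cl t \<and> (t \<in> Psi q \<longrightarrow> b = kap t * (a * a ^ q)) then ?l g (var_monomial (VarY m)) else 0)"
      using fin by (auto simp: lookup_formal_sum)
  qed simp
  also have "\<dots> = (if t \<notin> Gam q \<and> (t \<in> Psi q \<longrightarrow> b = kap t * (a * a ^ q)) then ?l g (var_monomial (VarY (cl t))) else 0)"
  proof (cases "t \<notin> Gam q \<and> (t \<in> Psi q \<longrightarrow> b = kap t * (a * a ^ q))")
    case True
    hence "cl t \<in> UU" using t by (simp add: cl_in_index)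
    thus ?thesis using True by simp
  next
    case False
    thus ?thesis using cl_in_index(1)[OF t] by (intro trans[OF sum.neutral]) auto
  qed
  also have "(\<Sum>m\<in>VV. ?l g (var_monomial (VarY m) + var_monomial VarT) * ?l (formal_sum (SS m)) ?x)
    = (\<Sum>m\<in>VV. if m = cl t then ?l g (var_monomial (VarY m) + var_monomial VarT) else 0)"
  proof (rule sum.cong)
    fix m assume m: "m \<in> VV"
    obtain s where s: "s \<noteq> 0" "m = cl s" using VV_UU[OF m] by (rule UU_E)
    have "?x \<in> SS m \<longleftrightarrow> m = cl t" using s t ab cl_eq_iff[of t s] by (auto simp: mem_SS_iff)
    thus "?l g (var_monomial (VarY m) + var_monomial VarT) * ?l (formal_sum (SS m)) ?x
      = (if m = cl t then ?l g (var_monomial (VarY m) + var_monomial VarT) else 0)"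
      using finite_sets(2)[OF VV_UU[OF m]] by (simp add: lookup_formal_sum)
  qed simp
  also have "\<dots> = (if t \<in> Psi q \<and> t \<notin> Gam q then ?l g (var_monomial (VarY (cl t)) + var_monomial VarT) else 0)"
    using cl_in_index(2)[OF t] by simp
  finally show ?thesis using Gam_subset_Psi by auto
qed

text \<open>The triangular system is solved in order: elements with first coordinate
  \<open>0\<close> and second coordinate \<open>b \<noteq> 0\<close> see \<open>T\<close> but not
  \<open>1\<close>, and \<open>Y_m T\<close> but not \<open>Y_m\<close>.\<close>

lemma psi_normal_inj:
  assumes g: "keys g \<subseteq> normal_monomials" and "psi g = 0"
  shows "g = 0"
proof -
  let ?l = "lookup g"
  note L = lookup_psi_normal[OF g, unfolded assms(2), simplified, symmetric]
  obtain b where b: "b \<noteq> 0" "herm 0 b" using exists_trace_zero by blast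
  have T: "?l (var_monomial VarT) = 0" using L[OF b(2), of 1] b Gam_one by simp
  have one: "?l 0 = 0" using L[of 0 0 1] T Gam_one by simp
  have X: "?l (var_monomial (VarX n)) = 0" if nW: "n \<in> WW" for n
  proof -
    obtain a where a: "a \<noteq> 0" "n = wl a" using nW by (auto simp: WW_def carrier_Wgrp)
    obtain c where "herm a c" using exists_herm by blast
    thus ?thesis using L[of a c 1] a Gam_one by simp
  qed
  have YT: "?l (var_monomial (VarY m) + var_monomial VarT) = 0" if "m \<in> VV" for m
  proof -
    obtain t where t: "t \<in> Psi q" "t \<notin> Gam q" "t \<noteq> 0" "m = cl t" using \<open>m \<in> VV\<close> by (rule VV_E)
    thus ?thesis using L[OF b(2) t(3)] b by simp
  qed
  have Y: "?l (var_monomial (VarY m)) = 0" if "m \<in> UU" for m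
  proof -
    obtain t where t: "t \<noteq> 0" "t \<notin> Gam q" "m = cl t" using \<open>m \<in> UU\<close> by (rule UU_E)
    thus ?thesis using L[of 0 0 t] YT[of m] cl_in_index(2)[of t] by (auto split: if_splits)
  qed
  have "?l m = 0" if "m \<in> normal_monomials" for m
    using that T one X YT Y by (auto simp: normal_monomials_def)
  thus ?thesis using g by (intro poly_mapping_eqI) (auto simp: in_keys_iff subset_iff)
qed

lemma psi_surj:
  assumes z: "z \<in> carrier (A :: ('k, _) module)"
  shows "\<exists>g\<in>carrier RR. psi g = z"
proof -
  let ?l = "lookup"
  let ?s = "single :: _ \<Rightarrow> 'k \<Rightarrow> ('f set variable \<Rightarrow>\<^sub>0 nat) \<Rightarrow>\<^sub>0 'k"
  obtain b0 where b0: "b0 \<noteq> 0" "herm 0 b0" using exists_trace_zero by blast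
  obtain hb where hb: "\<And>a. herm a (hb a)" using exists_herm by metis
  define rx where "rx n = (SOME a. a \<noteq> 0 \<and> n = wl a)" for n
  define ry where "ry m = (SOME t. t \<noteq> 0 \<and> m = cl t)" for m
  have rx: "rx n \<noteq> 0 \<and> n = wl (rx n)" if "n \<in> WW" for n
    unfolding rx_def by (rule someI_ex) (use that in \<open>auto simp: WW_def carrier_Wgrp\<close>)
  have ry: "ry m \<noteq> 0 \<and> m = cl (ry m)" if "m \<in> UU" for m
    unfolding ry_def by (rule someI_ex) (use that in \<open>auto simp: UU_def carrier_Ugrp\<close>)
  define cX where "cX n = ?l z (E (rx n) (hb (rx n)) 1)" for n
  define cYT where "cYT m = ?l z (E 0 b0 (ry m))" for m
  \<comment> \<open>For \<open>m\<close> in \<open>VV\<close> the coset sum \<open>Y_m T\<close>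
    also contains the class of \<open>Y_m\<close>, so its contribution is subtracted; the
    coefficient of \<open>1\<close> in \<open>g\<close> below is corrected for \<open>T\<close> in
    the same way.\<close>
  define cY where "cY m = (if m \<in> VV then ?l z (E 0 0 (ry m)) - cYT m else ?l z (E 0 0 (ry m)))" for m
  define g where "g = ?s 0 (?l z (E 0 0 1) - ?l z (E 0 b0 1)) + ?s (var_monomial VarT) (?l z (E 0 b0 1))
    + (\<Sum>n\<in>WW. ?s (var_monomial (VarX n)) (cX n)) + (\<Sum>m\<in>UU. ?s (var_monomial (VarY m)) (cY m))
    + (\<Sum>m\<in>VV. ?s (var_monomial (VarY m) + var_monomial VarT) (cYT m))"
  have lg: "?l g 0 = ?l z (E 0 0 1) - ?l z (E 0 b0 1)" "?l g (var_monomial VarT) = ?l z (E 0 b0 1)"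
    "n \<in> WW \<Longrightarrow> ?l g (var_monomial (VarX n)) = cX n" "m \<in> UU \<Longrightarrow> ?l g (var_monomial (VarY m)) = cY m"
    "m' \<in> VV \<Longrightarrow> ?l g (var_monomial (VarY m') + var_monomial VarT) = cYT m'" for n m m'
    by (simp_all add: g_def lookup_add lookup_sum lookup_single when_def)
  have g: "keys g \<subseteq> normal_monomials"
    unfolding keys_subset_iff
  proof safe
    fix x assume x: "x \<notin> normal_monomials"
    have "0 \<noteq> x" "var_monomial VarT \<noteq> x" "n \<in> WW \<Longrightarrow> var_monomial (VarX n) \<noteq> x"
      "m \<in> UU \<Longrightarrow> var_monomial (VarY m) \<noteq> x"
      "m' \<in> VV \<Longrightarrow> var_monomial (VarY m') + var_monomial VarT \<noteq> x" for n m m'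
      using x by (auto simp: normal_monomials_def)
    thus "?l g x = 0"
      by (simp add: g_def lookup_add lookup_sum lookup_single when_def cong: sum.cong)
  qed
  hence gR: "g \<in> carrier RR"
    using normal_monomial_closed by (auto simp: polynomial_algebra_def)
  have pc: "psi g \<in> carrier A"
    by (rule A.poly_eval_closed[where S = "variables q", OF gen_closed gR])
  have key: "?l (psi g) (E a b t) = ?l z (E a b t)" if ab: "herm a b" and t: "t \<noteq> 0" for a b t
  proof -
    note Lg = lookup_psi_normal[OF g ab t]
    consider (one) "t \<in> Gam q" "a = 0" "b = 0" | (T) "t \<in> Gam q" "a = 0" "b \<noteq> 0" | (X) "t \<in> Gam q" "a \<noteq> 0"
      | (V) "t \<in> Psi q" "t \<notin> Gam q" | (D) "t \<notin> Psi q"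
      by blast
    thus ?thesis
    proof cases
      case one
      have "E a b t = E 0 0 1" using one ab t by (simp add: E_eq_iff)
      thus ?thesis using Lg one lg by simp
    next
      case T
      have "E a b t = E 0 b 1" using T ab t by (simp add: E_eq_iff)
      thus ?thesis using Lg T lg central_scale_zero[OF z, of b b0 1] b0 ab by simp
    next
      case X
      have 1: "E a b t = E a b 1" using X ab t by (simp add: E_eq_iff)
      have w: "wl a \<in> WW" using X by (simp add: WW_def carrier_Wgrp)
      have "a / rx (wl a) \<in> Lset q" using rx[OF w] X wl_eq_iff by blast
      hence "?l z (E a b 1) = cX (wl a)"
        unfolding cX_def using rx[OF w] hb ab central_PP_const[OF z, of "rx (wl a)"] by metis
      thus ?thesis using Lg X lg(3)[OF w] 1 by simp
    next
      case V
      have m: "cl t \<in> VV" "cl t \<in> UU" using V t cl_in_index by auto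
      let ?r = "ry (cl t)"
      have r: "?r \<noteq> 0" "cl ?r = cl t" using ry[OF m(2)] by auto
      hence rG: "?r / t \<in> Gam q" using cl_eq_iff[OF r(1) t] by simp
      have E0: "E 0 0 ?r = E 0 0 t" "E 0 b0 ?r = E 0 b0 t" using r t rG b0 by (simp_all add: E_eq_iff)
      let ?b = "b - kap t * (a * a ^ q)"
      have "?l z (E a b t) = ?l z (E 0 ?b t)" "herm 0 ?b" using central_VV[OF z ab] V by auto
      moreover have "?l z (E 0 ?b t) = ?l z (E 0 b0 t)" if "?b \<noteq> 0"
        using central_scale_zero[OF z] calculation(2) b0 t that by blast
      ultimately show ?thesis using Lg V lg(4)[OF m(2)] lg(5)[OF m(1)] m E0
        by (auto simp: cY_def cYT_def)
    next
      case D
      have m: "cl t \<in> UU" "cl t \<notin> VV" "t \<notin> Gam q" using D t cl_in_index Gam_subset_Psi by auto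
      let ?r = "ry (cl t)"
      have r: "?r \<noteq> 0" "cl ?r = cl t" using ry[OF m(1)] by auto
      hence "E 0 0 ?r = E 0 0 t" using cl_eq_iff[OF r(1) t] t by (simp add: E_eq_iff)
      thus ?thesis using Lg D m lg(4)[OF m(1)] central_DD[OF z ab t D] by (simp add: cY_def)
    qed
  qed
  have "psi g = z"
  proof (rule group_algebra_eqI)
    fix x assume "x \<in> carrier G"
    thus "?l (psi g) x = ?l z x" using E_surj key by metis
  qed (use pc z in \<open>auto simp: centre_iff\<close>)
  thus ?thesis using gR by blast
qed

theorem centre_presentation:
  "algebra_isomorphic (A :: ('k, _) module) (quotient_algebra RR (Idl\<^bsub>RR\<^esub> (relations q)))"
proof -
  interpret R: cring RR by (rule polynomial_algebra_cring)
  let ?I = "Idl\<^bsub>RR\<^esub> (relations q)"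
  let ?K = "{f \<in> carrier RR. psi f = \<zero>\<^bsub>A\<^esub>}"
  have rel: "relations q \<subseteq> carrier RR" using psi_relations by blast
  have I: "ideal ?I RR" by (rule R.genideal_ideal[OF rel])
  have relI: "relations q \<subseteq> ?I" by (rule R.genideal_self[OF rel])
  have K: "ideal ?K RR" by (rule A.kernel_ideal[OF gen_closed])
  have IK: "?I \<subseteq> ?K" by (rule R.genideal_minimal[OF K]) (use psi_relations in auto)
  show ?thesis
  proof (rule algebra_isomorphic_quotient[OF R.ring_axioms I A.ring_axioms _ psi_hom])
    fix f assume f: "f \<in> carrier RR"
    show "f \<in> ?I \<longleftrightarrow> psi f = \<zero>\<^bsub>A\<^esub>"
    proof
      assume 0: "psi f = \<zero>\<^bsub>A\<^esub>"
      \<comment> \<open>A polynomial in the kernel is congruent to a normal form that also lies in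
        the kernel, and such a normal form is zero.\<close>
      obtain g where g: "keys g \<subseteq> normal_monomials" "f - g \<in> ?I"
        using exists_normal_form[OF refl I relI f] by blast
      have gR: "g \<in> carrier RR" using g normal_monomial_closed by (auto simp: polynomial_algebra_def)
      have "psi (f - g) = 0" using g IK by auto
      hence "psi g = 0" using psi_minus[OF f gR] 0 by simp
      hence "g = 0" using psi_normal_inj[OF g(1)] by simp
      thus "f \<in> ?I" using g by simp
    qed (use IK in auto)
  next
    fix c f assume "f \<in> carrier RR"
    thus "psi (c \<odot>\<^bsub>RR\<^esub> f) = c \<odot>\<^bsub>A\<^esub> psi f" by (simp add: psi_smult)
  next
    show "carrier A \<subseteq> psi ` carrier RR" using psi_surj by blast
  qed simp
qed

end

section \<open>Hermitian spaces of dimension three\<close>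

lemma vec3_eq_iff: "(x :: 'a ^ 3) = y \<longleftrightarrow> x $ 1 = y $ 1 \<and> x $ 2 = y $ 2 \<and> x $ 3 = y $ 3"
  by (simp add: vec_eq_iff forall_3)

definition basis_matrix :: "'a::field ^ 3 \<Rightarrow> 'a ^ 3 \<Rightarrow> 'a ^ 3 \<Rightarrow> 'a ^ 3 ^ 3" where
  "basis_matrix u v w = transpose (vector [u, v, w])"

lemma basis_matrix_mult: "basis_matrix u v w *v x = x $ 1 *s u + x $ 2 *s v + x $ 3 *s w"
  by (simp add: basis_matrix_def vec3_eq_iff matrix_vector_mult_def transpose_def sum_3 mult.commute)

lemma mat_vector_mult: "mat c *v x = c *s (x :: 'a::field ^ 3)"
  by (simp add: vec3_eq_iff matrix_vector_mult_def mat_def sum_3)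

lemma mat_comm: "mat c ** A = A ** mat c" for A :: "'a::field ^ 3 ^ 3"
  by (simp add: vec3_eq_iff matrix_matrix_mult_def mat_def sum_3 mult.commute)

lemma mat_mult_mat: "mat c ** mat d = (mat (c * d) :: 'a::field ^ 3 ^ 3)"
  by (simp add: vec3_eq_iff matrix_matrix_mult_def mat_def sum_3)

lemma det_mat3: "det (mat c :: 'a::field ^ 3 ^ 3) = c ^ 3"
  by (simp add: det_3 mat_def power3_eq_cube)

section \<open>The standard form and the stabiliser of its first axis\<close>

context quadratic_field
begin

definition std_form :: "'f ^ 3 \<Rightarrow> 'f ^ 3 \<Rightarrow> 'f" where
  "std_form x y = x $ 1 * y $ 3 ^ q + x $ 2 * y $ 2 ^ q + x $ 3 * y $ 1 ^ q"

text \<open>The unitriangular matrix behind \<open>E a b t\<close> with its columns scaled by the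
  diagonal factors; \<open>t ^ q / t\<close> stands for the exponent \<open>q - 1\<close>.\<close>

definition bmat :: "'f \<Rightarrow> 'f \<Rightarrow> 'f \<Rightarrow> 'f ^ 3 ^ 3" where
  "bmat a b t = vector [vector [t, a * t ^ q / t, b / t ^ q],
                        vector [0, t ^ q / t, - (a ^ q) / t ^ q],
                        vector [0, 0, 1 / t ^ q]]"

lemma bmat_mult:
  assumes "t \<noteq> 0" "t' \<noteq> 0"
  shows "bmat a b t ** bmat a' b' t' =
    bmat (a + chi q t * a') (b + t * t ^ q * b' - a * (chi q t * a') ^ q) (t * t')"
  using assms
  by (simp add: vec3_eq_iff matrix_matrix_mult_def bmat_def sum_3 chi_def frob_simps power2_eq_square field_simps)

lemma bmat_det: "t \<noteq> 0 \<Longrightarrow> det (bmat a b t) = 1"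
  by (simp add: det_3 bmat_def)

lemma bmat_mult_vec: "bmat a b t *v x = vector [t * x $ 1 + a * t ^ q / t * x $ 2 + b / t ^ q * x $ 3,
    t ^ q / t * x $ 2 - a ^ q / t ^ q * x $ 3, x $ 3 / t ^ q]"
  by (simp add: vec3_eq_iff matrix_vector_mult_def bmat_def sum_3)

lemma bmat_std_form:
  assumes ab: "herm a b" and t: "t \<noteq> 0"
  shows "std_form (bmat a b t *v x) (bmat a b t *v y) = std_form x y"
proof -
  obtain x1 x2 x3 y1 y2 y3 where xy: "x $ 1 = x1" "x $ 2 = x2" "x $ 3 = x3" "y $ 1 = y1" "y $ 2 = y2" "y $ 3 = y3"
    by blast
  define u where "u = t ^ q"
  have u: "u \<noteq> 0" "u ^ q = t" using t by (simp_all add: u_def)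
  show ?thesis
    unfolding std_form_def bmat_mult_vec vector_3 xy u_def[symmetric]
    using t u(1)
    by (simp add: frob_simps u u_def[symmetric] herm_conj[OF ab] field_simps)
qed

lemma bmat_inj:
  assumes "bmat a b t = bmat a' b' t'" "t \<noteq> 0" "t' \<noteq> 0"
  shows "a = a' \<and> b = b' \<and> t = t'"
  using assms by (auto simp: vec3_eq_iff bmat_def)

text \<open>On \<open>Gam q\<close> both \<open>chi\<close> and the norm are \<open>1\<close>, which
  makes all three diagonal entries equal to \<open>c\<close>.\<close>

lemma mat_eq_bmat:
  assumes "c \<in> Gam q"
  shows "mat c = bmat 0 0 c"
proof -
  have c0: "c \<noteq> 0" using Gam_nonzero assms by blast
  have c1: "c ^ 2 = c ^ q" using chi_eq_1_iff[OF c0] assms c0 by (simp add: chi_def)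
  have c2: "c * c ^ q = 1" using assms Gam_subset_Psi mem_Psi_iff by blast
  have "c ^ q / c = c" using c1 c0 by (simp flip: c1 add: power2_eq_square)
  moreover have "1 / c ^ q = c" using c2 c0 by (simp add: field_simps)
  ultimately show ?thesis by (simp add: vec3_eq_iff mat_def bmat_def)
qed

text \<open>The entries are read off from the form on pairs of axes: pair \<open>(1, 2)\<close>
  gives the zero in the last row, \<open>(1, 3)\<close> the last diagonal entry,
  \<open>(3, 2)\<close> the entry depending on \<open>a\<close>, and \<open>(3, 3)\<close> the
  condition \<open>herm\<close>. The middle diagonal entry comes from the determinant.\<close>

lemma stabiliser_eq_bmat:
  assumes form: "\<And>x y. std_form (B *v x) (B *v y) = std_form x y" and det: "det B = 1"
    and ax: "B *v axis 1 1 = t *s axis 1 1" and t: "t \<noteq> 0"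
  shows "\<exists>a b. herm a b \<and> B = bmat a b t"
proof -
  have col: "(B *v axis j 1) $ i = B $ i $ j" for i j :: 3
    by (simp add: matrix_vector_mult_def axis_def if_distrib cong: if_cong)
  have c1: "B $ 1 $ 1 = t" "B $ 2 $ 1 = 0" "B $ 3 $ 1 = 0"
    using arg_cong[OF ax, of "\<lambda>v. v $ 1"] arg_cong[OF ax, of "\<lambda>v. v $ 2"] arg_cong[OF ax, of "\<lambda>v. v $ 3"]
    by (simp_all add: col) (simp_all add: axis_def)
  have f: "B $ 1 $ i * (B $ 3 $ j) ^ q + B $ 2 $ i * (B $ 2 $ j) ^ q + B $ 3 $ i * (B $ 1 $ j) ^ q
    = std_form (axis i 1) (axis j 1)" for i j
    using form[of "axis i 1" "axis j 1"] by (simp add: std_form_def col)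
  have c32: "B $ 3 $ 2 = 0" using f[of 1 2] c1 t by (simp add: std_form_def axis_def)
  have c33: "B $ 3 $ 3 = 1 / t ^ q"
  proof -
    have "t * (B $ 3 $ 3) ^ q = 1" using f[of 1 3] c1 by (simp add: std_form_def axis_def)
    hence "(t * (B $ 3 $ 3) ^ q) ^ q = 1" by simp
    hence "t ^ q * B $ 3 $ 3 = 1" by (simp add: frob_simps)
    thus ?thesis using t by (simp add: field_simps)
  qed
  have c22: "B $ 2 $ 2 = t ^ q / t" using det c1 c32 c33 t by (simp add: det_3 field_simps)
  define a where "a = B $ 1 $ 2 * t / t ^ q"
  define b where "b = B $ 1 $ 3 * t ^ q"
  have a: "B $ 1 $ 2 = a * t ^ q / t" and b: "B $ 1 $ 3 = b / t ^ q"
    using t by (simp_all add: a_def b_def)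
  define u where "u = t ^ q"
  have u: "u \<noteq> 0" "u ^ q = t" using t by (simp_all add: u_def)
  have c23: "B $ 2 $ 3 = - (a ^ q) / t ^ q"
  proof -
    have "B $ 1 $ 3 * (B $ 3 $ 2) ^ q + B $ 2 $ 3 * (B $ 2 $ 2) ^ q + B $ 3 $ 3 * (B $ 1 $ 2) ^ q = 0"
      using f[of 3 2] by (simp add: std_form_def axis_def)
    hence "B $ 2 $ 3 * (t / u) + 1 / u * (a ^ q * t / u) = 0"
      unfolding c32 c22 a c33 u_def[symmetric] by (simp add: frob_simps u flip: u_def)
    hence "t * (B $ 2 $ 3 * u + a ^ q) = 0" using u by (simp add: field_simps)
    hence "B $ 2 $ 3 * u + a ^ q = 0" using t by simp
    hence "B $ 2 $ 3 * u = - (a ^ q)" by (simp add: eq_neg_iff_add_eq_0)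
    thus ?thesis using u by (simp add: u_def[symmetric] field_simps)
  qed
  have "herm a b"
  proof -
    have "B $ 1 $ 3 * (B $ 3 $ 3) ^ q + B $ 2 $ 3 * (B $ 2 $ 3) ^ q + B $ 3 $ 3 * (B $ 1 $ 3) ^ q = 0"
      using f[of 3 3] by (simp add: std_form_def axis_def)
    hence "b / u * (1 / t) + (a ^ q / u) * (a / t) + 1 / u * (b ^ q / t) = 0"
      unfolding c23 c33 b u_def[symmetric] by (simp add: frob_simps u)
    hence "(b + a ^ q * a + b ^ q) / (u * t) = 0" by (simp add: add_divide_distrib)
    thus ?thesis using u t by (simp add: herm_def algebra_simps)
  qed
  moreover have "B = bmat a b t" by (simp add: vec3_eq_iff bmat_def c1 c32 c33 c22 c23 a b)
  ultimately show ?thesis by blast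
qed

lemma card_herm: "card {(a, b). herm a b} = q ^ 3"
proof -
  have "{(a, b). herm a b} = (SIGMA a:UNIV. {b. herm a b})" by auto
  moreover have "card {b. herm a b} = q" for a
  proof -
    have "(- (a * a ^ q)) ^ q = 1 * - (a * a ^ q)" by (simp add: frob_simps mult.commute)
    moreover have "{b. herm a b} = {b. b ^ q + 1 * b = - (a * a ^ q)}"
      by (auto simp: herm_def eq_neg_iff_add_eq_0 add.commute)
    ultimately show ?thesis using card_additive_fibre[of 1 "- (a * a ^ q)"] by simp
  qed
  ultimately show ?thesis using card_F by (simp add: power3_eq_cube power2_eq_square)
qed

text \<open>With the second and third coordinates fixed, isotropy is a trace equation for the first
  one; its coefficient \<open>z ^ q\<close> may vanish, in which case the number of solutions is
  still divisible by \<open>q\<close>.\<close>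

lemma dvd_card_isotropic: "q dvd card {x. std_form x x = 0}"
proof -
  define f where "f y z = {x :: 'f. (z ^ q * x) ^ q + 1 * (z ^ q * x) = - (y * y ^ q)}" for y z
  have "card {x. std_form x x = 0} = card (SIGMA yz:UNIV. f (fst yz) (snd yz))"
  proof (rule bij_betw_same_card[of "\<lambda>x. ((x $ 2, x $ 3), x $ 1)"],
      rule bij_betw_byWitness[where f' = "\<lambda>(yz, x). vector [x, fst yz, snd yz]"])
    show "(\<lambda>x. ((x $ 2, x $ 3), x $ 1)) ` {x. std_form x x = 0} \<subseteq> (SIGMA yz:UNIV. f (fst yz) (snd yz))"
      by (auto simp: std_form_def f_def frob_simps eq_neg_iff_add_eq_0 algebra_simps)
    show "(\<lambda>(yz, x). vector [x, fst yz, snd yz]) ` (SIGMA yz:UNIV. f (fst yz) (snd yz)) \<subseteq> {x. std_form x x = 0}"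
      by (auto simp: std_form_def f_def frob_simps eq_neg_iff_add_eq_0 algebra_simps)
  qed (auto simp: vec3_eq_iff)
  also have "\<dots> = (\<Sum>yz\<in>UNIV. card (f (fst yz) (snd yz)))" by simp
  also have "q dvd \<dots>"
    unfolding f_def by (intro dvd_sum dvd_card_additive_fibre) simp
  finally show ?thesis .
qed

end

section \<open>Bases adapted to an isotropic vector\<close>

locale hermitian_space = quadratic_field p r q F
  for p r q and F :: "'f::{field,finite} itself" +
  fixes h :: "'f ^ 3 \<Rightarrow> 'f ^ 3 \<Rightarrow> 'f"
  assumes form: "nondegenerate_hermitian_form q h"
begin

lemma h_add: "h (x + y) z = h x z + h y z" "h z (x + y) = h z x + h z y"
  and h_smult: "h (a *s x) y = a * h x y" "h x (a *s y) = a ^ q * h x y"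
  and h_conj: "h y x = h x y ^ q"
  and h_nondegenerate: "(\<And>y. h x y = 0) \<Longrightarrow> x = 0"
proof -
  have 1: "\<And>x y z :: 'f ^ 3. h (x + y) z = h x z + h y z" "\<And>a (x :: 'f ^ 3) y. h (a *s x) y = a * h x y"
    "\<And>x y :: 'f ^ 3. h y x = h x y ^ q" "\<And>x :: 'f ^ 3. (\<forall>y. h x y = 0) \<Longrightarrow> x = 0"
    using form unfolding nondegenerate_hermitian_form_def by blast+
  show "h (x + y) z = h x z + h y z" "h (a *s x) y = a * h x y" "h y x = h x y ^ q"
    "(\<And>y. h x y = 0) \<Longrightarrow> x = 0" using 1 by blast+
  show "h z (x + y) = h z x + h z y" using 1(1)[of x y z] 1(3)[of z] by (metis frob_add)
  show "h x (a *s y) = a ^ q * h x y" using 1(2)[of a y x] 1(3) by (metis power_mult_distrib)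
qed

lemma h_zero [simp]: "h 0 x = 0" "h x 0 = 0"
  using h_smult(1)[of 0 0 x] h_conj[of x 0] by simp_all

lemma h_diff: "h (x - y) z = h x z - h y z" "h z (x - y) = h z x - h z y"
  using h_add(1)[of "x - y" y z] h_add(2)[of z "x - y" y] by simp_all

lemmas h_simps = h_add h_smult h_diff

lemma exists_orthogonal: "\<exists>w \<noteq> 0. h w u = 0"
proof -
  let ?x = "axis 1 1 :: 'f ^ 3" and ?y = "axis 2 1 :: 'f ^ 3"
  let ?w = "h ?y u *s ?x - h ?x u *s ?y"
  show ?thesis
  proof (cases "h ?x u = 0")
    case True
    thus ?thesis by (intro exI[of _ ?x]) (simp add: axis_eq_0_iff)
  next
    case False
    hence "?w $ 2 \<noteq> 0" by (simp add: axis_def)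
    hence "?w \<noteq> 0" by (metis zero_index)
    moreover have "h ?w u = 0" by (simp add: h_simps)
    ultimately show ?thesis by blast
  qed
qed

text \<open>If all vectors were isotropic, \<open>h x y + h y x\<close> would vanish identically;
  but some pair has \<open>h x y\<close> of trace one.\<close>

lemma exists_anisotropic: "\<exists>v. h v v \<noteq> 0"
proof (rule ccontr)
  assume "\<not> ?thesis"
  hence iso: "h v v = 0" for v by blast
  have "(axis 1 1 :: 'f ^ 3) \<noteq> 0" by (simp add: axis_eq_0_iff)
  then obtain y where y: "h (axis 1 1) y \<noteq> 0" using h_nondegenerate by blast
  obtain b :: 'f where b: "b + b ^ q = 1" using trace_surj[of 1] by auto
  define x :: "'f ^ 3" where "x = (b / h (axis 1 1) y) *s axis 1 1"
  have "h x y = b" using y by (simp add: x_def h_simps)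
  hence "h y x = b ^ q" using h_conj[of y x] by simp
  moreover have "h (x + y) (x + y) = h x x + h x y + h y x + h y y" by (simp add: h_add)
  ultimately show False using iso b \<open>h x y = b\<close> by simp
qed

text \<open>On two orthogonal anisotropic vectors the isotropy of \<open>v + a *s w\<close> is a
  norm equation for \<open>a\<close> over the fixed field of the Frobenius map, which is
  solvable.\<close>

lemma exists_isotropic: "\<exists>v \<noteq> 0. h v v = 0"
proof -
  obtain v where v: "h v v \<noteq> 0" using exists_anisotropic by blast
  obtain w where w: "w \<noteq> 0" "h w v = 0" using exists_orthogonal by blast
  show ?thesis
  proof (cases "h w w = 0")
    case False
    have "(- h v v / h w w) ^ q = - h v v / h w w" by (simp add: frob_simps flip: h_conj)
    from norm_surj[OF this] obtain a where a: "a * a ^ q = - h v v / h w w" by auto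
    have vw: "h v w = 0" using h_conj[of v w] w by simp
    have "h (v + a *s w) (v + a *s w) = h v v + a * a ^ q * h w w"
      using w vw by (simp add: h_simps)
    also have "\<dots> = 0" using a False by simp
    finally have "h (v + a *s w) (v + a *s w) = 0" .
    moreover have "v + a *s w \<noteq> 0"
    proof
      assume "v + a *s w = 0"
      hence "h (v + a *s w) v = 0" by simp
      thus False using w v by (simp add: h_simps)
    qed
    ultimately show ?thesis by blast
  qed (use w in blast)
qed

definition adapted :: "'f ^ 3 ^ 3 \<Rightarrow> 'f ^ 3 ^ 3 \<Rightarrow> bool" where
  "adapted M M' \<longleftrightarrow> M ** M' = mat 1 \<and> M' ** M = mat 1 \<and> (\<forall>x y. h (M *v x) (M *v y) = std_form x y)"

text \<open>Completes \<open>e\<close> to a hyperbolic pair \<open>e\<close>, \<open>f\<close> and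
  adds a vector of length one orthogonal to both, so that the form becomes
  \<open>std_form\<close>.\<close>

lemma exists_adapted:
  assumes e: "e \<noteq> 0" "h e e = 0"
  shows "\<exists>M M'. adapted M M' \<and> M *v axis 1 1 = e"
proof -
  obtain f0 where f0: "h e f0 \<noteq> 0" using h_nondegenerate e by blast
  \<comment> \<open>The power \<open>q\<close> undoes the semilinearity of the second
    argument.\<close>
  define f1 where "f1 = (1 / h e f0) ^ q *s f0"
  have ef1: "h e f1 = 1" using f0 by (simp add: f1_def h_smult)
  have "(- h f1 f1) ^ q = - h f1 f1" by (simp add: frob_minus flip: h_conj)
  from trace_surj[OF this] obtain a where a: "a + a ^ q = - h f1 f1" by blast
  define f where "f = f1 + a *s e"
  have fe1: "h f1 e = 1" using h_conj[of f1 e] ef1 by simp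
  have ef: "h e f = 1" "h f e = 1" using ef1 fe1 e by (simp_all add: f_def h_simps)
  have "h f f = h f1 f1 + (a + a ^ q)" using ef1 fe1 e by (simp add: f_def h_simps)
  hence ff: "h f f = 0" using a by simp
  \<comment> \<open>A plane has at most \<open>q ^ 4\<close> of the \<open>q ^ 6\<close>
    vectors.\<close>
  obtain u where u: "\<And>x y. u \<noteq> x *s e + y *s f"
  proof -
    have "card ((\<lambda>(x, y). x *s e + y *s f) ` UNIV) \<le> card (UNIV :: ('f \<times> 'f) set)"
      by (rule card_image_le) simp
    also have "\<dots> < card (UNIV :: ('f ^ 3) set)"
      using card_F q_ge_2 by (simp add: card_cartesian_product CARD_vec power_strict_increasing_iff flip: power_mult power_add)
    finally have "(\<lambda>(x, y). x *s e + y *s f) ` UNIV \<noteq> (UNIV :: ('f ^ 3) set)" by auto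
    then obtain u where "u \<notin> (\<lambda>(x, y). x *s e + y *s f) ` UNIV" by blast
    thus ?thesis by (intro that[of u]) auto
  qed
  define g where "g = u - h u f *s e - h u e *s f"
  have ge: "h g e = 0" "h g f = 0" by (simp_all add: g_def h_simps ef ff e)
  have eg: "h e g = 0" "h f g = 0" using h_conj[of e g] h_conj[of f g] ge by simp_all
  have g0: "g \<noteq> 0" using u[of "h u f" "h u e"] by (auto simp: g_def algebra_simps)
  have inj: "a = 0 \<and> b = 0 \<and> c = 0" if eq: "a *s e + b *s g + c *s f = 0" for a b c
  proof -
    have "h (a *s e + b *s g + c *s f) e = 0" "h (a *s e + b *s g + c *s f) f = 0" using eq by simp_all
    hence "c = 0" "a = 0" using ef ff ge e by (simp_all add: h_simps)
    thus ?thesis using eq g0 by simp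
  qed
  have span: "\<exists>M'. basis_matrix e (s *s g) f ** M' = mat 1 \<and> M' ** basis_matrix e (s *s g) f = mat 1"
    if s: "s \<noteq> 0" for s
  proof -
    have "x = 0" if "basis_matrix e (s *s g) f *v x = 0" for x
    proof -
      have "x $ 1 *s e + (x $ 2 * s) *s g + x $ 3 *s f = 0"
        using that by (simp add: basis_matrix_mult vector_smult_assoc)
      from inj[OF this] show ?thesis using s by (simp add: vec3_eq_iff)
    qed
    then obtain M' where "M' ** basis_matrix e (s *s g) f = mat 1"
      using matrix_left_invertible_ker[of "basis_matrix e (s *s g) f"] by blast
    thus ?thesis using matrix_left_right_inverse by blast
  qed
  \<comment> \<open>Otherwise \<open>g\<close> would be orthogonal to the basis \<open>e\<close>,
    \<open>g\<close>, \<open>f\<close>, against nondegeneracy.\<close>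
  have gg: "h g g \<noteq> 0"
  proof
    assume gg: "h g g = 0"
    obtain M' where M': "basis_matrix e (1 *s g) f ** M' = mat 1" using span[of 1] by auto
    have "h g x = 0" for x
    proof -
      have "x = basis_matrix e (1 *s g) f *v (M' *v x)"
        by (simp only: matrix_vector_mul_assoc M' matrix_vector_mul_lid)
      also have "h g \<dots> = 0" using gg ge by (simp add: basis_matrix_mult h_simps)
      finally show ?thesis .
    qed
    thus False using h_nondegenerate g0 by blast
  qed
  have "(1 / h g g) ^ q = 1 / h g g" by (simp add: frob_simps flip: h_conj)
  from norm_surj[OF this] obtain s where s: "s * s ^ q = 1 / h g g" by auto
  have s0: "s \<noteq> 0" using s gg by auto
  let ?M = "basis_matrix e (s *s g) f"
  have "h (?M *v x) (?M *v y) = std_form x y" for x y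
  proof -
    define g' where "g' = s *s g"
    have "h g' g' = (s * s ^ q) * h g g" by (simp add: g'_def h_smult)
    hence g'g': "h g' g' = 1" using s gg by simp
    have "h g' e = 0" "h g' f = 0" "h e g' = 0" "h f g' = 0"
      using ge eg by (simp_all add: g'_def h_simps)
    thus ?thesis unfolding g'_def[symmetric] using g'g' e ef ff
      by (simp add: basis_matrix_mult h_add h_smult std_form_def algebra_simps)
  qed
  moreover have "?M *v axis 1 1 = e" by (simp add: basis_matrix_mult) (simp add: axis_def)
  ultimately show ?thesis using span[OF s0] unfolding adapted_def by blast
qed

lemma SU_simps [simp]:
  "A \<otimes>\<^bsub>SU h\<^esub> B = A ** B" "\<one>\<^bsub>SU h\<^esub> = mat 1"
  "A \<in> carrier (SU h) \<longleftrightarrow> det A = 1 \<and> (\<forall>x y. h (A *v x) (A *v y) = h x y)"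
  by (simp_all add: SU_def)

lemma SU_group: "group (SU h)"
proof (rule groupI)
  fix A B assume "A \<in> carrier (SU h)" "B \<in> carrier (SU h)"
  thus "A \<otimes>\<^bsub>SU h\<^esub> B \<in> carrier (SU h)" by (simp add: det_mul flip: matrix_vector_mul_assoc)
next
  fix A assume A: "A \<in> carrier (SU h)"
  then obtain B where B: "A ** B = mat 1" "B ** A = mat 1"
    using invertible_det_nz[of A] unfolding invertible_def by auto
  have "det A * det B = 1" using arg_cong[OF B(1), of det] by (simp add: det_mul det_I)
  moreover have "h (B *v x) (B *v y) = h x y" for x y
  proof -
    have "h (B *v x) (B *v y) = h (A *v (B *v x)) (A *v (B *v y))" using A by simp
    thus ?thesis by (simp add: matrix_vector_mul_assoc B)
  qed
  ultimately show "\<exists>B\<in>carrier (SU h). B \<otimes>\<^bsub>SU h\<^esub> A = \<one>\<^bsub>SU h\<^esub>" using A B by (intro bexI[of _ B]) auto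
qed (auto simp: matrix_mul_assoc)

definition scalars :: "('f ^ 3 ^ 3) set" where
  "scalars = {A \<in> carrier (SU h). \<exists>c. A = mat c}"

lemma PSU_eq: "PSU h = SU h Mod scalars"
  by (simp add: PSU_def scalars_def)

end

section \<open>\<open>PSU\<close> as cosets of scalar matrices\<close>

context hermitian_space
begin

interpretation SU: group "SU h" by (rule SU_group)

lemma finite_SU: "finite (carrier (SU h))" by (rule finite_subset[OF subset_UNIV]) simp

text \<open>The determinant gives \<open>c ^ 3 = 1\<close> and the form on an anisotropic vector
  gives norm one; together they say \<open>chi q c = 1\<close>.\<close>

lemma mat_in_SU_iff: "mat c \<in> carrier (SU h) \<longleftrightarrow> c \<in> Gam q"
proof
  assume c: "c \<in> Gam q"
  have "c * c ^ q = 1" using c Gam_subset_Psi mem_Psi_iff by blast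
  moreover have "c ^ 3 = 1" using c gam_cases by (auto simp: Gam_def)
  moreover have "h (mat c *v x) (mat c *v y) = (c * c ^ q) * h x y" for x y
    by (simp add: mat_vector_mult h_smult)
  ultimately show "mat c \<in> carrier (SU h)" by (simp add: det_mat3)
next
  assume c: "mat c \<in> carrier (SU h)"
  have c3: "c ^ 3 = 1" using c by (simp add: det_mat3)
  hence c0: "c \<noteq> 0" by auto
  obtain v where v: "h v v \<noteq> 0" using exists_anisotropic by blast
  have "h (mat c *v v) (mat c *v v) = (c * c ^ q) * h v v"
    by (simp add: mat_vector_mult h_smult)
  hence cq: "c * c ^ q = 1" using c v by simp
  have "c ^ 2 = c ^ q"
  proof -
    have "c * c ^ 2 = c * c ^ q" using c3 cq by (simp add: power3_eq_cube power2_eq_square mult.assoc)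
    thus ?thesis using c0 by simp
  qed
  hence "chi q c = 1" using c0 by (simp add: chi_def)
  thus "c \<in> Gam q" using chi_eq_1_iff c0 by blast
qed

lemma scalars_eq: "scalars = mat ` Gam q"
  unfolding scalars_def using mat_in_SU_iff by blast

lemma mat_inj: "mat c = (mat d :: 'f ^ 3 ^ 3) \<Longrightarrow> c = d"
  by (drule arg_cong[of _ _ "\<lambda>A. A $ 1 $ 1"]) (simp add: mat_def)

lemma card_scalars: "card scalars = gam q"
  unfolding scalars_eq using card_Gam by (subst card_image) (auto simp: inj_on_def dest: mat_inj)

lemma scalars_normal: "scalars \<lhd> SU h"
proof (rule SU.normalI)
  show "subgroup scalars (SU h)"
  proof (rule SU.subgroupI)
    show "scalars \<subseteq> carrier (SU h)" by (auto simp: scalars_def)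
    show "scalars \<noteq> {}" using Gam_one by (auto simp: scalars_eq)
    fix A assume "A \<in> scalars"
    then obtain c where c: "c \<in> Gam q" "A = mat c" by (auto simp: scalars_eq)
    have c': "1 / c \<in> Gam q" using Gam_divide[OF Gam_one c(1)] .
    have "mat (1 / c) \<otimes>\<^bsub>SU h\<^esub> A = \<one>\<^bsub>SU h\<^esub>"
      using c Gam_nonzero[OF c(1)] by (simp add: mat_mult_mat)
    hence "inv\<^bsub>SU h\<^esub> A = mat (1 / c)"
      using c c' mat_in_SU_iff by (intro SU.inv_equality) blast+
    thus "inv\<^bsub>SU h\<^esub> A \<in> scalars" using c' by (auto simp: scalars_eq)
    fix B assume "B \<in> scalars"
    thus "A \<otimes>\<^bsub>SU h\<^esub> B \<in> scalars" using c Gam_mult by (auto simp: scalars_eq mat_mult_mat)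
  qed
  show "\<forall>x\<in>carrier (SU h). scalars #>\<^bsub>SU h\<^esub> x = x <#\<^bsub>SU h\<^esub> scalars"
    by (auto simp: scalars_eq r_coset_def l_coset_def mat_comm)
qed

interpretation Z: normal scalars "SU h" by (rule scalars_normal)

abbreviation cs :: "'f ^ 3 ^ 3 \<Rightarrow> ('f ^ 3 ^ 3) set" where "cs A \<equiv> scalars #>\<^bsub>SU h\<^esub> A"

lemma mem_scalar_coset_iff: "B \<in> cs A \<longleftrightarrow> (\<exists>c\<in>Gam q. B = mat c ** A)"
  by (auto simp: r_coset_def scalars_eq)

lemma scalar_coset_eq_iff:
  assumes "A \<in> carrier (SU h)" "B \<in> carrier (SU h)"
  shows "cs A = cs B \<longleftrightarrow> (\<exists>c\<in>Gam q. A = mat c ** B)"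
  using assms SU.rcos_self[OF assms(1) Z.subgroup_axioms] SU.repr_independence[OF _ assms(2) Z.subgroup_axioms]
  unfolding mem_scalar_coset_iff[symmetric] by metis

lemma PSU_carrier: "carrier (PSU h) = cs ` carrier (SU h)"
  by (auto simp: PSU_eq FactGroup_def RCOSETS_def)

lemma PSU_mult: "A \<in> carrier (SU h) \<Longrightarrow> B \<in> carrier (SU h) \<Longrightarrow> cs A \<otimes>\<^bsub>PSU h\<^esub> cs B = cs (A ** B)"
  using Z.rcos_sum[of A B] by (simp add: PSU_eq)

lemma PSU_group: "group (PSU h)"
  unfolding PSU_eq by (rule Z.factorgroup_is_group)

interpretation PSU: group "PSU h" by (rule PSU_group)

lemma PSU_one: "\<one>\<^bsub>PSU h\<^esub> = cs (mat 1)"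
  using SU.coset_mult_one[OF Z.subset] by (simp add: PSU_eq)

lemma finite_PSU: "finite (carrier (PSU h))"
  by (simp add: PSU_carrier finite_SU)

section \<open>Coordinates relative to an adapted basis, and the normaliser of the unipotent
  group\<close>

context
  fixes M M' :: "'f ^ 3 ^ 3"
  assumes ad: "adapted M M'"
begin

lemma adapted_simps: "M ** M' = mat 1" "M' ** M = mat 1" "h (M *v x) (M *v y) = std_form x y"
  using ad by (auto simp: adapted_def)

definition EM :: "'f \<Rightarrow> 'f \<Rightarrow> 'f \<Rightarrow> 'f ^ 3 ^ 3" where
  "EM a b t = M ** bmat a b t ** M'"

lemma sandwich: "(M ** A ** M') ** (M ** B ** M') = M ** (A ** B) ** M'"
proof -
  have "(M ** A ** M') ** (M ** B ** M') = M ** A ** (M' ** M) ** B ** M'"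
    by (simp only: matrix_mul_assoc)
  thus ?thesis by (simp add: adapted_simps matrix_mul_assoc)
qed

lemma sandwich_inv: "M' ** (M ** A ** M') ** M = A" "M ** (M' ** A ** M) ** M' = A"
proof -
  have "M' ** (M ** A ** M') ** M = (M' ** M) ** A ** (M' ** M)" by (simp only: matrix_mul_assoc)
  thus "M' ** (M ** A ** M') ** M = A" by (simp add: adapted_simps)
  have "M ** (M' ** A ** M) ** M' = (M ** M') ** A ** (M ** M')" by (simp only: matrix_mul_assoc)
  thus "M ** (M' ** A ** M) ** M' = A" by (simp add: adapted_simps)
qed

lemma det_MM: "det M * det M' = 1" "det M' * det M = 1"
  using arg_cong[OF adapted_simps(1), of det] by (simp_all add: det_mul det_I mult.commute)

lemma h_sandwich: "h x y = std_form (M' *v x) (M' *v y)"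
  by (simp add: adapted_simps(1) matrix_vector_mul_assoc flip: adapted_simps(3))

lemma EM_closed: "herm a b \<Longrightarrow> t \<noteq> 0 \<Longrightarrow> EM a b t \<in> carrier (SU h)"
proof -
  assume ab: "herm a b" and t: "t \<noteq> 0"
  have "det (EM a b t) = det M * det M'" using t by (simp add: EM_def det_mul bmat_det)
  moreover have "h (EM a b t *v x) (EM a b t *v y) = h x y" for x y
  proof -
    have "h (EM a b t *v x) (EM a b t *v y)
      = h (M *v (bmat a b t *v (M' *v x))) (M *v (bmat a b t *v (M' *v y)))"
      by (simp add: EM_def matrix_vector_mul_assoc matrix_mul_assoc)
    thus ?thesis by (simp only: adapted_simps(3) bmat_std_form[OF ab t] h_sandwich[of x y])
  qed
  ultimately show ?thesis by (simp add: det_MM)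
qed

lemma EM_mult:
  assumes "t \<noteq> 0" "t' \<noteq> 0"
  shows "EM a b t ** EM a' b' t' = EM (a + chi q t * a') (b + t * t ^ q * b' - a * (chi q t * a') ^ q) (t * t')"
  unfolding EM_def sandwich bmat_mult[OF assms] ..

lemma EM_inj: "EM a b t = EM a' b' t' \<Longrightarrow> t \<noteq> 0 \<Longrightarrow> t' \<noteq> 0 \<Longrightarrow> a = a' \<and> b = b' \<and> t = t'"
  using bmat_inj sandwich_inv(1) unfolding EM_def by metis

lemma EM_scalar:
  assumes "c \<in> Gam q" "t \<noteq> 0"
  shows "mat c ** EM a b t = EM a b (c * t)"
proof -
  have c0: "c \<noteq> 0" using Gam_nonzero assms by blast
  have "mat c ** EM a b t = M ** (mat c ** bmat a b t) ** M'"
    unfolding EM_def by (metis mat_comm matrix_mul_assoc)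
  also have "mat c ** bmat a b t = bmat a b (c * t)"
    unfolding mat_eq_bmat[OF assms(1)] bmat_mult[OF c0 assms(2)]
    using chi_eq_1_iff[OF c0] assms Gam_subset_Psi mem_Psi_iff[of c] by auto
  finally show ?thesis by (simp add: EM_def)
qed

definition EE :: "'f \<Rightarrow> 'f \<Rightarrow> 'f \<Rightarrow> ('f ^ 3 ^ 3) set" where
  "EE a b t = cs (EM a b t)"

lemma EE_closed: "herm a b \<Longrightarrow> t \<noteq> 0 \<Longrightarrow> EE a b t \<in> carrier (PSU h)"
  unfolding EE_def PSU_carrier using EM_closed by blast

lemma EE_mult:
  assumes "herm a b" "t \<noteq> 0" "herm a' b'" "t' \<noteq> 0"
  shows "EE a b t \<otimes>\<^bsub>PSU h\<^esub> EE a' b' t'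
    = EE (a + chi q t * a') (b + t * t ^ q * b' - a * (chi q t * a') ^ q) (t * t')"
  unfolding EE_def PSU_mult[OF EM_closed[OF assms(1,2)] EM_closed[OF assms(3,4)]] EM_mult[OF assms(2,4)] ..

lemma EE_eq_iff:
  assumes "herm a b" "t \<noteq> 0" "herm a' b'" "t' \<noteq> 0"
  shows "EE a b t = EE a' b' t' \<longleftrightarrow> a = a' \<and> b = b' \<and> t / t' \<in> Gam q"
proof -
  have "EE a b t = EE a' b' t' \<longleftrightarrow> (\<exists>c\<in>Gam q. EM a b t = mat c ** EM a' b' t')"
    unfolding EE_def by (rule scalar_coset_eq_iff[OF EM_closed[OF assms(1,2)] EM_closed[OF assms(3,4)]])
  also have "\<dots> \<longleftrightarrow> (\<exists>c\<in>Gam q. EM a b t = EM a' b' (c * t'))"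
    using EM_scalar assms(4) by auto
  also have "\<dots> \<longleftrightarrow> a = a' \<and> b = b' \<and> t / t' \<in> Gam q"
  proof safe
    fix c assume c: "c \<in> Gam q" and eq: "EM a b t = EM a' b' (c * t')"
    have "c * t' \<noteq> 0" using Gam_nonzero[OF c] assms by simp
    from EM_inj[OF eq assms(2) this] show "a = a'" "b = b'" "t / t' \<in> Gam q" using c assms by auto
  next
    assume "t / t' \<in> Gam q"
    thus "\<exists>c\<in>Gam q. EM a' b' t = EM a' b' (c * t')" using assms by (intro bexI[of _ "t / t'"]) auto
  qed
  finally show ?thesis .
qed

lemma EE_one: "EE 0 0 1 = \<one>\<^bsub>PSU h\<^esub>"
proof -
  have "EM 0 0 1 = mat 1" using mat_eq_bmat[OF Gam_one] by (simp add: EM_def adapted_simps flip: mat_eq_bmat[OF Gam_one])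
  thus ?thesis by (simp add: EE_def PSU_one)
qed

text \<open>Written in the adapted basis, the assumption is that the first axis is an eigenvector of
  an isometry of \<open>std_form\<close>.\<close>

lemma line_stabiliser:
  assumes A: "A \<in> carrier (SU h)" and e: "A *v (M *v axis 1 1) = t *s (M *v axis 1 1)" and t: "t \<noteq> 0"
  shows "\<exists>a b. herm a b \<and> A = EM a b t"
proof -
  let ?B = "M' ** A ** M"
  have "std_form (?B *v x) (?B *v y) = std_form x y" for x y
  proof -
    have "std_form (?B *v x) (?B *v y) = h (A *v (M *v x)) (A *v (M *v y))"
      by (simp add: h_sandwich matrix_vector_mul_assoc matrix_mul_assoc)
    thus ?thesis using A adapted_simps(3) by simp
  qed
  moreover have "det ?B = 1" using A det_MM by (simp add: det_mul)
  moreover have "?B *v axis 1 1 = t *s axis 1 1"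
  proof -
    have "?B *v axis 1 1 = M' *v (A *v (M *v axis 1 1))"
      by (simp add: matrix_vector_mul_assoc matrix_mul_assoc)
    also have "\<dots> = t *s (M' *v (M *v axis 1 1))" unfolding e by (simp add: vec.scale)
    also have "\<dots> = t *s axis 1 1" by (simp add: matrix_vector_mul_assoc adapted_simps)
    finally show ?thesis .
  qed
  ultimately obtain a b where "herm a b" "?B = bmat a b t" using stabiliser_eq_bmat t by blast
  moreover have "A = M ** ?B ** M'" by (simp add: sandwich_inv)
  ultimately show ?thesis unfolding EM_def by metis
qed

definition unipotent :: "('f ^ 3 ^ 3) set set" where
  "unipotent = {EE a b 1 | a b. herm a b}"

lemma card_unipotent: "card unipotent = q ^ 3"
proof -
  have "unipotent = (\<lambda>(a, b). EE a b 1) ` {(a, b). herm a b}" by (auto simp: unipotent_def)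
  moreover have "inj_on (\<lambda>(a, b). EE a b 1) {(a, b). herm a b}"
    by (rule inj_onI) (auto simp: EE_eq_iff)
  ultimately show ?thesis by (simp add: card_image card_herm)
qed

lemma unipotent_subgroup: "subgroup unipotent (PSU h)"
proof (rule PSU.subgroupI)
  show "unipotent \<subseteq> carrier (PSU h)" using EE_closed by (auto simp: unipotent_def)
  show "unipotent \<noteq> {}" using exists_trace_zero by (auto simp: unipotent_def)
  fix x assume "x \<in> unipotent"
  then obtain a b where ab: "herm a b" "x = EE a b 1" by (auto simp: unipotent_def)
  have ab': "herm (- a) (b ^ q)" using ab by (simp add: herm_def frob_minus add.commute)
  have "EE (- a) (b ^ q) 1 \<otimes>\<^bsub>PSU h\<^esub> x = EE 0 (b ^ q + b + a * a ^ q) 1"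
    using ab ab' by (simp add: EE_mult)
  also have "b ^ q + b + a * a ^ q = 0" using ab by (simp add: herm_def add.commute)
  finally have "inv\<^bsub>PSU h\<^esub> x = EE (- a) (b ^ q) 1"
    using ab ab' EE_closed EE_one by (intro PSU.inv_equality) auto
  thus "inv\<^bsub>PSU h\<^esub> x \<in> unipotent" using ab' by (auto simp: unipotent_def)
  fix y assume "y \<in> unipotent"
  then obtain a' b' where ab2: "herm a' b'" "y = EE a' b' 1" by (auto simp: unipotent_def)
  have "herm (a + a') (b + b' - a * a' ^ q)"
    unfolding herm_def by (simp add: frob_simps herm_conj[OF ab(1)] herm_conj[OF ab2(1)] algebra_simps)
  thus "x \<otimes>\<^bsub>PSU h\<^esub> y \<in> unipotent" using ab ab2 by (auto simp: unipotent_def EE_mult)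
qed

text \<open>An element normalising the unipotent group must preserve its fixed line, because some
  unipotent element has no other eigenline.\<close>

lemma normaliser_unipotent:
  "normalizer (PSU h) unipotent = {EE a b t | a b t. herm a b \<and> t \<noteq> 0}"
proof -
  have sub: "unipotent \<subseteq> carrier (PSU h)" using unipotent_subgroup subgroup.subset by blast
  have norm_iff: "x \<in> normalizer (PSU h) unipotent \<longleftrightarrow>
    x \<in> carrier (PSU h) \<and> x <#\<^bsub>PSU h\<^esub> unipotent #>\<^bsub>PSU h\<^esub> inv\<^bsub>PSU h\<^esub> x = unipotent" for x
    using sub by (auto simp: normalizer_def stabilizer_def)
  have conj: "x <#\<^bsub>PSU h\<^esub> unipotent #>\<^bsub>PSU h\<^esub> inv\<^bsub>PSU h\<^esub> x
    = (\<lambda>u. x \<otimes>\<^bsub>PSU h\<^esub> u \<otimes>\<^bsub>PSU h\<^esub> inv\<^bsub>PSU h\<^esub> x) ` unipotent" for x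
    by (auto simp: l_coset_def r_coset_def)
  show ?thesis
  proof (intro equalityI subsetI)
    fix x assume "x \<in> {EE a b t | a b t. herm a b \<and> t \<noteq> 0}"
    then obtain a b t where x: "herm a b" "t \<noteq> 0" "x = EE a b t" by blast
    have xG: "x \<in> carrier (PSU h)" using x EE_closed by simp
    have "x \<otimes>\<^bsub>PSU h\<^esub> u \<otimes>\<^bsub>PSU h\<^esub> inv\<^bsub>PSU h\<^esub> x \<in> unipotent" if uu: "u \<in> unipotent" for u
    proof -
      obtain c d where u: "herm c d" "u = EE c d 1" using uu by (auto simp: unipotent_def)
      define w where "w = chi q t"
      \<comment> \<open>Solves \<open>E (w * c) d' 1 x = x u\<close> for the second
        coordinate.\<close>
      define d' where "d' = t * t ^ q * d - a * (w * c) ^ q + w * c * a ^ q"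
      have n: "t * t ^ q = w * w ^ q" using chi_norm x by (simp add: w_def)
      have h': "herm (w * c) d'"
        unfolding herm_def d'_def n by (simp add: frob_simps herm_conj[OF u(1)] algebra_simps)
      have "EE (w * c) d' 1 \<otimes>\<^bsub>PSU h\<^esub> x = EE (w * c + a) (d' + b - w * c * a ^ q) t"
        using x h' by (simp add: EE_mult)
      also have "\<dots> = x \<otimes>\<^bsub>PSU h\<^esub> u"
        using x u by (simp add: EE_mult d'_def w_def algebra_simps)
      finally have "x \<otimes>\<^bsub>PSU h\<^esub> u = EE (w * c) d' 1 \<otimes>\<^bsub>PSU h\<^esub> x" ..
      hence "x \<otimes>\<^bsub>PSU h\<^esub> u \<otimes>\<^bsub>PSU h\<^esub> inv\<^bsub>PSU h\<^esub> x = EE (w * c) d' 1"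
        using xG EE_closed[OF h', of 1] by (simp add: PSU.m_assoc)
      thus ?thesis using h' by (auto simp: unipotent_def)
    qed
    hence "x <#\<^bsub>PSU h\<^esub> unipotent #>\<^bsub>PSU h\<^esub> inv\<^bsub>PSU h\<^esub> x \<subseteq> unipotent"
      unfolding conj by blast
    moreover have "card (x <#\<^bsub>PSU h\<^esub> unipotent #>\<^bsub>PSU h\<^esub> inv\<^bsub>PSU h\<^esub> x) = card unipotent"
      unfolding conj by (rule card_image, rule inj_onI) (use sub xG in \<open>auto simp: subset_iff\<close>)
    moreover have "finite unipotent" using sub finite_PSU finite_subset by blast
    ultimately show "x \<in> normalizer (PSU h) unipotent" using norm_iff xG card_subset_eq by blast
  next
    fix x assume "x \<in> normalizer (PSU h) unipotent"
    hence xG: "x \<in> carrier (PSU h)" and eq: "x <#\<^bsub>PSU h\<^esub> unipotent #>\<^bsub>PSU h\<^esub> inv\<^bsub>PSU h\<^esub> x = unipotent"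
      using norm_iff by auto
    obtain A where A: "A \<in> carrier (SU h)" "x = cs A" using xG by (auto simp: PSU_carrier)
    obtain B where B: "A ** B = mat 1" "B ** A = mat 1" "B \<in> carrier (SU h)"
      using SU.r_inv[OF A(1)] SU.l_inv[OF A(1)] SU.inv_closed[OF A(1)] by auto
    let ?e = "M *v axis 1 1"
    define w where "w = M' *v (B *v ?e)"
    have Be: "B *v ?e = M *v w" by (simp add: w_def matrix_vector_mul_assoc matrix_mul_assoc adapted_simps)
    \<comment> \<open>Conjugates under \<open>x\<close> stay unipotent and fix \<open>?e\<close>, so
      the inverse \<open>B\<close> of \<open>A\<close> maps \<open>?e\<close> to an eigenvector of
      the original element. The scalar \<open>c\<close> enters because equality in
      \<open>PSU\<close> is equality up to \<open>Gam q\<close>.\<close>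
    have eigen: "\<exists>c. bmat 1 d 1 *v w = c *s w" if d: "herm 1 d" for d
    proof -
      have "x \<otimes>\<^bsub>PSU h\<^esub> EE 1 d 1 \<otimes>\<^bsub>PSU h\<^esub> inv\<^bsub>PSU h\<^esub> x \<in> unipotent"
      proof -
        have "EE 1 d 1 \<in> unipotent" using d by (auto simp: unipotent_def)
        thus ?thesis using eq unfolding conj by blast
      qed
      then obtain a b where ab: "herm a b" "x \<otimes>\<^bsub>PSU h\<^esub> EE 1 d 1 \<otimes>\<^bsub>PSU h\<^esub> inv\<^bsub>PSU h\<^esub> x = EE a b 1"
        by (auto simp: unipotent_def)
      hence "x \<otimes>\<^bsub>PSU h\<^esub> EE 1 d 1 = EE a b 1 \<otimes>\<^bsub>PSU h\<^esub> x"
      proof -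
        have "EE 1 d 1 \<in> carrier (PSU h)" "EE a b 1 \<in> carrier (PSU h)" using EE_closed d ab by simp_all
        hence "x \<otimes>\<^bsub>PSU h\<^esub> EE 1 d 1 = (x \<otimes>\<^bsub>PSU h\<^esub> EE 1 d 1 \<otimes>\<^bsub>PSU h\<^esub> inv\<^bsub>PSU h\<^esub> x) \<otimes>\<^bsub>PSU h\<^esub> x"
          using xG by (simp add: PSU.m_assoc)
        thus ?thesis unfolding ab(2) .
      qed
      hence cseq: "cs (A ** EM 1 d 1) = cs (EM a b 1 ** A)"
        unfolding EE_def A(2) using PSU_mult[OF A(1) EM_closed[OF d, of 1]] PSU_mult[OF EM_closed[OF ab(1), of 1] A(1)]
        by simp
      obtain c where c: "c \<in> Gam q" "A ** EM 1 d 1 = mat c ** (EM a b 1 ** A)"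
      proof -
        have "A ** EM 1 d 1 \<in> carrier (SU h)" "EM a b 1 ** A \<in> carrier (SU h)"
          using SU.m_closed[OF A(1) EM_closed[OF d]] SU.m_closed[OF EM_closed[OF ab(1)] A(1)] by simp_all
        thus ?thesis using cseq scalar_coset_eq_iff that by blast
      qed
      have "EM 1 d 1 ** B = mat c ** (B ** EM a b 1)"
      proof -
        have "EM 1 d 1 ** B = B ** (A ** EM 1 d 1) ** B" by (simp add: matrix_mul_assoc B)
        also have "\<dots> = (B ** mat c) ** EM a b 1 ** (A ** B)" unfolding c by (simp only: matrix_mul_assoc)
        finally show ?thesis by (simp only: B(1) matrix_mul_rid mat_comm[of c B, symmetric] matrix_mul_assoc)
      qed
      hence "EM 1 d 1 *v (B *v ?e) = mat c *v (B *v (EM a b 1 *v ?e))"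
        by (simp only: matrix_vector_mul_assoc matrix_mul_assoc)
      also have "EM a b 1 *v ?e = ?e"
      proof -
        have "EM a b 1 *v ?e = M *v (bmat a b 1 *v axis 1 1)"
          by (simp add: EM_def matrix_vector_mul_assoc matrix_mul_assoc[symmetric] adapted_simps)
        moreover have "bmat a b 1 *v axis 1 1 = axis 1 1"
          by (simp add: bmat_mult_vec vec3_eq_iff axis_def)
        ultimately show ?thesis by simp
      qed
      finally have "M' *v (EM 1 d 1 *v (M *v w)) = c *s (M' *v (M *v w))"
        unfolding Be by (simp add: mat_vector_mult vec.scale)
      hence "(M' ** EM 1 d 1 ** M) *v w = c *s w"
        by (simp add: matrix_vector_mul_assoc matrix_mul_assoc adapted_simps)
      thus ?thesis unfolding EM_def sandwich_inv by blast
    qed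
    \<comment> \<open>The choice \<open>a = 1\<close> gives a single Jordan block, whose only
      eigenline is the first axis; hence the coordinates \<open>w $ 3\<close> and
      \<open>w $ 2\<close> vanish.\<close>
    obtain d where d: "herm 1 d" using exists_herm by blast
    obtain c where "bmat 1 d 1 *v w = c *s w" using eigen[OF d] by blast
    hence w: "w $ 1 + w $ 2 + d * w $ 3 = c * w $ 1" "w $ 2 - w $ 3 = c * w $ 2" "w $ 3 = c * w $ 3"
      by (simp_all add: bmat_mult_vec vec3_eq_iff)
    have w3: "w $ 3 = 0"
    proof (rule ccontr)
      assume "w $ 3 \<noteq> 0"
      hence "c = 1" using w(3) by simp
      thus False using w(2) \<open>w $ 3 \<noteq> 0\<close> by simp
    qed
    have w2: "w $ 2 = 0"
    proof (rule ccontr)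
      assume "w $ 2 \<noteq> 0"
      hence "c = 1" using w(2) w3 by simp
      thus False using w(1) w3 \<open>w $ 2 \<noteq> 0\<close> by simp
    qed
    have "w = w $ 1 *s axis 1 1" using w2 w3 by (simp add: vec3_eq_iff axis_def)
    hence "M *v w = w $ 1 *s ?e" by (metis vec.scale)
    hence Be': "B *v ?e = w $ 1 *s ?e" using Be by simp
    have e: "?e = w $ 1 *s (A *v ?e)"
    proof -
      have "?e = A *v (B *v ?e)" by (simp add: matrix_vector_mul_assoc matrix_mul_assoc B)
      thus ?thesis unfolding Be' by (simp add: vec.scale)
    qed
    have "?e \<noteq> 0"
    proof
      assume "?e = 0"
      hence "M' *v ?e = 0" by simp
      hence "axis 1 1 = (0 :: 'f ^ 3)" by (simp add: matrix_vector_mul_assoc adapted_simps)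
      thus False by (simp add: axis_eq_0_iff)
    qed
    hence w1: "w $ 1 \<noteq> 0" using e by auto
    have "A *v ?e = (1 / w $ 1) *s ?e" using w1 by (subst (2) e) (simp add: vector_smult_assoc)
    from line_stabiliser[OF A(1) this] obtain a b where "herm a b" "A = EM a b (1 / w $ 1)"
      using w1 by (metis divide_eq_0_iff one_neq_zero)
    thus "x \<in> {EE a b t | a b t. herm a b \<and> t \<noteq> 0}" using A w1 unfolding EE_def by force
  qed
qed

end

end

section \<open>Sylow subgroups and their normalisers\<close>

text \<open>\<open>BijGroup X\<close> consists of maps that are extensional on \<open>X\<close>,
  hence the restriction.\<close>

lemma group_actionI:
  assumes "group G" and closed: "\<And>g x. g \<in> carrier G \<Longrightarrow> x \<in> X \<Longrightarrow> f g x \<in> X"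
    and one: "\<And>x. x \<in> X \<Longrightarrow> f \<one>\<^bsub>G\<^esub> x = x"
    and mult: "\<And>g g' x. g \<in> carrier G \<Longrightarrow> g' \<in> carrier G \<Longrightarrow> x \<in> X \<Longrightarrow> f (g \<otimes>\<^bsub>G\<^esub> g') x = f g (f g' x)"
  shows "group_action G X (\<lambda>g. restrict (f g) X)"
proof -
  interpret group G by fact
  have bij: "restrict (f g) X \<in> Bij X" if g: "g \<in> carrier G" for g
  proof -
    have "f g (f (inv\<^bsub>G\<^esub> g) x) = x" "f (inv\<^bsub>G\<^esub> g) (f g x) = x" if "x \<in> X" for x
      using that mult[OF g inv_closed[OF g], of x] mult[OF inv_closed[OF g] g, of x] one g by simp_all
    hence "bij_betw (f g) X X"
      using closed g by (intro bij_betw_byWitness[where f' = "f (inv\<^bsub>G\<^esub> g)"]) auto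
    thus ?thesis by (simp add: Bij_def bij_betw_restrict_eq)
  qed
  show ?thesis
  proof (rule group_action.intro, unfold group_hom_def group_hom_axioms_def, intro conjI group_BijGroup assms(1) homI)
    fix g g' assume g: "g \<in> carrier G" "g' \<in> carrier G"
    have "restrict (f (g \<otimes>\<^bsub>G\<^esub> g')) X = compose X (restrict (f g) X) (restrict (f g') X)"
      using g closed mult by (auto simp: compose_def fun_eq_iff)
    thus "restrict (f (g \<otimes>\<^bsub>G\<^esub> g')) X = restrict (f g) X \<otimes>\<^bsub>BijGroup X\<^esub> restrict (f g') X"
      using g bij by (simp add: BijGroup_def)
  qed (use bij in \<open>simp add: BijGroup_def\<close>)
qed

text \<open>If \<open>p\<close> divided the size of every orbit, it would divide \<open>card E\<close>; any other orbit size is prime to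
  \<open>p ^ n\<close>.\<close>

lemma (in group_action) exists_small_orbit:
  assumes p: "Factorial_Ring.prime p" and X: "finite E" "\<not> p dvd card E" and ord: "Coset.order G = p ^ n * m"
  shows "\<exists>x\<in>E. card (orbit G \<phi> x) dvd m"
proof -
  have "card E = (\<Sum>orb\<in>orbits G E \<phi>. card orb)"
    using disjoint_sum[OF X(1), of "\<lambda>_. 1 :: nat"] by simp
  with X(2) obtain orb where orb: "orb \<in> orbits G E \<phi>" "\<not> p dvd card orb"
    using dvd_sum[of "orbits G E \<phi>" p card] by auto
  then obtain x where x: "x \<in> E" "orb = orbit G \<phi> x" by (auto simp: orbits_def)
  have "card orb dvd p ^ n * m" using orbit_stabilizer_theorem[OF x(1)] ord x(2) by (metis dvd_triv_left)
  moreover have "coprime (card orb) (p ^ n)"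
    using orb(2) p by (metis coprime_commute coprime_power_right_iff prime_imp_coprime)
  ultimately have "card orb dvd m" using coprime_dvd_mult_right_iff by blast
  thus ?thesis using x by blast
qed

section \<open>Sylow subgroups fix an isotropic line\<close>

context hermitian_space
begin

interpretation SU: group "SU h" by (rule SU_group)
interpretation Z: normal scalars "SU h" by (rule scalars_normal)
interpretation PSU: group "PSU h" by (rule PSU_group)

text \<open>The count including the zero vector is divisible by \<open>q\<close>, so removing that
  vector leaves \<open>- 1\<close> modulo \<open>p\<close>.\<close>

lemma card_isotropic_not_dvd: "\<not> p dvd card {v. v \<noteq> 0 \<and> h v v = 0}"
proof -
  obtain e where "e \<noteq> 0" "h e e = 0" using exists_isotropic by blast
  then obtain M M' where ad: "adapted M M'" using exists_adapted by blast
  have "card {v. h v v = 0} = card {x. std_form x x = 0}"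
  proof (rule bij_betw_same_card[of "\<lambda>v. M' *v v"], rule bij_betw_byWitness[where f' = "\<lambda>x. M *v x"])
    show "(*v) M' ` {v. h v v = 0} \<subseteq> {x. std_form x x = 0}" using h_sandwich[OF ad] by auto
    show "(*v) M ` {x. std_form x x = 0} \<subseteq> {v. h v v = 0}" using adapted_simps(3)[OF ad] by auto
  qed (simp_all add: matrix_vector_mul_assoc adapted_simps[OF ad])
  hence "p dvd card {v. h v v = 0}" using dvd_trans[OF p_dvd_q dvd_card_isotropic] by simp
  moreover have "{v. h v v = 0} = insert 0 {v. v \<noteq> 0 \<and> h v v = 0}" by auto
  moreover have "card (insert 0 {v. v \<noteq> 0 \<and> h v v = 0}) = Suc (card {v. v \<noteq> 0 \<and> h v v = 0})"
    by (rule card_insert_disjoint) auto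
  ultimately have dvd: "p dvd Suc (card {v. v \<noteq> 0 \<and> h v v = 0})" by (simp only:)
  show ?thesis
  proof
    assume "p dvd card {v. v \<noteq> 0 \<and> h v v = 0}"
    from dvd_diff_nat[OF dvd this] show False using prime_p by (simp add: Suc_diff_le)
  qed
qed

lemma sylow_eq_unipotent:
  assumes P: "sylow_subgroup p (PSU h) P"
  shows "\<exists>M M'. adapted M M' \<and> P = unipotent M M'"
proof -
  have Psub: "subgroup P (PSU h)" and Pcard: "card P = p ^ multiplicity p (Coset.order (PSU h))"
    using P by (auto simp: sylow_subgroup_def)
  \<comment> \<open>The explicit unipotent group has order \<open>p ^ (3 * r)\<close>, and the Sylow
    order is the full power of \<open>p\<close> in the group order.\<close>
  have qP: "q ^ 3 \<le> card P"
  proof -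
    obtain e where "e \<noteq> 0" "h e e = 0" using exists_isotropic by blast
    then obtain M M' where ad: "adapted M M'" using exists_adapted by blast
    have "card (unipotent M M') dvd Coset.order (PSU h)"
      using PSU.lagrange[OF unipotent_subgroup[OF ad]] by (metis dvd_triv_right)
    hence "q ^ 3 dvd Coset.order (PSU h)" by (simp only: card_unipotent[OF ad])
    hence "p ^ (r * 3) dvd Coset.order (PSU h)" by (simp only: q_def power_mult)
    moreover have "Coset.order (PSU h) \<noteq> 0" using PSU.order_gt_0_iff_finite finite_PSU by simp
    ultimately have "r * 3 \<le> multiplicity p (Coset.order (PSU h))"
      using prime_p by (intro multiplicity_geI) (auto dest: not_prime_unit)
    hence "p ^ (r * 3) \<le> card P"
      unfolding Pcard using prime_gt_0_nat[OF prime_p] by (intro power_increasing) auto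
    thus ?thesis by (simp add: q_def power_mult)
  qed
  have Psub': "subgroup P (SU h Mod scalars)" using Psub by (simp add: PSU_eq)
  define Q where "Q = \<Union>P"
  have Q: "Q = {x \<in> carrier (SU h). cs x \<in> P}"
    unfolding Q_def by (rule Z.factgroup_subgroup_union_char[OF Psub'])
  have Qsub: "subgroup Q (SU h)"
    unfolding Q_def by (rule Z.factgroup_subgroup_union_subgroup[OF Psub'])
  let ?Q = "SU h\<lparr>carrier := Q\<rparr>"
  interpret Q: group ?Q by (rule SU.subgroup_imp_group[OF Qsub])
  have scQ: "scalars \<subseteq> Q"
  proof
    fix A assume A: "A \<in> scalars"
    hence AG: "A \<in> carrier (SU h)" using Z.subset by blast
    have "cs A = \<one>\<^bsub>PSU h\<^esub>" using SU.coset_join2[OF AG Z.subgroup_axioms A] by (simp add: PSU_eq)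
    thus "A \<in> Q" using AG subgroup.one_closed[OF Psub] unfolding Q by (simp only: mem_Collect_eq)
  qed
  have ordQ: "Coset.order ?Q = p ^ multiplicity p (Coset.order (PSU h)) * gam q"
  proof -
    have "subgroup scalars ?Q" by (rule SU.subgroup_incl[OF Z.subgroup_axioms Qsub scQ])
    from Q.lagrange[OF this] have "card (rcosets\<^bsub>?Q\<^esub> scalars) * gam q = Coset.order ?Q"
      by (simp add: card_scalars)
    moreover have "P = rcosets\<^bsub>?Q\<^esub> scalars"
      unfolding Q_def by (rule Z.factgroup_subgroup_union_factor[OF Psub'])
    ultimately show ?thesis using Pcard by simp
  qed
  let ?X = "{v. v \<noteq> 0 \<and> h v v = 0}"
  have nz: "A *v v \<noteq> 0" if A: "A \<in> carrier (SU h)" and v: "v \<noteq> 0" for A v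
  proof
    assume "A *v v = 0"
    hence "h v y = 0" for y using A h_zero(1)[of "A *v y"] unfolding SU_simps by metis
    thus False using h_nondegenerate v by blast
  qed
  have QSU: "A \<in> carrier (SU h)" if "A \<in> Q" for A using that Q by blast
  interpret act: group_action ?Q ?X "\<lambda>A. restrict ((*v) A) ?X"
  proof (rule group_actionI[OF Q.group_axioms])
    fix A v assume A: "A \<in> carrier ?Q" and v: "v \<in> ?X"
    have "A \<in> carrier (SU h)" using A QSU by simp
    thus "A *v v \<in> ?X" using v nz by auto
  qed (auto simp: matrix_vector_mul_assoc)
  obtain e where e: "e \<in> ?X" and "card (orbit ?Q (\<lambda>A. restrict ((*v) A) ?X) e) dvd gam q"
    using act.exists_small_orbit[OF prime_p _ card_isotropic_not_dvd ordQ] by auto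
  moreover have orb: "orbit ?Q (\<lambda>A. restrict ((*v) A) ?X) e = (\<lambda>A. A *v e) ` Q"
    using e by (auto simp: orbit_def)
  ultimately have dvd: "card ((\<lambda>A. A *v e) ` Q) dvd gam q" by simp
  \<comment> \<open>The scalars in \<open>Q\<close> already produce \<open>gam q\<close> distinct
    multiples of \<open>e\<close>; an orbit whose size divides \<open>gam q\<close> can contain
    nothing else.\<close>
  have line: "(\<lambda>A. A *v e) ` Q = (\<lambda>c. c *s e) ` Gam q"
  proof (rule sym, rule card_subset_eq)
    show "(\<lambda>c. c *s e) ` Gam q \<subseteq> (\<lambda>A. A *v e) ` Q"
      using scQ by (auto simp: scalars_eq mat_vector_mult[symmetric])
    have "inj_on (\<lambda>c. c *s e) (Gam q)" using e by (auto simp: inj_on_def vector_mul_rcancel)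
    hence c: "card ((\<lambda>c. c *s e) ` Gam q) = gam q" by (simp add: card_image card_Gam)
    have "gam q \<le> card ((\<lambda>A. A *v e) ` Q)"
      unfolding c[symmetric] using \<open>(\<lambda>c. c *s e) ` Gam q \<subseteq> (\<lambda>A. A *v e) ` Q\<close> by (intro card_mono) auto
    moreover have "card ((\<lambda>A. A *v e) ` Q) \<le> gam q"
      using dvd gam_cases by (intro dvd_imp_le) auto
    ultimately show "card ((\<lambda>c. c *s e) ` Gam q) = card ((\<lambda>A. A *v e) ` Q)" using c by simp
  qed simp
  obtain M M' where ad: "adapted M M'" and Me: "M *v axis 1 1 = e" using exists_adapted e by blast
  have "P \<subseteq> unipotent M M'"
  proof
    fix x assume x: "x \<in> P"
    hence "x \<in> carrier (PSU h)" using subgroup.subset[OF Psub] by blast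
    then obtain A where A: "A \<in> carrier (SU h)" "x = cs A" by (auto simp: PSU_carrier)
    hence "A \<in> Q" using x Q by simp
    hence "A *v e \<in> (\<lambda>c. c *s e) ` Gam q" using line by blast
    then obtain t where t: "t \<in> Gam q" "A *v e = t *s e" by blast
    obtain a b where ab: "herm a b" "A = EM M M' a b t"
      using line_stabiliser[OF ad A(1), of t] t Gam_nonzero Me by auto
    hence "x = EE M M' a b t" using A by (simp add: EE_def[OF ad])
    \<comment> \<open>The eigenvalue lies in \<open>Gam q\<close>, so it is absorbed by the scalars
      and the element is unipotent in \<open>PSU\<close>.\<close>
    also have "\<dots> = EE M M' a b 1" using EE_eq_iff[OF ad ab(1) Gam_nonzero[OF t(1)] ab(1), of 1] t by simp
    finally show "x \<in> unipotent M M'" using ab by (auto simp: unipotent_def[OF ad])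
  qed
  moreover have "finite (unipotent M M')"
    using finite_PSU finite_subset subgroup.subset[OF unipotent_subgroup[OF ad]] by blast
  ultimately have "P = unipotent M M'"
    using qP card_unipotent[OF ad] by (intro card_seteq) auto
  thus ?thesis using ad by blast
qed

theorem sylow_normaliser_borel:
  assumes P: "sylow_subgroup p (PSU h) P"
  shows "\<exists>E. borel p r q ((PSU h)\<lparr>carrier := normalizer (PSU h) P\<rparr>) (E :: 'f \<Rightarrow> 'f \<Rightarrow> 'f \<Rightarrow> _)"
proof -
  obtain M M' where ad: "adapted M M'" and PU: "P = unipotent M M'"
    using sylow_eq_unipotent[OF P] by blast
  let ?N = "normalizer (PSU h) P"
  have N: "?N = {EE M M' a b t | a b t. herm a b \<and> t \<noteq> 0}"
    unfolding PU by (rule normaliser_unipotent[OF ad])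
  have sub: "subgroup ?N (PSU h)"
    using PSU.normalizer_imp_subgroup subgroup.subset[OF unipotent_subgroup[OF ad]] PU by blast
  have "borel_axioms q ((PSU h)\<lparr>carrier := ?N\<rparr>) (EE M M')"
  proof
    fix a b t :: 'f assume "quadratic_field.herm q a b" "t \<noteq> 0"
    thus "EE M M' a b t \<in> carrier (PSU h\<lparr>carrier := ?N\<rparr>)" using N by auto
  next
    fix x assume "x \<in> carrier (PSU h\<lparr>carrier := ?N\<rparr>)"
    thus "\<exists>a b t. quadratic_field.herm q a b \<and> t \<noteq> 0 \<and> x = EE M M' a b t" using N by auto
  qed (simp_all add: EE_mult[OF ad] EE_eq_iff[OF ad])
  hence "borel p r q (PSU h\<lparr>carrier := ?N\<rparr>) (EE M M')"
    by (intro borel.intro quadratic_field_axioms PSU.subgroup_imp_group sub)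
  thus ?thesis by blast
qed

end

theorem proposition42:
  fixes p r q :: nat
    and h :: "'f::{field,finite} ^ 3 \<Rightarrow> 'f ^ 3 \<Rightarrow> 'f"
    and P :: "('f ^ 3 ^ 3) set set"
    and N :: "('f ^ 3 ^ 3) set monoid"
    and R :: "('k::field, ('f set variable \<Rightarrow>\<^sub>0 nat) \<Rightarrow>\<^sub>0 'k) module"
  assumes "Factorial_Ring.prime p" and "0 < r" and "q = p ^ r"
    and "CARD('f) = q ^ 2"
    and "CHAR('k) = p"
    and "nondegenerate_hermitian_form q h"
    and "sylow_subgroup p (PSU h) P"
    and "N = (PSU h)\<lparr>carrier := normalizer (PSU h) P\<rparr>"
    and "R = polynomial_algebra (variables q)"
  shows "algebra_isomorphic
           (centre_algebra (group_algebra N :: ('k, ('f ^ 3 ^ 3) set \<Rightarrow>\<^sub>0 'k) module))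
           (quotient_algebra R (Idl\<^bsub>R\<^esub> (relations q)))"
proof -
  interpret hermitian_space p r q "TYPE('f)" h
    by unfold_locales (use assms in auto)
  obtain E :: "'f \<Rightarrow> 'f \<Rightarrow> 'f \<Rightarrow> _" where "borel p r q N E"
    using sylow_normaliser_borel[OF assms(7)] assms(8) by blast
  then interpret borel_algebra p r q "TYPE('f)" N E "TYPE('k)"
    using assms(5) by (simp add: borel_algebra_def borel_algebra_axioms_def)
  show ?thesis unfolding assms(9) by (rule centre_presentation)
qed

end
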